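(* Let either $0<c<2$ and $R_{N,M}$ be the radius function of the discrete map $Z^c$, or $c=0$ and $R_{N,M}$ be the radius function of the discrete logarithm $\mathrm{Log}$ (all as defined in the context). Then there is a constant $K(c)$, independent of $N_0$, such that for every fixed integer $N_0$, $$R_{N_0,M}\simeq K(c)\,M^{c-1}\qquad\text{as } M\to\infty,$$ where $\simeq$ means the ratio of the two sides tends to $1$.
   Context: Let $\mathbb{Z}^2_+=\{(n,m)\in\mathbb{Z}^2:n,m\ge 0\}$. A map $f:\mathbb{Z}^2_+\to\mathbb{C}$ is a discrete conformal map if every elementary quadrilateral has cross-ratio $-1$: $$\frac{(f_{n,m}-f_{n+1,m})(f_{n+1,m+1}-f_{n,m+1})}{(f_{n+1,m}-f_{n+1,m+1})(f_{n,m+1}-f_{n,m})}=-1 .$$ Consider also the constraint, for all $(n,m)\in\mathbb{Z}^2_+$, $$c\, f_{n,m}=2n\frac{(f_{n+1,m}-f_{n,m})(f_{n,m}-f_{n-1,m})}{f_{n+1,m}-f_{n-1,m}}+2m\frac{(f_{n,m+1}-f_{n,m})(f_{n,m}-f_{n,m-1})}{f_{n,m+1}-f_{n,m-1}}\qquad(\ast)$$ (terms with coefficient $0$ omitted). For $0<c<2$, the discrete map $Z^c$ is the discrete conformal map satisfying $(\ast)$ with initial conditions $f_{0,0}=0$, $f_{1,0}=1$, $f_{0,1}=e^{c\pi i/2}$. The discrete map $Z^2$ is the discrete conformal map satisfying $(\ast)$ with $c=2$ (both equations understood after multiplying by their denominators) and initial conditions $f_{0,0}=f_{1,0}=f_{0,1}=0$,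 $f_{2,0}=1$, $f_{0,2}=-1$, $f_{1,1}=2i/\pi$. (The constraint determines $f_{n,0}$, $f_{0,m}$, and the cross-ratio equation then determines all $f_{n,m}$.) For such maps, when $n+m$ is even the four points $f_{n\pm1,m},f_{n,m\pm1}$ are equidistant from $f_{n,m}$. With $N=(n-m)/2$, $M=(n+m)/2$ (so pairs $(n,m)\in\mathbb{Z}^2_+$ with $n+m$ even correspond to integer pairs $(N,M)$ with $M\ge|N|$), the radius function of the map is $R_{N,M}=|f_{n+1,m}-f_{n,m}|$. The discrete logarithm $\mathrm{Log}$ is the discrete conformal map dual to $Z^2$; its radius function is $R^{\mathrm{Log}}_{N,M}=1/R^{Z^2}_{N,M}$, where $R^{Z^2}$ is the radius function of $Z^2$. *)

theory Defs
  imports Complex_Main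
begin

definition cross_ratio_cond :: "(nat \<Rightarrow> nat \<Rightarrow> complex) \<Rightarrow> bool" where
  "cross_ratio_cond f \<longleftrightarrow> (\<forall>n m.
     ((f n m - f (n+1) m) * (f (n+1) (m+1) - f n (m+1))) /
     ((f (n+1) m - f (n+1) (m+1)) * (f n (m+1) - f n m)) = -1)"

definition cross_ratio_cond_mult :: "(nat \<Rightarrow> nat \<Rightarrow> complex) \<Rightarrow> bool" where
  "cross_ratio_cond_mult f \<longleftrightarrow> (\<forall>n m.
     (f n m - f (n+1) m) * (f (n+1) (m+1) - f n (m+1)) =
     - ((f (n+1) m - f (n+1) (m+1)) * (f n (m+1) - f n m)))"

definition term_n :: "(nat \<Rightarrow> nat \<Rightarrow> complex) \<Rightarrow> nat \<Rightarrow> nat \<Rightarrow> complex" where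
  "term_n f n m = (if n = 0 then 0 else
     2 * of_nat n * ((f (n+1) m - f n m) * (f n m - f (n-1) m)) / (f (n+1) m - f (n-1) m))"

definition term_m :: "(nat \<Rightarrow> nat \<Rightarrow> complex) \<Rightarrow> nat \<Rightarrow> nat \<Rightarrow> complex" where
  "term_m f n m = (if m = 0 then 0 else
     2 * of_nat m * ((f n (m+1) - f n m) * (f n m - f n (m-1))) / (f n (m+1) - f n (m-1)))"

definition constraint_cond :: "real \<Rightarrow> (nat \<Rightarrow> nat \<Rightarrow> complex) \<Rightarrow> bool" where
  "constraint_cond c f \<longleftrightarrow> (\<forall>n m. of_real c * f n m = term_n f n m + term_m f n m)"

text \<open>Constraint (*) multiplied by its (present) denominators (used for Z^2).\<close>
definition constraint_cond_mult :: "real \<Rightarrow> (nat \<Rightarrow> nat \<Rightarrow> complex) \<Rightarrow> bool" where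
  "constraint_cond_mult c f \<longleftrightarrow> (\<forall>n m.
     (let A = f (n+1) m - f (n-1) m; B = f n (m+1) - f n (m-1);
          X = 2 * of_nat n * ((f (n+1) m - f n m) * (f n m - f (n-1) m));
          Y = 2 * of_nat m * ((f n (m+1) - f n m) * (f n m - f n (m-1)))
      in if n = 0 \<and> m = 0 then of_real c * f n m = 0
         else if n = 0 then of_real c * f n m * B = Y
         else if m = 0 then of_real c * f n m * A = X
         else of_real c * f n m * A * B = X * B + Y * A))"

definition is_Zc :: "real \<Rightarrow> (nat \<Rightarrow> nat \<Rightarrow> complex) \<Rightarrow> bool" where
  "is_Zc c f \<longleftrightarrow> cross_ratio_cond f \<and> constraint_cond c f \<and>
     f 0 0 = 0 \<and> f 1 0 = 1 \<and> f 0 1 = exp (of_real (c * pi / 2) * \<i>)"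

definition is_Z2 :: "(nat \<Rightarrow> nat \<Rightarrow> complex) \<Rightarrow> bool" where
  "is_Z2 f \<longleftrightarrow> cross_ratio_cond_mult f \<and> constraint_cond_mult 2 f \<and>
     f 0 0 = 0 \<and> f 1 0 = 0 \<and> f 0 1 = 0 \<and> f 2 0 = 1 \<and> f 0 2 = -1 \<and>
     f 1 1 = 2 * \<i> / of_real pi"

text \<open>Radius function: R_{N,M} = |f_{n+1,m} - f_{n,m}| with n = M+N, m = M-N (meaningful for M >= |N|).\<close>
definition radius :: "(nat \<Rightarrow> nat \<Rightarrow> complex) \<Rightarrow> int \<Rightarrow> int \<Rightarrow> real" where
  "radius f N M = cmod (f (nat (M+N) + 1) (nat (M-N)) - f (nat (M+N)) (nat (M-N)))"

end

theory Submission
  imports Defs "HOL-Complex_Analysis.Complex_Analysis"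
begin

text \<open>On the diagonal, \<open>f M M = \<epsilon> F\<close> and the edges at \<open>f M M\<close> are \<open>\<epsilon> r (cos \<alpha> \<mp> i sin \<alpha>)\<close> with
  \<open>\<epsilon> = exp (i \<pi> c / 4)\<close>. The constraint turns into a discrete Painleve II equation for the angle \<open>\<alpha>\<close>,
  and the ratio of consecutive radii is \<open>tan \<alpha>\<close>.

  Positivity: the edges are the values at \<open>z = \<plusminus> i\<close> of a function on the upper half plane that starts as
  \<open>z powr (- c / 2)\<close> and is transformed by a Moebius map at each diagonal step, as in the Schur algorithm. It
  stays in the class of functions with \<open>Im V \<le> 0\<close> and \<open>Im (z V) \<ge> 0\<close> by the Schwarz-Pick lemma, and it
  satisfies a Riccati equation from which the discrete Painleve equation identifies the next edge. Hence all
  angles lie in the open first quadrant, and then all radii of the pattern are positive.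

  Asymptotics: the discrete Painleve equation is monotone in the neighbouring angles, and
  comparison with equal neighbours gives \<open>|\<delta> M| \<le> max |\<delta> (M \<plusminus> 1)| / 3 + O(1 / M)\<close> for
  \<open>\<delta> = \<alpha> - \<pi> / 4\<close>, so \<open>\<delta> = O(1 / M)\<close>. Therefore \<open>F (M + 1) / F M = 1 + c / M + O(1 / M\<^sup>2)\<close>, which gives
  the diagonal \<open>N = 0\<close>; Schramm's equation for orthogonal circle patterns transports it to every \<open>N\<close>.\<close>

section \<open>The Schwarz-Pick lemma on the upper half plane\<close>

text \<open>The obstacle is positivity, not growth. Near \<open>\<alpha> = \<pi> / 4\<close> the
  linearised recursion is \<open>\<delta> (M + 1) = 6 * \<delta> M - \<delta> (M - 1)\<close> up to
  O(1 / M), so forward iteration multiplies an error by about \<open>3 + 2 * sqrt 2\<close>.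
  Estimates of the recursion alone therefore cannot keep the solution with the prescribed initial
  angle in the quadrant; the analytic function carries the exact information along. Its exponent
  comes from the first edge: divided by \<open>\<epsilon>\<close> it is exp (- i pi c / 4), the
  value of \<open>z powr (- c / 2)\<close> at i. Once the angles are known to be bounded, the same
  instability helps, because a bounded solution has to stay near the equilibrium. For c = 2 the
  power is 1 / z, and numerator and denominator of the first Schur step vanish identically; their
  first-order terms as the exponent tends to -1 involve the logarithm and serve as the starting
  function. The dual map Log is never built: only reciprocals of the radii of
  \<open>Z\<^sup>2\<close> are needed.\<close>

abbreviation upper :: "complex set" where
  "upper \<equiv> {z. 0 < Im z}"

lemma open_upper: "open upper"
  by (rule open_halfspace_Im_gt)

lemma connected_upper: "connected upper"
  by (rule convex_connected[OF convex_halfspace_Im_gt])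

text \<open>The Schur quotient is 0 / 0 at i, so its inequalities and equations are first proved
  away from i. Continuity then supplies the missing point.\<close>

lemma upper_limit_le:
  fixes g :: "complex \<Rightarrow> real"
  assumes "continuous_on upper g" and "\<And>z. z \<in> upper \<Longrightarrow> z \<noteq> \<i> \<Longrightarrow> g z \<le> 0"
  shows "g \<i> \<le> 0"
proof -
  have "isCont g \<i>"
    using assms(1) open_upper by (simp add: continuous_on_eq_continuous_at)
  then have *: "(g \<longlongrightarrow> g \<i>) (at \<i>)" by (simp add: isCont_def)
  have "\<forall>\<^sub>F z in at \<i>. z \<in> upper"
    by (rule eventually_at_in_open') (use open_upper in auto)
  then have "\<forall>\<^sub>F z in at \<i>. g z \<le> 0"
    using eventually_neq_at_within[of "\<i>" "\<i>" UNIV]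
    by eventually_elim (use assms(2) in auto)
  then show ?thesis by (intro tendsto_upperbound[OF *]) auto
qed

lemma upper_limit_eq:
  fixes g :: "complex \<Rightarrow> complex"
  assumes "continuous_on upper g" and "\<And>z. z \<in> upper \<Longrightarrow> z \<noteq> \<i> \<Longrightarrow> g z = 0"
  shows "g \<i> = 0"
proof -
  have "norm (g \<i>) \<le> 0"
    by (rule upper_limit_le[of "\<lambda>z. norm (g z)"]) (auto intro!: continuous_intros assms(1) simp: assms(2))
  then show ?thesis by simp
qed

text \<open>By the open mapping theorem a nonconstant map that reaches the real axis at an interior
  point would also take values below it.\<close>

lemma nonneg_Im_dichotomy:
  assumes "\<phi> holomorphic_on upper" "\<And>z. z \<in> upper \<Longrightarrow> 0 \<le> Im (\<phi> z)" "w \<in> upper" "Im (\<phi> w) = 0"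
  shows "\<phi> constant_on upper"
proof (rule ccontr)
  assume "\<not> \<phi> constant_on upper"
  then have "open (\<phi> ` upper)"
    by (intro open_mapping_thm[OF assms(1)] open_upper connected_upper) auto
  moreover have "\<phi> w \<in> \<phi> ` upper" using assms(3) by blast
  ultimately obtain e where e: "e > 0" "ball (\<phi> w) e \<subseteq> \<phi> ` upper"
    by (meson openE)
  have "\<phi> w - \<i> * (e/2) \<in> ball (\<phi> w) e"
    using e(1) by (simp add: dist_norm norm_mult)
  then obtain z where "z \<in> upper" "\<phi> z = \<phi> w - \<i> * (e/2)" using e(2) by (metis imageE subset_iff)
  then have "Im (\<phi> z) < 0" using assms(4) e(1) by simp
  with assms(2)[OF \<open>z \<in> upper\<close>] show False by simp
qed

text \<open>Cayley transforms \<open>m\<close> and \<open>k\<close> reduce both parts to the Schwarz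
  lemma for \<open>g\<close> on the disc. The inequality is \<open>|g (k z)| \<le> |k z|\<close>,
  squared and with common terms cancelled. The second part is the equality case:
  \<open>z \<mapsto> S + C z\<close> is the automorphism without rotation that sends i to
  \<open>\<phi> \<i>\<close>.\<close>

lemma schwarz_pick_upper:
  assumes holo: "\<phi> holomorphic_on upper" and nonneg: "\<And>z. z \<in> upper \<Longrightarrow> 0 \<le> Im (\<phi> z)"
    and at_i: "\<phi> \<i> = Complex S C" and "0 < C"
  shows "z \<in> upper \<Longrightarrow>
      Im z * ((cmod (\<phi> z - of_real S))\<^sup>2 + C\<^sup>2) \<le> Im (\<phi> z) * C * (1 + (cmod z)\<^sup>2)"
    and "(\<exists>z\<in>upper. z \<noteq> \<i> \<and> \<phi> z = of_real S + of_real C * z) \<or> deriv \<phi> \<i> = of_real C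
      \<Longrightarrow> \<forall>z\<in>upper. \<phi> z = of_real S + of_real C * z"
proof -
  have pos: "0 < Im (\<phi> z)" if "z \<in> upper" for z
  proof (rule ccontr)
    assume "\<not> 0 < Im (\<phi> z)"
    then have "Im (\<phi> z) = 0" using nonneg[OF that] by simp
    then have "\<phi> constant_on upper" using nonneg_Im_dichotomy holo nonneg that by blast
    then have "\<phi> z = \<phi> \<i>" using that unfolding constant_on_def by force
    with \<open>Im (\<phi> z) = 0\<close> at_i \<open>0 < C\<close> show False by simp
  qed
  define m :: "complex \<Rightarrow> complex" where "m = (\<lambda>z. \<i> * (1 + z) / (1 - z))"
  define k :: "complex \<Rightarrow> complex" where "k = (\<lambda>z. (z - \<i>) / (z + \<i>))"
  have ne1: "1 - z \<noteq> 0" if "norm z < 1" for z :: complex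
    using that by (metis norm_one order_less_irrefl right_minus_eq)
  have m_upper: "m z \<in> upper" if "norm z < 1" for z
  proof -
    have "Im (m z) = (1 - (cmod z)\<^sup>2) / (cmod (1 - z))\<^sup>2"
      unfolding m_def cmod_power2
      by (cases z) (simp add: Im_divide power2_eq_square algebra_simps)
    moreover have "(cmod z)\<^sup>2 < 1" using that by (simp add: abs_square_less_1)
    ultimately show ?thesis using ne1[OF that] by simp
  qed
  have zi: "z + \<i> \<noteq> 0" if "z \<in> upper" for z
    using that by (auto simp: complex_eq_iff)
  have k_disc: "norm (k z) < 1" if "z \<in> upper" for z
  proof -
    have "(cmod (z - \<i>))\<^sup>2 < (cmod (z + \<i>))\<^sup>2"
      using that unfolding cmod_power2 by (simp add: power2_eq_square algebra_simps)
    then have "cmod (z - \<i>) < cmod (z + \<i>)" by (rule power2_less_imp_less) simp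
    then show ?thesis using zi[OF that] by (simp add: k_def norm_divide)
  qed
  have mk: "m (k z) = z" if "z \<in> upper" for z
  proof -
    have "1 - k z = 2 * \<i> / (z + \<i>)" "1 + k z = 2 * z / (z + \<i>)"
      using zi[OF that] by (auto simp: k_def field_simps)
    then show ?thesis using zi[OF that] by (simp add: m_def)
  qed
  define \<phi>0 where "\<phi>0 = Complex S C"
  define g where "g = (\<lambda>z. (\<phi> (m z) - \<phi>0) / (\<phi> (m z) - cnj \<phi>0))"
  have den: "\<phi> z - cnj \<phi>0 \<noteq> 0" if "z \<in> upper" for z
    using pos[OF that] \<open>0 < C\<close> by (auto simp: \<phi>0_def complex_eq_iff)
  have m_holo: "m holomorphic_on ball 0 1"
    unfolding m_def by (intro holomorphic_intros) (use ne1 in auto)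
  have \<phi>m: "(\<lambda>z. \<phi> (m z)) holomorphic_on ball 0 1"
    using holomorphic_on_compose_gen[OF m_holo holo] m_upper by (force simp: o_def)
  have g_holo: "g holomorphic_on ball 0 1"
    unfolding g_def by (intro holomorphic_intros \<phi>m) (use den m_upper in auto)
  have g0: "g 0 = 0" by (simp add: g_def m_def at_i \<phi>0_def)
  have g_less: "norm (g z) < 1" if "norm z < 1" for z
  proof -
    have p: "0 < Im (\<phi> (m z))" using pos m_upper that by blast
    have "(cmod (\<phi> (m z) - \<phi>0))\<^sup>2 < (cmod (\<phi> (m z) - cnj \<phi>0))\<^sup>2"
      using mult_pos_pos[OF p \<open>0 < C\<close>] unfolding cmod_power2 \<phi>0_def
      by (simp add: power2_eq_square algebra_simps)
    then have "cmod (\<phi> (m z) - \<phi>0) < cmod (\<phi> (m z) - cnj \<phi>0)"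
      by (rule power2_less_imp_less) simp
    then show ?thesis by (simp add: g_def norm_divide divide_simps)
  qed
  note schwarz = Schwarz_Lemma[OF g_holo g0 g_less]
  show "Im z * ((cmod (\<phi> z - of_real S))\<^sup>2 + C\<^sup>2) \<le> Im (\<phi> z) * C * (1 + (cmod z)\<^sup>2)"
    if z: "z \<in> upper" for z
  proof -
    have "cmod (g (k z)) \<le> cmod (k z)" using schwarz(1) k_disc[OF z] by blast
    then have "cmod (\<phi> z - \<phi>0) * cmod (z + \<i>) \<le> cmod (z - \<i>) * cmod (\<phi> z - cnj \<phi>0)"
      unfolding g_def mk[OF z] norm_divide unfolding k_def norm_divide
      using den[OF z] zi[OF z] by (simp add: field_simps)
    then have "(cmod (\<phi> z - \<phi>0) * cmod (z + \<i>))\<^sup>2 \<le> (cmod (z - \<i>) * cmod (\<phi> z - cnj \<phi>0))\<^sup>2"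
      by (intro power_mono) auto
    then have "(cmod (\<phi> z - \<phi>0))\<^sup>2 * (cmod (z + \<i>))\<^sup>2 \<le> (cmod (z - \<i>))\<^sup>2 * (cmod (\<phi> z - cnj \<phi>0))\<^sup>2"
      by (simp add: power_mult_distrib)
    then show ?thesis
      unfolding cmod_power2 \<phi>0_def by (simp add: power2_eq_square algebra_simps)
  qed
  show "\<forall>z\<in>upper. \<phi> z = of_real S + of_real C * z"
    if ass: "(\<exists>z\<in>upper. z \<noteq> \<i> \<and> \<phi> z = of_real S + of_real C * z) \<or> deriv \<phi> \<i> = of_real C"
  proof -
    \<comment> \<open>In disc coordinates the automorphism \<open>S + C z\<close> is the identity,
      so rigidity amounts to showing that the Schwarz constant of \<open>g\<close> is 1.\<close>
    have aff: "(of_real S + of_real C * z - \<phi>0) / (of_real S + of_real C * z - cnj \<phi>0) = k z" 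
      if "z \<in> upper" for z
    proof -
      have "of_real S + of_real C * z - \<phi>0 = of_real C * (z - \<i>)"
        "of_real S + of_real C * z - cnj \<phi>0 = of_real C * (z + \<i>)"
        by (auto simp: \<phi>0_def complex_eq_iff algebra_simps)
      then show ?thesis using \<open>0 < C\<close> by (simp add: k_def)
    qed
    have "\<exists>\<alpha>. (\<forall>z. norm z < 1 \<longrightarrow> g z = \<alpha> * z) \<and> \<alpha> = 1"
    using ass proof
      assume "\<exists>z\<in>upper. z \<noteq> \<i> \<and> \<phi> z = of_real S + of_real C * z"
      then obtain z where z: "z \<in> upper" "z \<noteq> \<i>" "\<phi> z = of_real S + of_real C * z" by blast
      have gk: "g (k z) = k z" using aff[OF z(1)] z by (simp add: g_def mk)
      have k0: "k z \<noteq> 0" using z zi by (simp add: k_def)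
      have "\<exists>\<alpha>. (\<forall>z. norm z < 1 \<longrightarrow> g z = \<alpha> * z) \<and> norm \<alpha> = 1"
        using schwarz(3)[of 0] k_disc[OF z(1)] gk k0 by fastforce
      then obtain \<alpha> where \<alpha>: "\<forall>z. norm z < 1 \<longrightarrow> g z = \<alpha> * z" by blast
      then have "\<alpha> = 1" using gk k0 k_disc[OF z(1)] by simp
      with \<alpha> show ?thesis by blast
    next
      assume d: "deriv \<phi> \<i> = of_real C"
      have "(\<phi> has_field_derivative of_real C) (at \<i>)"
        using holomorphic_derivI[OF holo open_upper, of "\<i>"] d by simp
      moreover have m0: "m 0 = \<i>" by (simp add: m_def)
      moreover have "(m has_field_derivative 2 * \<i>) (at 0)"
        unfolding m_def by (auto intro!: derivative_eq_intros)
      ultimately have d\<phi>: "((\<lambda>z. \<phi> (m z)) has_field_derivative of_real C * (2 * \<i>)) (at 0)"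
        using DERIV_chain2[of \<phi> "of_real C" m 0 "2*\<i>" UNIV] by simp
      have "\<phi>0 - cnj \<phi>0 = of_real C * (2 * \<i>)"
        by (simp add: \<phi>0_def complex_eq_iff)
      with d\<phi> have "(g has_field_derivative 1) (at 0)"
        unfolding g_def
        using \<open>0 < C\<close>
        by (auto intro!: derivative_eq_intros simp: m0 at_i \<phi>0_def[symmetric])
      then have dg: "deriv g 0 = 1" by (rule DERIV_imp_deriv)
      then have "\<exists>\<alpha>. (\<forall>z. norm z < 1 \<longrightarrow> g z = \<alpha> * z) \<and> norm \<alpha> = 1"
        using schwarz(3)[of 0] by simp
      then obtain \<alpha> where \<alpha>: "\<forall>z. norm z < 1 \<longrightarrow> g z = \<alpha> * z" by blast
      have "((\<lambda>z. \<alpha> * z) has_field_derivative \<alpha>) (at 0)"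
        by (auto intro!: derivative_eq_intros)
      then have "(g has_field_derivative \<alpha>) (at 0)"
        by (rule has_field_derivative_transform_within_open[of _ _ _ "ball 0 1"]) (use \<alpha> in auto)
      then have "\<alpha> = 1" using dg DERIV_imp_deriv by blast
      with \<alpha> show ?thesis by blast
    qed
    then have g_id: "g z = z" if "norm z < 1" for z using that by auto
    show ?thesis
    proof
      fix z assume z: "z \<in> upper"
      have "(\<phi> z - \<phi>0) / (\<phi> z - cnj \<phi>0) = k z"
        using g_id[OF k_disc[OF z]] by (simp add: g_def mk[OF z])
      then have "(\<phi> z - \<phi>0) * (z + \<i>) = (z - \<i>) * (\<phi> z - cnj \<phi>0)"
        using den[OF z] zi[OF z] by (simp add: k_def field_simps)
      then have "\<phi> z * (2 * \<i>) = \<phi>0 * (z + \<i>) - cnj \<phi>0 * (z - \<i>)"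
        by (simp add: algebra_simps)
      also have "\<dots> = (of_real S + of_real C * z) * (2 * \<i>)"
        by (simp add: \<phi>0_def complex_eq_iff algebra_simps)
      finally show "\<phi> z = of_real S + of_real C * z" by simp
    qed
  qed
qed

text \<open>Dividing both functions by \<open>z - \<i>\<close> keeps them holomorphic, and the new
  denominator has the value \<open>deriv D \<i>\<close> at i, which is nonzero.\<close>

lemma removable_quotient:
  assumes N: "N holomorphic_on upper" "N \<i> = 0" and D: "D holomorphic_on upper" "D \<i> = 0"
    and nz: "\<And>z. z \<in> upper \<Longrightarrow> z \<noteq> \<i> \<Longrightarrow> D z \<noteq> 0" "deriv D \<i> \<noteq> 0"
  obtains U where "U holomorphic_on upper" "\<And>z. z \<in> upper \<Longrightarrow> z \<noteq> \<i> \<Longrightarrow> U z = N z / D z"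
proof
  define q where "q = (\<lambda>F z. if z = \<i> then deriv F \<i> else (F z - F \<i>) / (z - \<i>))"
  have qh: "q F holomorphic_on upper" if "F holomorphic_on upper" for F
    using pole_lemma_open[OF that open_upper, of "\<i>"] by (simp add: q_def)
  show "(\<lambda>z. q N z / q D z) holomorphic_on upper"
    by (intro holomorphic_intros qh N D) (use nz D(2) in \<open>auto simp: q_def\<close>)
  show "q N z / q D z = N z / D z" if "z \<in> upper" "z \<noteq> \<i>" for z
    using that nz(1)[OF that] by (simp add: q_def N D)
qed

section \<open>Schur steps for a Riccati equation\<close>

text \<open>The predicate \<open>level\<close> describes the normalized function after \<open>M\<close> Schur steps, with \<open>C = cos \<alpha>\<close> and
  \<open>S = sin \<alpha>\<close>. At \<open>z = i\<close> the right-hand side of the Riccati equation is a quadratic polynomial in \<open>V\<close>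
  whose roots are the next and the previous edge at the diagonal vertex; the condition on \<open>G C + H S\<close> says that
  its derivative at the root \<open>V i\<close> corresponds to the exponent \<open>M\<close>.\<close>

definition riccati :: "real \<Rightarrow> real \<Rightarrow> real \<Rightarrow> real \<Rightarrow> complex \<Rightarrow> complex \<Rightarrow> complex" where
  "riccati s G H E z v = - of_real s * (z\<^sup>2 + 1) * v - 2 * of_real G * (1 + z\<^sup>2 * v\<^sup>2)
     + 2 * of_real H * z * (v\<^sup>2 + 1) - 4 * of_real E * z * v"

definition level :: "real \<Rightarrow> nat \<Rightarrow> real \<Rightarrow> real \<Rightarrow> real \<Rightarrow> bool" where
  "level s M C S G \<longleftrightarrow> 0 < C \<and> 0 < S \<and> C\<^sup>2 + S\<^sup>2 = 1 \<and> 0 \<le> G \<and>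
     (\<exists>H V. G * C + H * S = real M / 2 \<and> V holomorphic_on upper \<and> V \<i> = Complex C (- S) \<and>
       (\<forall>z\<in>upper. Im (V z) \<le> 0 \<and> 0 \<le> Im (z * V z) \<and>
          z * (z\<^sup>2 + 1) * deriv V z = riccati s G H (H * C - G * S) z (V z)))"

text \<open>At i the left side of the Riccati equation vanishes, so \<open>U \<i>\<close> is a root
  of a quadratic whose coefficients the discrete Painleve data determine. The sign conditions select
  the root that belongs to the next edge and force it into the open quadrant.\<close>

lemma levelI:
  fixes C S C' S' :: real
  assumes holo: "U holomorphic_on upper"
    and U: "\<And>z. z \<in> upper \<Longrightarrow> z \<noteq> \<i> \<Longrightarrow> Im (U z) \<le> 0 \<and> 0 \<le> Im (z * U z) \<and>
      z * (z\<^sup>2 + 1) * deriv U z = riccati s G H (G * C - H * S) z (U z)"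
    and unit: "C\<^sup>2 + S\<^sup>2 = 1" "C'\<^sup>2 + S'\<^sup>2 = 1" and "0 < S" "C' \<noteq> 0" "0 < s" "0 \<le> G"
    and G: "G * (2 * (1 + S * C' + C * S')) = real (Suc M) * (C' + S)"
    and H: "H * (2 * (1 + S * C' + C * S')) = real (Suc M) * (S' + C)"
    and \<sigma>: "1 + S * C' + C * S' \<noteq> 0"
  shows "level s (Suc M) C' S' G"
proof -
  have Uc: "continuous_on upper U" using holo by (rule holomorphic_on_imp_continuous_on)
  have dU: "deriv U holomorphic_on upper" using holo open_upper by (rule holomorphic_deriv)
  have dUc: "continuous_on upper (deriv U)" using dU by (rule holomorphic_on_imp_continuous_on)
  have Im1: "Im (U z) \<le> 0" if "z \<in> upper" for z
    using that U upper_limit_le[of "\<lambda>z. Im (U z)"] by (cases "z = \<i>") (auto intro!: continuous_intros Uc)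
  have Im2: "0 \<le> Im (z * U z)" if "z \<in> upper" for z
  proof (cases "z = \<i>")
    case True
    have "- Im (\<i> * U \<i>) \<le> 0"
    proof (rule upper_limit_le[of "\<lambda>z. - Im (z * U z)"])
      show "continuous_on upper (\<lambda>z. - Im (z * U z))" by (intro continuous_intros Uc)
      show "- Im (z * U z) \<le> 0" if "z \<in> upper" "z \<noteq> \<i>" for z using U[OF that] by simp
    qed
    with True show ?thesis by simp
  qed (use that U in blast)
  have ode: "z * (z\<^sup>2 + 1) * deriv U z = riccati s G H (G * C - H * S) z (U z)" if "z \<in> upper" for z
  proof (cases "z = \<i>")
    case True
    have "(\<lambda>z. z * (z\<^sup>2 + 1) * deriv U z - riccati s G H (G * C - H * S) z (U z)) \<i> = 0"
    proof (rule upper_limit_eq)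
      show "continuous_on upper (\<lambda>z. z * (z\<^sup>2 + 1) * deriv U z - riccati s G H (G * C - H * S) z (U z))"
        unfolding riccati_def by (intro continuous_intros Uc dUc)
      show "z * (z\<^sup>2 + 1) * deriv U z - riccati s G H (G * C - H * S) z (U z) = 0"
        if "z \<in> upper" "z \<noteq> \<i>" for z using U[OF that] by simp
    qed
    with True show ?thesis by simp
  qed (use that U in blast)
  \<comment> \<open>\<open>G\<close> and \<open>H\<close> share this factor, which makes sum and
    product of the two candidate roots checkable by algebra.\<close>
  define k where "k = real (Suc M) / (2 * (1 + S * C' + C * S'))"
  have Gk: "G = k * (C' + S)" and Hk: "H = k * (S' + C)"
    using G H \<sigma> by (simp_all add: k_def field_simps)
  have k\<sigma>: "k * (2 * (1 + S * C' + C * S')) = real (Suc M)" using \<sigma> by (simp add: k_def)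
  have "k \<noteq> 0" using \<sigma> by (simp add: k_def)
  define u where "u = U \<i>"
  have "riccati s G H (G * C - H * S) \<i> u = 0" using ode[of \<i>] by (simp add: u_def)
  then have "2 * ((of_real G + \<i> * of_real H) * (u - Complex (- S) C) * (u - Complex C' (- S'))) = 0"
  proof -
    have "riccati s G H (G * C - H * S) \<i> u =
      2 * ((of_real G + \<i> * of_real H) * (u - Complex (- S) C) * (u - Complex C' (- S')))"
    proof -
      have sum: "(of_real G + \<i> * of_real H) * (Complex (- S) C + Complex C' (- S')) = 2 * \<i> * of_real (G * C - H * S)"
        using unit unfolding Gk Hk complex_eq_iff by (simp, algebra)
      have prod: "(of_real G + \<i> * of_real H) * (Complex (- S) C * Complex C' (- S')) = - (of_real G - \<i> * of_real H)"
        using unit unfolding Gk Hk complex_eq_iff by (simp, algebra)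
      have "(of_real G + \<i> * of_real H) * (u - Complex (- S) C) * (u - Complex C' (- S')) =
         (of_real G + \<i> * of_real H) * u\<^sup>2
         - u * ((of_real G + \<i> * of_real H) * (Complex (- S) C + Complex C' (- S')))
         + (of_real G + \<i> * of_real H) * (Complex (- S) C * Complex C' (- S'))"
        by (simp add: algebra_simps power2_eq_square)
      also have "\<dots> = (of_real G + \<i> * of_real H) * u\<^sup>2 - u * (2 * \<i> * of_real (G * C - H * S))
          - (of_real G - \<i> * of_real H)"
        by (simp only: sum prod) simp
      finally have eq: "(of_real G + \<i> * of_real H) * (u - Complex (- S) C) * (u - Complex C' (- S')) = \<dots>" .
      show ?thesis unfolding eq by (simp add: riccati_def algebra_simps power2_eq_square)
    qed
    with \<open>riccati s G H (G * C - H * S) \<i> u = 0\<close> show ?thesis by simp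
  qed
  moreover have "of_real G + \<i> * of_real H \<noteq> 0"
  proof
    assume "of_real G + \<i> * of_real H = 0"
    then have "G = 0" "H = 0" by (simp_all add: complex_eq_iff)
    then have "C' + S = 0" "S' + C = 0" using Gk Hk \<open>k \<noteq> 0\<close> by auto
    then have "C' = - S" "S' = - C" by simp_all
    then show False using \<sigma> unit by (simp add: power2_eq_square)
  qed
  \<comment> \<open>This root is the previous edge traversed backwards. Its real part is
    \<open>- S < 0\<close>, while \<open>Im (\<i> * U \<i>) \<ge> 0\<close> says that the real part
    of \<open>U \<i>\<close> is nonnegative.\<close>
  moreover have "u \<noteq> Complex (- S) C"
    using Im2[of \<i>] \<open>0 < S\<close> by (auto simp: u_def)
  ultimately have u: "u = Complex C' (- S')" by simp
  have "C' > 0" "S' \<ge> 0"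
    using Im1[of \<i>] Im2[of \<i>] u \<open>C' \<noteq> 0\<close> by (simp_all add: u_def)
  \<comment> \<open>A real value at i makes \<open>U\<close> constant, hence equal to 1; the real
    part of the Riccati equation at 2i then reads \<open>s + 2 * G = 0\<close>.\<close>
  moreover have "S' \<noteq> 0"
  proof
    assume "S' = 0"
    then have "C' = 1" using unit \<open>C' > 0\<close> by (simp add: power2_eq_1_iff)
    have "(\<lambda>z. - U z) constant_on upper"
      by (rule nonneg_Im_dichotomy[of _ \<i>]) (use Im1 u \<open>S' = 0\<close> holo in \<open>auto intro!: holomorphic_intros simp: u_def\<close>)
    then obtain c where c: "\<forall>z\<in>upper. - U z = c" by (auto simp: constant_on_def)
    have U1: "U z = 1" if "z \<in> upper" for z
    proof -
      have "- U z = - U \<i>" using c that by simp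
      then show ?thesis using u \<open>S' = 0\<close> \<open>C' = 1\<close> by (simp add: u_def complex_eq_iff)
    qed
    have "((\<lambda>z. 1) has_field_derivative 0) (at (2 * \<i>))" by simp
    then have "(U has_field_derivative 0) (at (2 * \<i>))"
      by (rule has_field_derivative_transform_within_open[OF _ open_upper]) (use U1 in auto)
    then have "deriv U (2 * \<i>) = 0" by (rule DERIV_imp_deriv)
    then have "riccati s G H (G * C - H * S) (2 * \<i>) 1 = 0" using ode[of "2 * \<i>"] U1[of "2 * \<i>"] by simp
    then have "s + 2 * G = 0" by (simp add: riccati_def complex_eq_iff power2_eq_square)
    then show False using \<open>0 < s\<close> \<open>0 \<le> G\<close> by simp
  qed
  moreover have "G * C' + H * S' = real (Suc M) / 2"
    using k\<sigma> unit unfolding Gk Hk by (simp, algebra)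
  moreover have "H * C' - G * S' = G * C - H * S"
    unfolding Gk Hk by (simp add: algebra_simps)
  ultimately show ?thesis
    unfolding level_def using holo Im1 Im2 ode u unit \<open>0 \<le> G\<close>
    by (auto simp: u_def intro!: exI[of _ H] exI[of _ U])
qed

text \<open>One step of the Schur algorithm: \<open>N / D\<close> is a Moebius image of
  \<open>V\<close> in which both parts vanish at i because \<open>V \<i> = C - i S\<close>. The two
  Schwarz-Pick inequalities, for \<open>- V\<close> and for \<open>z * V\<close>, say exactly that
  the quotient keeps the two sign conditions, and the form of the Riccati equation is
  invariant.\<close>

lemma level_step:
  assumes lev: "level s M C S G" and "0 < s" and G': "G' = (G * C + s / 2) / S"
    and unit': "C'\<^sup>2 + S'\<^sup>2 = 1" and "C' \<noteq> 0" and \<sigma>: "1 + S * C' + C * S' \<noteq> 0"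
    and dPII: "G' * (2 * (1 + S * C' + C * S')) = real (Suc M) * (C' + S)"
  shows "level s (Suc M) C' S' G'"
proof -
  obtain H V where "0 < C" "0 < S" and unit: "C\<^sup>2 + S\<^sup>2 = 1" and "0 \<le> G"
    and GH: "G * C + H * S = real M / 2" and holo: "V holomorphic_on upper"
    and Vi: "V \<i> = Complex C (- S)"
    and Im1: "\<And>z. z \<in> upper \<Longrightarrow> Im (V z) \<le> 0" and Im2: "\<And>z. z \<in> upper \<Longrightarrow> 0 \<le> Im (z * V z)"
    and ode: "\<And>z. z \<in> upper \<Longrightarrow> z * (z\<^sup>2 + 1) * deriv V z = riccati s G H (H * C - G * S) z (V z)"
    using lev unfolding level_def by blast
  \<comment> \<open>With this choice \<open>G' * S + H' * C\<close> exceeds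
    \<open>G * C + H * S\<close> by 1 / 2, which raises the exponent from \<open>M\<close> to
    \<open>Suc M\<close>.\<close>
  define H' where "H' = (H * S + (1 - s) / 2) / C"
  have GS: "G' * S = G * C + s / 2" and HC: "H' * C = H * S + (1 - s) / 2"
    using \<open>0 < C\<close> \<open>0 < S\<close> by (simp_all add: G' H'_def)
  have dV: "(V has_field_derivative deriv V z) (at z)" if "z \<in> upper" for z
    using holomorphic_derivI[OF holo open_upper that] .
  define N where "N = (\<lambda>z. (of_real C + z * of_real S) * V z - 1)"
  define D where "D = (\<lambda>z. of_real S + z * of_real C - z * V z)"
  have \<phi>h: "(\<lambda>z. z * V z) holomorphic_on upper" by (intro holomorphic_intros holo)
  have \<phi>i: "\<i> * V \<i> = Complex S C" by (simp add: Vi complex_eq_iff)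
  \<comment> \<open>In the extremal case of Schwarz-Pick \<open>D\<close> would vanish identically.
    The Riccati equation rules it out: its instances at i and 2i differ by a multiple of
    \<open>C * (s + 2 * G * C)\<close>, which is positive.\<close>
  have not_aff: "\<not> (\<forall>z\<in>upper. z * V z = of_real S + of_real C * z)"
  proof
    assume aff: "\<forall>z\<in>upper. z * V z = of_real S + of_real C * z"
    have V_eq: "V z = of_real S / z + of_real C" if "z \<in> upper" for z
    proof -
      have "z \<noteq> 0" using that by auto
      then have "V z = z * V z / z" by simp
      also have "\<dots> = (of_real S + of_real C * z) / z" using aff that by simp
      also have "\<dots> = of_real S / z + of_real C" using \<open>z \<noteq> 0\<close> by (simp add: field_simps)
      finally show ?thesis .
    qed
    have "deriv V z = - of_real S / z\<^sup>2" if z: "z \<in> upper" for z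
    proof -
      have "((\<lambda>z. of_real S / z + of_real C) has_field_derivative - of_real S / z\<^sup>2) (at z)"
        using z by (auto intro!: derivative_eq_intros simp: power2_eq_square)
      then have "(V has_field_derivative - of_real S / z\<^sup>2) (at z)"
        by (rule has_field_derivative_transform_within_open[OF _ open_upper z]) (simp add: V_eq)
      then show ?thesis by (rule DERIV_imp_deriv)
    qed
    then have id: "- of_real S * (z\<^sup>2 + 1) = z * riccati s G H (H * C - G * S) z (of_real S / z + of_real C)"
      if "z \<in> upper" for z
    proof -
      have "z \<noteq> 0" using that by auto
      then have "- of_real S * (z\<^sup>2 + 1) = z * (z * (z\<^sup>2 + 1) * (- of_real S / z\<^sup>2))"
        by (simp add: power2_eq_square)
      also have "z * (z\<^sup>2 + 1) * (- of_real S / z\<^sup>2) = z * (z\<^sup>2 + 1) * deriv V z"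
        using \<open>\<And>z. z \<in> upper \<Longrightarrow> deriv V z = _\<close>[OF that] by simp
      finally show ?thesis unfolding ode[OF that] V_eq[OF that] .
    qed
    define E where "E = H * C - G * S"
    have "Im (\<i> * riccati s G H E \<i> (of_real S / \<i> + of_real C)) = 0"
      unfolding E_def by (subst id[of "\<i>", symmetric]) simp_all
    then have 1: "- 2 * G * (1 - C * C + S * S) + 4 * H * C * S - 4 * E * S = 0"
      by (simp add: riccati_def power2_eq_square algebra_simps)
    have "Im (2 * \<i> * riccati s G H E (2 * \<i>) (of_real S / (2 * \<i>) + of_real C)) = 0"
      unfolding E_def by (subst id[of "2 * \<i>", symmetric]) simp_all
    then have 2: "3 * s * C - 2 * G * (1 - 4 * C * C + S * S) + 4 * H * C * S - 4 * E * S = 0"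
      by (simp add: riccati_def power2_eq_square algebra_simps)
    have "C * (s + 2 * G * C) = 0"
      using 1 2 by (simp add: algebra_simps)
    then show False using \<open>0 < C\<close> \<open>0 < s\<close> \<open>0 \<le> G\<close> 
      by (smt (verit) mult_eq_0_iff mult_nonneg_nonneg)
  qed
  note rigid = schwarz_pick_upper(2)[OF \<phi>h Im2 \<phi>i \<open>0 < C\<close>]
  have D0: "D z \<noteq> 0" if "z \<in> upper" "z \<noteq> \<i>" for z
  proof
    assume "D z = 0"
    then have "z * V z = of_real S + of_real C * z" by (simp add: D_def algebra_simps)
    with that rigid not_aff show False by blast
  qed
  have "((\<lambda>z. z * V z) has_field_derivative V \<i> + \<i> * deriv V \<i>) (at \<i>)"
    by (rule derivative_eq_intros dV refl | simp)+
  then have \<phi>': "deriv (\<lambda>z. z * V z) \<i> = V \<i> + \<i> * deriv V \<i>" by (rule DERIV_imp_deriv)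
  have dD: "(D has_field_derivative of_real C - (V z + z * deriv V z)) (at z)" if "z \<in> upper" for z
    unfolding D_def by (rule derivative_eq_intros dV refl that | simp)+
  have dN: "(N has_field_derivative of_real S * V z + (of_real C + z * of_real S) * deriv V z) (at z)"
    if "z \<in> upper" for z
    unfolding N_def by (rule derivative_eq_intros dV refl that | simp)+
  have D1: "deriv D \<i> \<noteq> 0"
  proof
    assume "deriv D \<i> = 0"
    then have "deriv (\<lambda>z. z * V z) \<i> = of_real C"
      using DERIV_imp_deriv[OF dD[of \<i>]] by (simp add: \<phi>')
    with rigid not_aff show False by blast
  qed
  have Di: "D \<i> = 0" by (simp add: D_def Vi complex_eq_iff)
  have Ni: "N \<i> = 0" using unit by (simp add: N_def Vi complex_eq_iff power2_eq_square)
  have DN: "D holomorphic_on upper" "N holomorphic_on upper"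
    unfolding D_def N_def by (intro holomorphic_intros holo)+
  obtain U where Uh: "U holomorphic_on upper" and U: "\<And>z. z \<in> upper \<Longrightarrow> z \<noteq> \<i> \<Longrightarrow> U z = N z / D z"
    using removable_quotient[OF DN(2) Ni DN(1) Di D0 D1] by metis
  show ?thesis
  proof (rule levelI[OF Uh _ unit unit' \<open>0 < S\<close> \<open>C' \<noteq> 0\<close> \<open>0 < s\<close> _ dPII _ \<sigma>, where H = H'])
    have "0 \<le> G * C + s / 2" using \<open>0 \<le> G\<close> \<open>0 < C\<close> \<open>0 < s\<close> by simp
    then show "0 \<le> G'" using \<open>0 < S\<close> by (simp add: G')
    have "G' * S + H' * C = real (Suc M) / 2" using GH unfolding GS HC by (simp add: field_simps)
    then have "C * (H' * (2 * (1 + S * C' + C * S'))) = C * (real (Suc M) * (S' + C))"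
      using dPII unit by algebra
    then show "H' * (2 * (1 + S * C' + C * S')) = real (Suc M) * (S' + C)"
      using \<open>0 < C\<close> by simp
    fix z assume z: "z \<in> upper" "z \<noteq> \<i>"
    have "z \<noteq> 0" using z(1) by auto
    have Dz: "D z \<noteq> 0" using D0 z by blast
    have q: "0 < Im z" using z by simp
    have UD: "U z * (cmod (D z))\<^sup>2 = N z * cnj (D z)"
    proof -
      have "U z * (cmod (D z))\<^sup>2 = U z * D z * cnj (D z)"
        by (simp only: complex_norm_square mult.assoc)
      then show ?thesis using U[OF z] Dz by simp
    qed
    show "Im (U z) \<le> 0 \<and> 0 \<le> Im (z * U z) \<and>
      z * (z\<^sup>2 + 1) * deriv U z = riccati s G' H' (G' * C - H' * S) z (U z)"
    proof (intro conjI)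
      \<comment> \<open>Schwarz-Pick is applied to \<open>- V\<close>, whose value at i is
        \<open>- C + i S\<close>; hence \<open>- C\<close> and \<open>S\<close> take the places of
        \<open>S\<close> and \<open>C\<close>.\<close>
      have sp: "Im z * ((cmod (- V z - of_real (- C)))\<^sup>2 + S\<^sup>2) \<le> Im (- V z) * S * (1 + (cmod z)\<^sup>2)"
        by (rule schwarz_pick_upper(1)[of "\<lambda>z. - V z" "- C" S])
          (use Im1 Vi \<open>0 < S\<close> z in \<open>auto intro!: holomorphic_intros holo simp: complex_eq_iff\<close>)
      have "Im (U z) * (cmod (D z))\<^sup>2 = Im (N z * cnj (D z))"
        unfolding UD[symmetric] by simp
      also have "\<dots> = C * (Im z * ((cmod (- V z - of_real (- C)))\<^sup>2 + S\<^sup>2) - Im (- V z) * S * (1 + (cmod z)\<^sup>2))"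
        using unit unfolding cmod_power2 N_def D_def by (simp, algebra)
      also have "\<dots> \<le> 0" using sp \<open>0 < C\<close> by (simp add: mult_le_0_iff)
      finally show "Im (U z) \<le> 0" using Dz by (simp add: mult_le_0_iff)
      have sp: "Im z * ((cmod (z * V z - of_real S))\<^sup>2 + C\<^sup>2) \<le> Im (z * V z) * C * (1 + (cmod z)\<^sup>2)"
        by (rule schwarz_pick_upper(1)[OF \<phi>h Im2 \<phi>i \<open>0 < C\<close> z(1)])
      have "Im (z * U z) * (cmod (D z))\<^sup>2 = Im (z * (N z * cnj (D z)))"
        unfolding UD[symmetric] by (simp add: algebra_simps)
      also have "\<dots> = S * (Im (z * V z) * C * (1 + (cmod z)\<^sup>2) - Im z * ((cmod (z * V z - of_real S))\<^sup>2 + C\<^sup>2))"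
        using unit unfolding cmod_power2 N_def D_def by (simp, algebra)
      also have "\<dots> \<ge> 0" using sp \<open>0 < S\<close> by simp
      finally show "0 \<le> Im (z * U z)" using Dz by (simp add: zero_le_mult_iff)
      have "((\<lambda>z. N z / D z) has_field_derivative
          ((of_real S * V z + (of_real C + z * of_real S) * deriv V z) * D z
            - N z * (of_real C - (V z + z * deriv V z))) / (D z * D z)) (at z)"
        by (rule DERIV_divide[OF dN dD]) (use z Dz in auto)
      then have "(U has_field_derivative
          ((of_real S * V z + (of_real C + z * of_real S) * deriv V z) * D z
            - N z * (of_real C - (V z + z * deriv V z))) / (D z * D z)) (at z)"
        by (rule has_field_derivative_transform_within_open[of _ _ _ "upper - {\<i>}"])
          (use z U open_upper in \<open>auto intro: open_delete\<close>)
      then have dU: "deriv U z = ((of_real S * V z + (of_real C + z * of_real S) * deriv V z) * D z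
            - N z * (of_real C - (V z + z * deriv V z))) / (D z * D z)" by (rule DERIV_imp_deriv)
      define v d where "v = V z" and "d = deriv V z"
      define cC cS cG cH cs cG' cH' :: complex where "cC = of_real C" and "cS = of_real S" and "cG = of_real G"
        and "cH = of_real H" and "cs = of_real s" and "cG' = of_real G'" and "cH' = of_real H'"
      have e1: "cC^2 + cS^2 = 1" using arg_cong[OF unit, of complex_of_real] by (simp add: cC_def cS_def)
      have e2: "cG' * cS = cG * cC + cs / 2" using arg_cong[OF GS, of complex_of_real]
        by (simp add: cC_def cS_def cG_def cG'_def cs_def)
      have e3: "cH' * cC = cH * cS + (1 - cs) / 2" using arg_cong[OF HC, of complex_of_real]
        by (simp add: cC_def cS_def cH_def cH'_def cs_def)
      have e4: "z * (z\<^sup>2 + 1) * d = - cs * (z\<^sup>2 + 1) * v - 2 * cG * (1 + z\<^sup>2 * v\<^sup>2)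
         + 2 * cH * z * (v\<^sup>2 + 1) - 4 * (cH * cC - cG * cS) * z * v"
        using ode[OF z(1)] by (simp add: riccati_def v_def d_def cC_def cS_def cG_def cH_def cs_def)
      define n where "n = (cC + z * cS) * v - 1"
      define b where "b = cS + z * cC - z * v"
      have nb: "N z = n" "D z = b" by (simp_all add: n_def b_def N_def D_def cC_def cS_def v_def)
      have "z * (z\<^sup>2 + 1) * ((cS * v + (cC + z * cS) * d) * b - n * (cC - (v + z * d))) =
        - cs * (z\<^sup>2 + 1) * n * b - 2 * cG' * (b\<^sup>2 + z\<^sup>2 * n\<^sup>2) + 2 * cH' * z * (n\<^sup>2 + b\<^sup>2)
        - 4 * (cG' * cC - cH' * cS) * z * n * b" (is "?L = ?R")
      proof -
        \<comment> \<open>The coefficient of \<open>d\<close> collapses to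
          \<open>cC * cS * (z\<^sup>2 + 1)\<close>, the determinant of the Moebius map. Its factor
          \<open>z\<^sup>2 + 1\<close> allows the differential equation \<open>e4\<close> for
          \<open>V\<close> to be inserted.\<close>
        have "?L = cC * cS * (z\<^sup>2 + 1) * (z * (z\<^sup>2 + 1) * d) + z * (z\<^sup>2 + 1) * (cS * v * b - n * (cC - v))"
          using e1 unfolding n_def b_def by algebra
        also have "\<dots> = ?R" unfolding e4 n_def b_def using e1 e2 e3 by algebra
        finally show ?thesis .
      qed
      moreover have "deriv U z * (b * b) = (cS * v + (cC + z * cS) * d) * b - n * (cC - (v + z * d))"
        using Dz unfolding dU nb by (simp add: cC_def cS_def v_def d_def)
      moreover have "riccati s G' H' (G' * C - H' * S) z (U z) * (b * b) = - cs * (z\<^sup>2 + 1) * n * b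
          - 2 * cG' * (b\<^sup>2 + z\<^sup>2 * n\<^sup>2) + 2 * cH' * z * (n\<^sup>2 + b\<^sup>2) - 4 * (cG' * cC - cH' * cS) * z * n * b"
      proof -
        have "n = U z * b" using U[OF z] Dz by (simp add: nb)
        then show ?thesis
          by (simp add: riccati_def cC_def cS_def cG'_def cH'_def cs_def algebra_simps power2_eq_square)
      qed
      ultimately have "z * (z\<^sup>2 + 1) * deriv U z * (b * b) = riccati s G' H' (G' * C - H' * S) z (U z) * (b * b)"
        by (simp only: mult.assoc)
      then show "z * (z\<^sup>2 + 1) * deriv U z = riccati s G' H' (G' * C - H' * S) z (U z)"
        using Dz by (simp add: nb)
    qed
  qed
qed

section \<open>Starting functions for the Schur steps: powers and the logarithm\<close>

lemma upper_Ln: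
  assumes "z \<in> upper"
  shows "z \<noteq> 0" "z \<notin> \<real>\<^sub>\<le>\<^sub>0" "0 < Im (Ln z)" "Im (Ln z) < pi" "exp (Ln z) = z"
proof -
  show "z \<noteq> 0" using assms by auto
  then show "exp (Ln z) = z" by simp
  show "z \<notin> \<real>\<^sub>\<le>\<^sub>0" using assms by (auto simp: complex_nonpos_Reals_iff)
  show "0 < Im (Ln z)" "Im (Ln z) < pi" using Im_Ln_pos_lt[OF \<open>z \<noteq> 0\<close>] assms by auto
qed

text \<open>For \<open>z\<close> with argument \<open>\<theta>\<close> in (0, pi) the function and
  its product with \<open>z\<close> have arguments \<open>- s * \<theta>\<close> and
  \<open>(1 - s) * \<theta>\<close>, which gives both sign conditions. The witness is
  \<open>H = 0\<close>, so the Riccati equation reduces to the linear one for a power.\<close>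

lemma level_power:
  assumes "0 < s" "s < 1"
  shows "level s 0 (cos (pi * s / 2)) (sin (pi * s / 2)) 0"
proof -
  define V where "V = (\<lambda>z. exp (- of_real s * Ln z))"
  have dV: "(V has_field_derivative - of_real s / z * V z) (at z)" if "z \<in> upper" for z
    unfolding V_def using upper_Ln[OF that] by (auto intro!: derivative_eq_intros simp: field_simps)
  have holo: "V holomorphic_on upper"
    using dV by (auto simp: holomorphic_on_open[OF open_upper])
  have Vi: "V \<i> = Complex (cos (pi * s / 2)) (- sin (pi * s / 2))"
    by (simp add: V_def complex_eq_iff Re_exp Im_exp algebra_simps)
  have sgn: "Im (V z) \<le> 0 \<and> 0 \<le> Im (z * V z)" if z: "z \<in> upper" for z
  proof
    have "s * Im (Ln z) \<le> 1 * pi" "(1 - s) * Im (Ln z) \<le> 1 * pi"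
      using upper_Ln[OF z] assms by (intro mult_mono; simp)+
    then have "0 \<le> sin (s * Im (Ln z))" "0 \<le> sin ((1 - s) * Im (Ln z))"
      using upper_Ln[OF z] assms by (auto intro!: sin_ge_zero)
    then show "Im (V z) \<le> 0" by (simp add: V_def Im_exp)
    have "z * V z = exp (Ln z) * V z" using upper_Ln(5)[OF z] by simp
    also have "\<dots> = exp (of_real (1 - s) * Ln z)"
      unfolding V_def by (simp add: exp_add[symmetric] algebra_simps)
    finally show "0 \<le> Im (z * V z)" using \<open>0 \<le> sin ((1 - s) * Im (Ln z))\<close> by (simp add: Im_exp)
  qed
  have "z * (z\<^sup>2 + 1) * deriv V z = riccati s 0 0 0 z (V z)" if z: "z \<in> upper" for z
    using upper_Ln(1)[OF z] DERIV_imp_deriv[OF dV[OF z]] by (simp add: riccati_def)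
  moreover have "0 < cos (pi * s / 2)" "0 < sin (pi * s / 2)"
  proof -
    have "pi * s < pi * 1" using assms by (intro mult_strict_left_mono) auto
    moreover have "0 < pi * s" using assms by simp
    moreover have "- pi < pi * s" using \<open>0 < pi * s\<close> pi_gt_zero by linarith
    ultimately show "0 < cos (pi * s / 2)" "0 < sin (pi * s / 2)"
      by (auto intro!: cos_gt_zero_pi sin_gt_zero)
  qed
  ultimately show ?thesis
    unfolding level_def using holo Vi sgn by (auto intro!: exI[of _ 0] exI[of _ V])
qed

lemma cosh_le_one_plus: "cosh (x::real) \<le> 1 + x * sinh x"
proof -
  have "cosh \<bar>x\<bar> - \<bar>x\<bar> * sinh \<bar>x\<bar> \<le> cosh 0 - 0 * sinh (0::real)"
    by (rule DERIV_nonpos_imp_nonincreasing[of 0 "\<bar>x\<bar>" "\<lambda>x. cosh x - x * sinh x"])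
       (auto intro!: derivative_eq_intros exI simp: mult_nonneg_nonneg)
  then show ?thesis by (cases "0 \<le> x") auto
qed

lemma x_cos_le_sin:
  assumes "0 \<le> \<theta>" "\<theta> \<le> pi"
  shows "\<theta> * cos \<theta> \<le> sin \<theta>"
proof -
  have "sin 0 - 0 * cos 0 \<le> sin \<theta> - \<theta> * cos \<theta>"
  proof (rule DERIV_nonneg_imp_nondecreasing[OF assms(1)])
    fix x assume "0 \<le> x" "x \<le> \<theta>"
    then have "0 \<le> x * sin x" using assms by (intro mult_nonneg_nonneg sin_ge_zero) auto
    moreover have "((\<lambda>x. sin x - x * cos x) has_real_derivative x * sin x) (at x)"
      by (auto intro!: derivative_eq_intros)
    ultimately show "\<exists>y. ((\<lambda>x. sin x - x * cos x) has_real_derivative y) (at x) \<and> 0 \<le> y" by blast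
  qed
  then show ?thesis by simp
qed

lemma jordan_sin:
  assumes "0 \<le> \<theta>" "\<theta> \<le> pi / 2"
  shows "2 * \<theta> \<le> pi * sin \<theta>"
proof (cases "\<theta> = 0")
  case False
  have "sin (pi / 2) / (pi / 2) \<le> sin \<theta> / \<theta>"
  proof (rule DERIV_nonpos_imp_nonincreasing[OF assms(2)])
    fix x assume x: "\<theta> \<le> x" "x \<le> pi / 2"
    then have "0 < x" using False assms by simp
    have "x * cos x \<le> sin x" using x assms by (intro x_cos_le_sin) auto
    then have "(cos x * x - sin x) / (x * x) \<le> 0" by (simp add: divide_le_0_iff mult.commute)
    moreover have "((\<lambda>x. sin x / x) has_real_derivative (cos x * x - sin x) / (x * x)) (at x)"
      using \<open>0 < x\<close> by (auto intro!: derivative_eq_intros)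
    ultimately show "\<exists>y. ((\<lambda>x. sin x / x) has_real_derivative y) (at x) \<and> y \<le> 0" by blast
  qed
  then show ?thesis using False assms by (simp add: field_simps)
qed simp

text \<open>This is the condition \<open>Im U \<le> 0\<close> for the logarithmic starting function
  at \<open>z = exp (x + i \<theta>)\<close>. For \<open>\<theta> \<le> pi / 2\<close> the part
  depending on \<open>x\<close> is largest at \<open>x = 0\<close>, and Jordan's inequality remains;
  for larger \<open>\<theta>\<close> the cosine is negative and crude bounds suffice.\<close>

lemma log_angle_bound:
  fixes \<theta> x :: real
  assumes "0 < \<theta>" "\<theta> < pi"
  shows "\<theta> * cos \<theta> * cosh x - x * sinh x * sin \<theta> \<le> pi / 2 * (sin \<theta> * cos \<theta>)"
proof (cases "\<theta> \<le> pi / 2")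
  case True
  have c: "0 \<le> cos \<theta>" using assms True by (intro cos_ge_zero) auto
  have s: "0 < sin \<theta>" using assms by (intro sin_gt_zero) auto
  have "\<theta> * cos \<theta> \<le> sin \<theta>" using assms by (intro x_cos_le_sin) auto
  then have "(cosh x - 1) * (\<theta> * cos \<theta>) \<le> (x * sinh x) * sin \<theta>"
    using cosh_le_one_plus[of x] cosh_real_ge_1[of x] s assms c by (intro mult_mono) auto
  then have "\<theta> * cos \<theta> * cosh x - x * sinh x * sin \<theta> \<le> \<theta> * cos \<theta>" by (simp add: algebra_simps)
  also have "\<dots> \<le> pi / 2 * sin \<theta> * cos \<theta>"
    using jordan_sin[of \<theta>] assms True c by (intro mult_right_mono) auto
  finally show ?thesis by (simp add: algebra_simps)
next
  case False
  have c: "cos \<theta> \<le> 0" using assms False cos_monotone_0_pi_le[of "pi/2" \<theta>] by simp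
  have s: "0 < sin \<theta>" using assms by (intro sin_gt_zero) auto
  have xs: "0 \<le> x * sinh x" by (cases "0 \<le> x") (auto simp: zero_le_mult_iff)
  have "pi / 2 * sin \<theta> \<le> \<theta> * cosh x"
    using False sin_le_one[of \<theta>] s cosh_real_ge_1[of x] assms
    by (smt (verit) mult_left_le mult_mono pi_gt_zero)
  then have "\<theta> * cosh x * cos \<theta> \<le> pi / 2 * sin \<theta> * cos \<theta>"
    using c by (intro mult_right_mono_neg)
  moreover have "0 \<le> x * sinh x * sin \<theta>" using xs s by simp
  ultimately show ?thesis by (simp add: algebra_simps)
qed

text \<open>The function used here is the limit for \<open>s \<rightarrow> 1\<close> of the first Schur step applied to \<open>z powr (- s)\<close>.\<close>

lemma level_log:
  "level 1 1 ((pi\<^sup>2 - 4) / (pi\<^sup>2 + 4)) (4 * pi / (pi\<^sup>2 + 4)) (1 / 2)"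
proof -
  \<comment> \<open>For exponent \<open>s = 1 - \<delta>\<close> the Schur numerator
    \<open>(C + z S) V - 1\<close> and denominator \<open>S + z C - z V\<close> of
    \<open>V = z powr (- s)\<close> are \<open>\<delta> * N z\<close> and
    \<open>\<delta> * D z\<close> to first order in \<open>\<delta>\<close>.\<close>
  define N where "N = (\<lambda>z. of_real pi / (2 * z) + Ln z)"
  define D where "D = (\<lambda>z. of_real (pi / 2) * z - Ln z)"
  have Lnh: "Ln holomorphic_on upper"
    by (intro holomorphic_on_Ln) (use upper_Ln in auto)
  have dN: "(N has_field_derivative - of_real pi / (2 * z\<^sup>2) + 1 / z) (at z)" if "z \<in> upper" for z
    unfolding N_def using upper_Ln[OF that]
    by (auto intro!: derivative_eq_intros simp: field_simps power2_eq_square)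
  have dD: "(D has_field_derivative of_real (pi / 2) - 1 / z) (at z)" if "z \<in> upper" for z
    unfolding D_def using upper_Ln[OF that]
    by (auto intro!: derivative_eq_intros simp: field_simps)
  have Nh: "N holomorphic_on upper" and Dh: "D holomorphic_on upper"
    using dN dD by (auto simp: holomorphic_on_open[OF open_upper])
  have Im_Ln: "0 \<le> Im (Ln z)" if "z \<in> upper" for z using upper_Ln[OF that] by simp
  have Ln_i: "Ln \<i> = Complex 0 (pi / 2)" by (simp add: complex_eq_iff)
  have pi2: "0 < pi / 2" by simp
  note sp = schwarz_pick_upper[OF Lnh Im_Ln Ln_i pi2]
  have not_lin: "\<not> (\<forall>z\<in>upper. Ln z = of_real 0 + of_real (pi / 2) * z)"
  proof
    assume "\<forall>z\<in>upper. Ln z = of_real 0 + of_real (pi / 2) * z"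
    then have "Ln (2 * \<i>) = of_real 0 + of_real (pi / 2) * (2 * \<i>)" by (rule bspec) simp
    then have "Im (Ln (2 * \<i>)) = pi" by simp
    with upper_Ln(4)[of "2 * \<i>"] show False by simp
  qed
  have D0: "D z \<noteq> 0" if "z \<in> upper" "z \<noteq> \<i>" for z
  proof
    assume "D z = 0"
    then have "Ln z = of_real 0 + of_real (pi / 2) * z" by (simp add: D_def)
    with sp(2) not_lin that show False by blast
  qed
  have D1: "deriv D \<i> \<noteq> 0"
    using DERIV_imp_deriv[OF dD[of \<i>]] by (simp add: complex_eq_iff)
  have N0: "N \<i> = 0" and Di: "D \<i> = 0" by (simp_all add: N_def D_def complex_eq_iff)
  obtain U where Uh: "U holomorphic_on upper" and U: "\<And>z. z \<in> upper \<Longrightarrow> z \<noteq> \<i> \<Longrightarrow> U z = N z / D z"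
    using removable_quotient[OF Nh N0 Dh Di D0 D1] by metis
  have p4: "0 < pi\<^sup>2 + 4" by (simp add: add_pos_pos)
  have pi_2: "2 < pi" using pi_gt3 by simp
  have "level 1 (Suc 0) ((pi\<^sup>2 - 4) / (pi\<^sup>2 + 4)) (4 * pi / (pi\<^sup>2 + 4)) (1 / 2)"
  \<comment> \<open>The preceding angle is pi / 2, and \<open>1 / pi\<close> is the limit of
    \<open>((1 - s) / 2) / cos (pi * s / 2)\<close>, the value that the regular Schur step gives to
    \<open>H'\<close>.\<close>
  proof (rule levelI[OF Uh, where C = 0 and S = 1 and H = "1 / pi"])
    show "(pi\<^sup>2 - 4) / (pi\<^sup>2 + 4) \<noteq> 0"
      using p4 pi_2 power_strict_mono[of 2 pi 2] by simp
    show "((pi\<^sup>2 - 4) / (pi\<^sup>2 + 4))\<^sup>2 + (4 * pi / (pi\<^sup>2 + 4))\<^sup>2 = 1"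
      using p4 by (simp add: power_divide add_divide_distrib[symmetric] divide_eq_1_iff) (simp add: power2_eq_square algebra_simps)
    have s: "1 + (pi\<^sup>2 - 4) / (pi\<^sup>2 + 4) = 2 * pi\<^sup>2 / (pi\<^sup>2 + 4)"
      using p4 by (simp add: field_simps)
    show "1 + 1 * ((pi\<^sup>2 - 4) / (pi\<^sup>2 + 4)) + 0 * (4 * pi / (pi\<^sup>2 + 4)) \<noteq> 0"
      using s p4 by simp
    show "1 / pi * (2 * (1 + 1 * ((pi\<^sup>2 - 4) / (pi\<^sup>2 + 4)) + 0 * (4 * pi / (pi\<^sup>2 + 4)))) =
      real (Suc 0) * (4 * pi / (pi\<^sup>2 + 4) + 0)"
      using s p4 by (simp add: field_simps power2_eq_square)
    fix z assume z: "z \<in> upper" "z \<noteq> \<i>"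
    have "z \<noteq> 0" using z(1) by auto
    have Dz: "D z \<noteq> 0" using D0 z by blast
    have UD: "U z * (cmod (D z))\<^sup>2 = N z * cnj (D z)"
    proof -
      have "U z * (cmod (D z))\<^sup>2 = U z * D z * cnj (D z)"
        by (simp only: complex_norm_square mult.assoc)
      then show ?thesis using U[OF z] Dz by simp
    qed
    show "Im (U z) \<le> 0 \<and> 0 \<le> Im (z * U z) \<and>
      z * (z\<^sup>2 + 1) * deriv U z = riccati 1 (1 / 2) (1 / pi) (1 / 2 * 0 - 1 / pi * 1) z (U z)"
    proof (intro conjI)
      define \<theta> x where "\<theta> = Im (Ln z)" and "x = Re (Ln z)"
      have \<theta>: "0 < \<theta>" "\<theta> < pi" using upper_Ln[OF z(1)] by (simp_all add: \<theta>_def)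
      have zx: "z = of_real (exp x) * cis \<theta>"
        using upper_Ln(5)[OF z(1)] by (simp add: \<theta>_def x_def exp_eq_polar)
      have Lx: "Ln z = Complex x \<theta>" by (simp add: \<theta>_def x_def)
      have iz: "1 / z = of_real (exp (- x)) * cis (- \<theta>)"
        unfolding zx by (simp add: exp_minus cis_inverse[symmetric] field_simps)
      have "Im (U z) * (cmod (D z))\<^sup>2 = Im (N z * cnj (D z))"
        unfolding UD[symmetric] by simp
      also have "N z * cnj (D z) = (of_real (pi / 2) * (1 / z) + Ln z) * cnj (of_real (pi / 2) * z - Ln z)"
        by (simp add: N_def D_def)
      also have "Im \<dots> = pi * (\<theta> * cos \<theta> * cosh x - x * sinh x * sin \<theta> - pi / 2 * (sin \<theta> * cos \<theta>))"
        unfolding iz Lx unfolding zx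
        by (simp add: cosh_def sinh_def exp_minus field_simps)
      also have "\<dots> \<le> 0" using log_angle_bound[OF \<theta>, of x] by (simp add: mult_le_0_iff)
      finally show "Im (U z) \<le> 0" using Dz by (simp add: mult_le_0_iff)
      have "Im (z * U z) * (cmod (D z))\<^sup>2 = Im (z * (N z * cnj (D z)))"
        unfolding UD[symmetric] by (simp add: algebra_simps)
      also have "z * (N z * cnj (D z)) = (of_real (pi / 2) + z * Ln z) * cnj (D z)"
        using \<open>z \<noteq> 0\<close> by (simp add: N_def algebra_simps)
      also have "Im \<dots> = Im (Ln z) * (pi / 2) * (1 + (cmod z)\<^sup>2) - Im z * ((cmod (Ln z - of_real 0))\<^sup>2 + (pi / 2)\<^sup>2)"
        unfolding cmod_power2 D_def Lx by (simp add: algebra_simps power2_eq_square)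
      also have "\<dots> \<ge> 0" using sp(1)[OF _ z(1)] by simp
      finally show "0 \<le> Im (z * U z)" using Dz by (simp add: zero_le_mult_iff)
      have "((\<lambda>z. N z / D z) has_field_derivative
          ((- of_real pi / (2 * z\<^sup>2) + 1 / z) * D z - N z * (of_real (pi / 2) - 1 / z)) / (D z * D z)) (at z)"
        by (rule DERIV_divide[OF dN dD]) (use z Dz in auto)
      then have "(U has_field_derivative
          ((- of_real pi / (2 * z\<^sup>2) + 1 / z) * D z - N z * (of_real (pi / 2) - 1 / z)) / (D z * D z)) (at z)"
        by (rule has_field_derivative_transform_within_open[of _ _ _ "upper - {\<i>}"])
          (use z U open_upper in \<open>auto intro: open_delete\<close>)
      then have "deriv U z = ((- of_real pi / (2 * z\<^sup>2) + 1 / z) * D z - N z * (of_real (pi / 2) - 1 / z)) / (D z * D z)"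
        by (rule DERIV_imp_deriv)
      then have "deriv U z * (D z * D z) = (- of_real pi / (2 * z\<^sup>2) + 1 / z) * D z - N z * (of_real (pi / 2) - 1 / z)"
        using Dz by simp
      then have "z * (z\<^sup>2 + 1) * deriv U z * (D z * D z)
          = z * (z\<^sup>2 + 1) * ((- of_real pi / (2 * z\<^sup>2) + 1 / z) * D z - N z * (of_real (pi / 2) - 1 / z))"
        by (simp only: mult.assoc)
      also have "\<dots> = - (z\<^sup>2 + 1) * N z * D z - ((D z)\<^sup>2 + z\<^sup>2 * (N z)\<^sup>2)
          + 2 * of_real (1 / pi) * z * ((N z)\<^sup>2 + (D z)\<^sup>2) + 4 * of_real (1 / pi) * z * N z * D z"
        using \<open>z \<noteq> 0\<close> unfolding N_def D_def by (simp add: field_simps power2_eq_square)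
      also have "\<dots> = riccati 1 (1 / 2) (1 / pi) (1 / 2 * 0 - 1 / pi * 1) z (U z) * (D z * D z)"
      proof -
        have "N z = U z * D z" using U[OF z] Dz by simp
        then show ?thesis
          by (simp add: riccati_def algebra_simps power2_eq_square add_divide_distrib)
      qed
      finally show "z * (z\<^sup>2 + 1) * deriv U z = riccati 1 (1 / 2) (1 / pi) (1 / 2 * 0 - 1 / pi * 1) z (U z)"
        using Dz by simp
    qed
  qed auto
  then show ?thesis by simp
qed

section \<open>Asymptotics of the discrete Painleve equation\<close>

text \<open>The quotient \<open>(C' + S) / (1 + S C' + C S')\<close> of the discrete Painleve
  equation, with \<open>a\<close> the current and \<open>b\<close> the next angle.\<close>

definition ratio_fun :: "real \<Rightarrow> real \<Rightarrow> real" where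
  "ratio_fun a b = (cos b + sin a) / (1 + sin (a + b))"

text \<open>Numerator and denominator share a sine, and cancelling it leaves a ratio of two sines of
  half angles, for which monotonicity follows from the addition formulas.\<close>

lemma ratio_fun_half:
  assumes "a \<in> {0..pi/2}" "b \<in> {0..pi/2}"
  shows "ratio_fun a b = sin (pi/4 + a/2 - b/2) / sin (pi/4 + a/2 + b/2)"
    and "0 < sin (pi/4 + a/2 + b/2)" and "0 \<le> sin (pi/4 + a/2 - b/2)"
proof -
  have ab: "0 \<le> a" "a \<le> pi/2" "0 \<le> b" "b \<le> pi/2" using assms by auto
  show pos: "0 < sin (pi/4 + a/2 + b/2)"
    by (rule sin_gt_zero) (use ab pi_gt_zero in linarith)+
  show "0 \<le> sin (pi/4 + a/2 - b/2)"
    by (rule sin_ge_zero) (use ab pi_gt_zero in linarith)+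
  have n: "cos b + sin a = 2 * sin (pi/4 + a/2 - b/2) * sin (pi/4 + a/2 + b/2)"
  proof -
    have prod: "2 * sin u * sin v = cos (u - v) - cos (u + v)" for u v :: real
      by (simp add: cos_diff cos_add)
    have "2 * sin (pi/4 + a/2 - b/2) * sin (pi/4 + a/2 + b/2) = cos (- b) - cos (pi/2 + a)"
      unfolding prod by (rule arg_cong2[where f = "\<lambda>x y. cos x - cos y"]) (simp_all add: field_simps)
    also have "\<dots> = cos b + sin a" by (simp add: cos_add)
    finally show ?thesis by simp
  qed
  have d: "1 + sin (a + b) = 2 * (sin (pi/4 + a/2 + b/2))\<^sup>2"
  proof -
    have "cos (2 * (pi/4 + a/2 + b/2)) = 1 - 2 * (sin (pi/4 + a/2 + b/2))\<^sup>2" by (rule cos_double_sin)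
    moreover have "2 * (pi/4 + a/2 + b/2) = pi/2 + (a + b)" by (simp add: field_simps)
    moreover have "cos (pi/2 + (a + b)) = - sin (a + b)" by (simp only: cos_add) simp
    ultimately show ?thesis by (simp add: add.assoc)
  qed
  show "ratio_fun a b = sin (pi/4 + a/2 - b/2) / sin (pi/4 + a/2 + b/2)"
    using pos unfolding ratio_fun_def n d by (simp add: power2_eq_square)
qed

lemma ratio_fun_mono:
  assumes "a \<in> {0..pi/2}" "a' \<in> {0..pi/2}" "b \<in> {0..pi/2}" "b' \<in> {0..pi/2}" "a \<le> a'" "b' \<le> b"
  shows "ratio_fun a b \<le> ratio_fun a' b'"
proof -
  have "ratio_fun a b \<le> ratio_fun a b'"
  proof -
    define p q q' where "p = pi/4 + a/2" and "q = b/2" and "q' = b'/2"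
    have "sin (p - q') * sin (p + q) - sin (p - q) * sin (p + q') = sin (p + p) * sin (q - q')"
      unfolding sin_add sin_diff by (simp add: algebra_simps)
    also have "\<dots> \<ge> 0"
      using assms by (intro mult_nonneg_nonneg sin_ge_zero) (auto simp: p_def q_def q'_def)
    finally have "sin (p - q) * sin (p + q') \<le> sin (p - q') * sin (p + q)" by simp
    then have "0 < sin (p + q) \<Longrightarrow> 0 < sin (p + q') \<Longrightarrow>
        sin (p - q) / sin (p + q) \<le> sin (p - q') / sin (p + q')"
      by (simp add: divide_simps mult.commute)
    moreover have "ratio_fun a b = sin (p - q) / sin (p + q)" "ratio_fun a b' = sin (p - q') / sin (p + q')"
      "0 < sin (p + q)" "0 < sin (p + q')"
      unfolding p_def q_def q'_def
      by (rule ratio_fun_half[OF assms(1,3)] ratio_fun_half[OF assms(1,4)])+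
    ultimately show ?thesis by simp
  qed
  also have "\<dots> \<le> ratio_fun a' b'"
  proof -
    define p p' q where "p = pi/4 + a/2" and "p' = pi/4 + a'/2" and "q = b'/2"
    have "sin (p' - q) * sin (p + q) - sin (p - q) * sin (p' + q) = sin (q + q) * sin (p' - p)"
      unfolding sin_add sin_diff by (simp add: algebra_simps)
    also have "\<dots> \<ge> 0"
      using assms by (intro mult_nonneg_nonneg sin_ge_zero) (auto simp: p_def q_def p'_def)
    finally have "sin (p - q) * sin (p' + q) \<le> sin (p' - q) * sin (p + q)" by simp
    then have "0 < sin (p + q) \<Longrightarrow> 0 < sin (p' + q) \<Longrightarrow>
        sin (p - q) / sin (p + q) \<le> sin (p' - q) / sin (p' + q)"
      by (simp add: divide_simps mult.commute)
    moreover have "ratio_fun a b' = sin (p - q) / sin (p + q)" "ratio_fun a' b' = sin (p' - q) / sin (p' + q)"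
      "0 < sin (p + q)" "0 < sin (p' + q)"
      unfolding p_def q_def p'_def
      by (rule ratio_fun_half[OF assms(1,4)] ratio_fun_half[OF assms(2,4)])+
    ultimately show ?thesis by simp
  qed
  finally show ?thesis .
qed

text \<open>When both neighbouring angles equal \<open>b\<close>, the two terms of the recursion
  merge into one sine. Its weights 3 and 1 are the source of the contraction factor 1 / 3.\<close>

lemma ratio_fun_balance:
  assumes "x \<in> {0..pi/2}" "b \<in> {0..pi/2}"
  shows "sin x * ratio_fun x b - cos x * ratio_fun b x
    = sin ((3 * (x - pi/4) - (b - pi/4)) / 2) / sin (pi/4 + x/2 + b/2)"
proof -
  define w where "w = (x - b) / 2"
  have "cos x * sin (pi/4 - w) = cos x * cos (pi/4 + w)"
    by (simp add: sin_diff cos_add sin_45 cos_45)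
  then have "sin x * sin (pi/4 + w) - cos x * sin (pi/4 - w) = - cos (x + (pi/4 + w))"
    by (simp add: cos_add)
  also have "\<dots> = sin ((3 * (x - pi/4) - (b - pi/4)) / 2)"
  proof -
    have "x + (pi/4 + w) = (3 * (x - pi/4) - (b - pi/4)) / 2 + pi/2" by (simp add: w_def field_simps)
    then show ?thesis by (simp only: cos_add) simp
  qed
  finally have "sin x * sin (pi/4 + w) - cos x * sin (pi/4 - w) = sin ((3 * (x - pi/4) - (b - pi/4)) / 2)" .
  moreover have "pi/4 + w = pi/4 + x/2 - b/2" "pi/4 - w = pi/4 + b/2 - x/2"
    by (simp_all add: w_def field_simps)
  moreover have "pi/4 + b/2 + x/2 = pi/4 + x/2 + b/2" by simp
  ultimately show ?thesis
    unfolding ratio_fun_half(1)[OF assms] ratio_fun_half(1)[OF assms(2,1)]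
    by (simp only: times_divide_eq_right diff_divide_distrib[symmetric])
qed

lemma contraction_decay:
  fixes d :: "nat \<Rightarrow> real"
  assumes bound: "\<And>M. 1 \<le> M \<Longrightarrow> d M \<le> b"
    and step: "\<And>M. 2 \<le> M \<Longrightarrow> d M \<le> (max (d (M - 1)) (d (M + 1)) + B / M) / 3"
    and "0 \<le> b" "0 \<le> B"
  shows "\<exists>A. \<forall>M\<ge>1. d M \<le> A / real M"
proof -
  define A where "A = max b B"
  have A: "b \<le> A" "B \<le> A" "0 \<le> A" using assms by (auto simp: A_def)
  have imp: "\<forall>M\<ge>1. d M \<le> A / real M + b / 3 ^ j" for j
  proof (induction j)
    case 0
    show ?case
    proof (intro allI impI)
      fix M :: nat assume "1 \<le> M"
      then show "d M \<le> A / real M + b / 3 ^ 0" using bound[of M] A by (simp add: add_increasing)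
    qed
  next
    case (Suc j)
    show ?case
    proof (intro allI impI)
      fix M :: nat assume M: "1 \<le> M"
      show "d M \<le> A / real M + b / 3 ^ Suc j"
      proof (cases "M = 1")
        case True
        then show ?thesis using bound[of M] A \<open>0 \<le> b\<close> by (simp add: add_increasing2)
      next
        case False
        then have M2: "2 \<le> M" using M by simp
        have 1: "A / real (M - 1) \<le> 2 * A / real M" "A / real (M + 1) \<le> 2 * A / real M"
          using M2 A(3) by (auto simp: divide_simps of_nat_diff algebra_simps intro: mult_left_mono)
        have "1 \<le> M - 1" using M2 by simp
        then have "d (M - 1) \<le> 2 * A / real M + b / 3 ^ j"
          using Suc.IH 1 by (meson add_right_mono order_trans)
        moreover have "d (M + 1) \<le> 2 * A / real M + b / 3 ^ j"
          using Suc.IH[rule_format, of "M + 1"] 1 by linarith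
        ultimately have "max (d (M - 1)) (d (M + 1)) \<le> 2 * A / real M + b / 3 ^ j"
          by (rule max.boundedI)
        moreover have "B / real M \<le> A / real M" using A(2) by (rule divide_right_mono) simp
        ultimately have "(max (d (M - 1)) (d (M + 1)) + B / real M) / 3 \<le> (2 * A / real M + b / 3 ^ j + A / real M) / 3"
          by (rule divide_right_mono[OF add_mono]) simp
        with step[OF M2] have "d M \<le> (2 * A / real M + b / 3 ^ j + A / real M) / 3"
          by (rule order_trans)
        also have "\<dots> = A / real M + b / 3 ^ Suc j" by (simp add: field_simps)
        finally show ?thesis .
      qed
    qed
  qed
  have "d M \<le> A / real M" if "1 \<le> M" for M
  proof (rule LIMSEQ_le_const)
    show "(\<lambda>j. A / real M + b / 3 ^ j) \<longlonglongrightarrow> A / real M"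
      using tendsto_add[OF tendsto_const LIMSEQ_divide_realpow_zero[of 3 b]] by simp
    show "\<exists>N. \<forall>j\<ge>N. d M \<le> A / real M + b / 3 ^ j" using imp that by blast
  qed
  then show ?thesis by blast
qed

text \<open>The increments of \<open>ln (F M) - c * ln M\<close> are O(1 / M^2), hence summable, so
  this difference converges.\<close>

lemma powr_growth:
  fixes F \<theta> :: "nat \<Rightarrow> real"
  assumes "0 < c" and F: "\<And>M. 1 \<le> M \<Longrightarrow> 0 < F M"
    and step: "\<And>M. N \<le> M \<Longrightarrow> F (Suc M) = F M * (1 + c * \<theta> M / real M)"
    and \<theta>: "\<And>M. N \<le> M \<Longrightarrow> \<bar>\<theta> M - 1\<bar> \<le> A / real M"
  shows "\<exists>K>0. (\<lambda>M. F M / real M powr c) \<longlonglongrightarrow> K"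
proof -
  define u where "u M = ln (F M) - c * ln (real M)" for M
  obtain N' where N': "N \<le> N'" "2 * A \<le> real N'" "4 * c \<le> real N'" "2 \<le> N'"
  proof
    show "N \<le> N + nat \<lceil>2 * \<bar>A\<bar>\<rceil> + nat \<lceil>4 * c\<rceil> + 2" by simp
    show "2 * A \<le> real (N + nat \<lceil>2 * \<bar>A\<bar>\<rceil> + nat \<lceil>4 * c\<rceil> + 2)" by linarith
    show "4 * c \<le> real (N + nat \<lceil>2 * \<bar>A\<bar>\<rceil> + nat \<lceil>4 * c\<rceil> + 2)" by linarith
  qed simp
  have bound: "norm (u (Suc M) - u M) \<le> (8 * c\<^sup>2 + 2 * c + c * A) * inverse (real M ^ 2)" if "N' \<le> M" for M
  proof -
    have M: "N \<le> M" "2 \<le> M" "2 * A \<le> real M" "4 * c \<le> real M" using that N' by auto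
    define y where "y = c * \<theta> M / real M"
    have "A / real M \<le> 1 / 2" using M by (simp add: field_simps)
    then have "\<bar>\<theta> M - 1\<bar> \<le> 1 / 2" using \<theta>[OF M(1)] by linarith
    then have th: "\<bar>\<theta> M\<bar> \<le> 2" by linarith
    have "\<bar>y\<bar> \<le> c * 2 / real M"
      unfolding y_def using th \<open>0 < c\<close> M by (simp add: abs_mult divide_right_mono)
    moreover have "c * 2 / real M \<le> 1 / 2" using M by (simp add: field_simps)
    ultimately have y: "\<bar>y\<bar> \<le> 1 / 2" "y\<^sup>2 \<le> (c * 2 / real M)\<^sup>2"
      using abs_le_square_iff[of y "c * 2 / real M"] \<open>0 < c\<close> by auto
    have "0 < 1 + y" "0 < F M" using y(1) F[of M] M by auto
    then have "ln (F M * (1 + y)) = ln (F M) + ln (1 + y)" by (simp add: ln_mult)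
    then have "ln (F (Suc M)) = ln (F M) + ln (1 + y)" using step[OF M(1)] by (simp add: y_def)
    moreover have "ln (real (Suc M)) = ln (real M) + ln (1 + 1 / real M)"
    proof -
      have "real (Suc M) = real M * (1 + 1 / real M)" using M by (simp add: field_simps)
      moreover have "0 < real M" "0 < 1 + 1 / real M" using M by (auto simp: add_pos_pos)
      ultimately show ?thesis by (simp add: ln_mult)
    qed
    ultimately have eq: "u (Suc M) - u M = (ln (1 + y) - y) - c * (ln (1 + 1 / real M) - 1 / real M) + c * (\<theta> M - 1) / real M"
      by (simp add: u_def y_def diff_divide_distrib right_diff_distrib distrib_left)
    have "\<bar>ln (1 + y) - y\<bar> \<le> 2 * y\<^sup>2" using abs_ln_one_plus_x_minus_x_bound[of y] y by simp
    also have "\<dots> \<le> 2 * (c * 2 / real M)\<^sup>2" using y by simp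
    finally have 1: "\<bar>ln (1 + y) - y\<bar> \<le> 8 * c\<^sup>2 / real M ^ 2" by (simp add: power_divide power_mult_distrib)
    have "\<bar>ln (1 + 1 / real M) - 1 / real M\<bar> \<le> 2 * (1 / real M)\<^sup>2"
      using abs_ln_one_plus_x_minus_x_bound[of "1 / real M"] M by simp
    then have "c * \<bar>ln (1 + 1 / real M) - 1 / real M\<bar> \<le> c * (2 * (1 / real M)\<^sup>2)"
      using \<open>0 < c\<close> by (intro mult_left_mono) auto
    then have 2: "\<bar>c * (ln (1 + 1 / real M) - 1 / real M)\<bar> \<le> 2 * c / real M ^ 2"
      using \<open>0 < c\<close> by (simp add: abs_mult power_divide mult.commute)
    have 3: "\<bar>c * (\<theta> M - 1) / real M\<bar> \<le> c * A / real M ^ 2"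
    proof -
      have "c * \<bar>\<theta> M - 1\<bar> / real M \<le> c * (A / real M) / real M"
        using \<theta>[OF M(1)] \<open>0 < c\<close> by (intro divide_right_mono mult_left_mono) auto
      then show ?thesis using \<open>0 < c\<close> by (simp add: abs_mult power2_eq_square)
    qed
    have "\<bar>u (Suc M) - u M\<bar> \<le> 8 * c\<^sup>2 / real M ^ 2 + 2 * c / real M ^ 2 + c * A / real M ^ 2"
      unfolding eq using 1 2 3 by linarith
    also have "\<dots> = (8 * c\<^sup>2 + 2 * c + c * A) * inverse (real M ^ 2)" by (simp add: divide_inverse algebra_simps)
    finally show ?thesis by simp
  qed
  have "summable (\<lambda>M. u (Suc M) - u M)"
  proof (rule summable_comparison_test_ev)
    show "\<forall>\<^sub>F M in sequentially. norm (u (Suc M) - u M) \<le> (8 * c\<^sup>2 + 2 * c + c * A) * inverse (real M ^ 2)"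
      using bound eventually_sequentially by auto
    show "summable (\<lambda>M. (8 * c\<^sup>2 + 2 * c + c * A) * inverse (real M ^ 2))"
      by (intro summable_mult inverse_power_summable) simp
  qed
  then have "convergent (\<lambda>n. u n - u 0)"
    by (simp add: summable_iff_convergent sum_lessThan_telescope)
  then obtain L where "(\<lambda>n. u n - u 0) \<longlonglongrightarrow> L" by (auto simp: convergent_def)
  then have "(\<lambda>n. exp (u n - u 0 + u 0)) \<longlonglongrightarrow> exp (L + u 0)" by (intro tendsto_intros)
  moreover have "\<forall>\<^sub>F n in sequentially. exp (u n - u 0 + u 0) = F n / real n powr c"
    using eventually_ge_at_top[of 1]
    by eventually_elim (use F in \<open>auto simp: u_def exp_diff powr_def Suc_le_eq\<close>)
  ultimately have "(\<lambda>M. F M / real M powr c) \<longlonglongrightarrow> exp (L + u 0)"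
    by (rule Lim_transform_eventually)
  then show ?thesis by (intro exI[of _ "exp (L + u 0)"]) auto
qed

text \<open>\<open>F\<close> is the position and \<open>r\<close> the radius on the diagonal. The
  angle is shown to approach pi / 4 at rate 1 / M, the growth of \<open>F\<close> follows from its
  product recursion, and \<open>dPII\<close> itself converts it into the growth of
  \<open>r\<close>.\<close>

lemma dPII_asymptotics:
  fixes C S r F :: "nat \<Rightarrow> real" and c :: real
  assumes c: "0 < c" "c \<le> 2"
    and CS: "\<And>M. 1 \<le> M \<Longrightarrow> 0 < C M \<and> 0 < S M \<and> (C M)\<^sup>2 + (S M)\<^sup>2 = 1"
    and rF: "\<And>M. 1 \<le> M \<Longrightarrow> 0 < r M \<and> 0 < F M"
    and r: "\<And>M. 1 \<le> M \<Longrightarrow> r (Suc M) = r M * S M / C M"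
    and F: "\<And>M. 1 \<le> M \<Longrightarrow> F (Suc M) = F M + r M / C M"
    and dPII: "\<And>M. 1 \<le> M \<Longrightarrow> c * F (Suc M) * (1 + S M * C (Suc M) + C M * S (Suc M))
       = 2 * real (Suc M) * r (Suc M) * (C (Suc M) + S M)"
  shows "\<exists>K>0. (\<lambda>M. r M / real M powr (c - 1)) \<longlonglongrightarrow> K"
    and "(\<lambda>M. r (Suc M) / r M) \<longlonglongrightarrow> 1"
proof -
  define \<alpha> where "\<alpha> M = arctan (S M / C M)" for M
  have \<alpha>: "0 < \<alpha> M" "\<alpha> M < pi / 2" "cos (\<alpha> M) = C M" "sin (\<alpha> M) = S M" if "1 \<le> M" for M
  proof -
    show "0 < \<alpha> M" using CS[OF that] by (simp add: \<alpha>_def)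
    show "\<alpha> M < pi / 2" unfolding \<alpha>_def by (rule arctan_ubound)
    have "sqrt (1 + (S M / C M)\<^sup>2) = 1 / C M"
      using CS[OF that] by (intro real_sqrt_unique) (auto simp: field_simps power2_eq_square)
    then show "cos (\<alpha> M) = C M" "sin (\<alpha> M) = S M"
      using CS[OF that] by (auto simp: \<alpha>_def cos_arctan sin_arctan)
  qed
  have \<alpha>I: "\<alpha> M \<in> {0..pi/2}" if "1 \<le> M" for M using \<alpha>[OF that] by auto
  define \<delta> where "\<delta> M = \<alpha> M - pi / 4" for M
  define k where "k M = ratio_fun (\<alpha> M) (\<alpha> (Suc M))" for M
  have sig: "1 + S M * C (Suc M) + C M * S (Suc M) > 0" if "1 \<le> M" for M
    using CS[OF that] CS[of "Suc M"] that by (simp add: add_pos_pos)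
  have k_eq: "k M = (C (Suc M) + S M) / (1 + S M * C (Suc M) + C M * S (Suc M))" if "1 \<le> M" for M
    using \<alpha>[OF that] \<alpha>[of "Suc M"] that by (simp add: k_def ratio_fun_def sin_add algebra_simps)
  have Fk: "c * F (Suc M) = 2 * real (Suc M) * r (Suc M) * k M" if "1 \<le> M" for M
    using dPII[OF that] sig[OF that] by (simp add: k_eq[OF that] field_simps)
  \<comment> \<open>The difference of two consecutive equations \<open>Fk\<close>; it eliminates
    \<open>F\<close> and leaves a second-order recursion in the angles alone.\<close>
  have three: "c = 2 * real M * (S M * k M - C M * k (M - 1)) + 2 * S M * k M" if "2 \<le> M" for M
  proof -
    have M: "1 \<le> M" "1 \<le> M - 1" "Suc (M - 1) = M" using that by auto
    have "c * (r M / C M) = c * F (Suc M) - c * F M"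
      using F[OF M(1)] by (simp add: algebra_simps)
    also have "\<dots> = 2 * real (Suc M) * (r M * S M / C M) * k M - 2 * real M * r M * k (M - 1)"
      using Fk[OF M(1)] Fk[OF M(2)] r[OF M(1)] M(3) by simp
    finally have "r M * c = r M * (2 * real (Suc M) * S M * k M - 2 * real M * C M * k (M - 1))"
      using CS[OF M(1)] by (simp add: field_simps)
    then have "c = 2 * real (Suc M) * S M * k M - 2 * real M * C M * k (M - 1)"
      using rF[OF M(1)] by simp
    then show ?thesis by (simp add: algebra_simps)
  qed
  have k01: "0 \<le> k M" "k M \<le> 1" if "1 \<le> M" for M
  proof -
    have "ratio_fun (\<alpha> M) (\<alpha> (Suc M)) \<le> ratio_fun (pi/2) 0" "ratio_fun 0 (pi/2) \<le> ratio_fun (\<alpha> M) (\<alpha> (Suc M))"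
      using \<alpha>I[OF that] \<alpha>I[of "Suc M"] by (auto intro!: ratio_fun_mono)
    then show "0 \<le> k M" "k M \<le> 1" by (simp_all add: k_def ratio_fun_def)
  qed
  \<comment> \<open>By \<open>three\<close>, \<open>M\<close> times the balance equals
    \<open>c / 2 - S M * k M\<close>, a difference of two numbers in [0, 1]; here
    \<open>c \<le> 2\<close> matters.\<close>
  have bal: "\<bar>S M * k M - C M * k (M - 1)\<bar> \<le> 1 / real M" if "2 \<le> M" for M
  proof -
    have M: "1 \<le> M" using that by simp
    have "0 \<le> S M" "S M \<le> 1" using \<alpha>[OF M] CS[OF M] by (auto simp flip: \<alpha>(4)[OF M])
    then have "0 \<le> S M * k M" "S M * k M \<le> 1" using k01[OF M] by (auto simp: mult_le_one)
    then have "\<bar>real M * (S M * k M - C M * k (M - 1))\<bar> \<le> 1"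
      using three[OF that] c by linarith
    then have "real M * \<bar>S M * k M - C M * k (M - 1)\<bar> \<le> 1" by (simp add: abs_mult)
    then show ?thesis using that by (simp add: pos_le_divide_eq mult.commute)
  qed
  have contr: "\<bar>\<delta> M\<bar> \<le> (max \<bar>\<delta> (M - 1)\<bar> \<bar>\<delta> (M + 1)\<bar> + pi / real M) / 3" if "2 \<le> M" for M
  proof -
    have M: "1 \<le> M" "1 \<le> M - 1" "Suc (M - 1) = M" "1 \<le> Suc M" using that by auto
    note I = \<alpha>I[OF M(1)] \<alpha>I[OF M(2)] \<alpha>I[OF M(4)]
    have CSp: "0 \<le> S M" "0 \<le> C M" using CS[OF M(1)] by auto
    \<comment> \<open>Jordan's inequality turns the bound for the sine into a bound for
      \<open>y\<close>; it applies because \<open>y / 2\<close> does not exceed pi / 2.\<close>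
    have fin: "y \<le> pi / real M" if y: "sin (y / 2) / s \<le> 1 / real M" "0 < s" "s \<le> 1" "y \<le> pi" for y s
    proof (cases "0 \<le> y")
      case True
      have "sin (y / 2) \<le> 1 / real M * s" using y(1,2) by (simp add: field_simps)
      also have "\<dots> \<le> 1 / real M" using y(3) by (rule mult_left_le) simp
      finally have "pi * sin (y / 2) \<le> pi * (1 / real M)" by (intro mult_left_mono) auto
      moreover have "2 * (y / 2) \<le> pi * sin (y / 2)" using True y by (intro jordan_sin) auto
      ultimately show ?thesis by simp
    qed (simp add: order_trans[of y 0])
    have up: "3 * \<delta> M - max (\<delta> (M - 1)) (\<delta> (M + 1)) \<le> pi / real M"
    proof (rule fin)
      define b where "b = max (\<alpha> (M - 1)) (\<alpha> (M + 1))"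
      have bI: "b \<in> {0..pi/2}" using I by (auto simp: b_def)
      \<comment> \<open>Replacing both neighbours by the larger one only lowers the balance, after
        which \<open>ratio_fun_balance\<close> applies. The lower estimate uses the smaller
        neighbour in the same way.\<close>
      have "S M * ratio_fun (\<alpha> M) b - C M * ratio_fun b (\<alpha> M) \<le> S M * k M - C M * k (M - 1)"
        using I bI CSp M by (intro diff_mono mult_left_mono) (auto simp: k_def b_def intro!: ratio_fun_mono)
      also have "\<dots> \<le> 1 / real M" using bal[OF that] by simp
      finally show "sin ((3 * \<delta> M - max (\<delta> (M - 1)) (\<delta> (M + 1))) / 2) / sin (pi/4 + \<alpha> M / 2 + b / 2) \<le> 1 / real M"
        using ratio_fun_balance[OF I(1) bI] \<alpha>[OF M(1)] by (simp add: \<delta>_def b_def max_def split: if_splits)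
      show "0 < sin (pi/4 + \<alpha> M / 2 + b / 2)" by (rule ratio_fun_half(2)[OF I(1) bI])
      show "sin (pi/4 + \<alpha> M / 2 + b / 2) \<le> 1" by simp
      show "3 * \<delta> M - max (\<delta> (M - 1)) (\<delta> (M + 1)) \<le> pi"
        using I by (auto simp: \<delta>_def)
    qed
    have lo: "min (\<delta> (M - 1)) (\<delta> (M + 1)) - 3 * \<delta> M \<le> pi / real M"
    proof (rule fin)
      define b where "b = min (\<alpha> (M - 1)) (\<alpha> (M + 1))"
      have bI: "b \<in> {0..pi/2}" using I by (auto simp: b_def)
      have "S M * k M - C M * k (M - 1) \<le> S M * ratio_fun (\<alpha> M) b - C M * ratio_fun b (\<alpha> M)"
        using I bI CSp M by (intro diff_mono mult_left_mono) (auto simp: k_def b_def intro!: ratio_fun_mono)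
      then have "- (S M * ratio_fun (\<alpha> M) b - C M * ratio_fun b (\<alpha> M)) \<le> 1 / real M" using bal[OF that] by simp
      also have "- (S M * ratio_fun (\<alpha> M) b - C M * ratio_fun b (\<alpha> M)) = 
         - (sin ((3 * \<delta> M - (b - pi/4)) / 2) / sin (pi/4 + \<alpha> M / 2 + b / 2))"
        using ratio_fun_balance[OF I(1) bI] \<alpha>[OF M(1)] by (simp add: \<delta>_def)
      also have "\<dots> = sin (- ((3 * \<delta> M - (b - pi/4)) / 2)) / sin (pi/4 + \<alpha> M / 2 + b / 2)"
        by simp
      also have "- ((3 * \<delta> M - (b - pi/4)) / 2) = (min (\<delta> (M - 1)) (\<delta> (M + 1)) - 3 * \<delta> M) / 2"
        by (simp add: \<delta>_def b_def min_def field_simps)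
      finally show "sin ((min (\<delta> (M - 1)) (\<delta> (M + 1)) - 3 * \<delta> M) / 2) / sin (pi/4 + \<alpha> M / 2 + b / 2) \<le> 1 / real M" .
      show "0 < sin (pi/4 + \<alpha> M / 2 + b / 2)" by (rule ratio_fun_half(2)[OF I(1) bI])
      show "sin (pi/4 + \<alpha> M / 2 + b / 2) \<le> 1" by simp
      show "min (\<delta> (M - 1)) (\<delta> (M + 1)) - 3 * \<delta> M \<le> pi"
        using I by (auto simp: \<delta>_def)
    qed
    show ?thesis using up lo by (auto simp: abs_le_iff)
  qed
  have "\<exists>A. \<forall>M\<ge>1. \<bar>\<delta> M\<bar> \<le> A / real M"
  proof (rule contraction_decay[of _ "pi/4" pi])
    show "\<bar>\<delta> M\<bar> \<le> pi / 4" if "1 \<le> M" for M unfolding \<delta>_def abs_le_iff using \<alpha>(1,2)[OF that] by linarith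
  qed (use contr in auto)
  then obtain A where A: "\<And>M. 1 \<le> M \<Longrightarrow> \<bar>\<delta> M\<bar> \<le> A / real M" by blast
  have "0 \<le> A" using A[of 1] by simp
  have "\<delta> \<longlonglongrightarrow> 0"
  proof (rule Lim_null_comparison)
    show "\<forall>\<^sub>F M in sequentially. norm (\<delta> M) \<le> A / real M"
      using eventually_ge_at_top[of 1] by eventually_elim (use A in auto)
    show "(\<lambda>M. A / real M) \<longlonglongrightarrow> 0" by (rule lim_const_over_n)
  qed
  then have \<alpha>lim: "\<alpha> \<longlonglongrightarrow> pi / 4"
    unfolding \<delta>_def using LIM_zero_iff by blast
  have "(\<lambda>M. cos (\<alpha> M)) \<longlonglongrightarrow> sqrt 2 / 2" "(\<lambda>M. sin (\<alpha> M)) \<longlonglongrightarrow> sqrt 2 / 2"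
    using tendsto_cos[OF \<alpha>lim] tendsto_sin[OF \<alpha>lim] by (simp_all add: cos_45 sin_45)
  moreover have "\<forall>\<^sub>F M in sequentially. cos (\<alpha> M) = C M" "\<forall>\<^sub>F M in sequentially. sin (\<alpha> M) = S M"
    unfolding eventually_sequentially using \<alpha> by blast+
  ultimately have Clim: "C \<longlonglongrightarrow> sqrt 2 / 2" and Slim: "S \<longlonglongrightarrow> sqrt 2 / 2"
    using Lim_transform_eventually by blast+
  have "(\<lambda>M. S M / C M) \<longlonglongrightarrow> (sqrt 2 / 2) / (sqrt 2 / 2)"
    by (intro tendsto_divide Slim Clim) simp
  then have "(\<lambda>M. S M / C M) \<longlonglongrightarrow> 1" by simp
  moreover have "\<forall>\<^sub>F M in sequentially. S M / C M = r (Suc M) / r M"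
    using eventually_ge_at_top[of 1] by eventually_elim (use r rF in \<open>auto simp: less_imp_neq[symmetric]\<close>)
  ultimately show "(\<lambda>M. r (Suc M) / r M) \<longlonglongrightarrow> 1" by (rule Lim_transform_eventually)
  \<comment> \<open>Eliminating \<open>r M\<close> by \<open>Fk\<close> shows that
    \<open>1 + c * \<theta> M / M\<close> is the factor from \<open>F M\<close> to
    \<open>F (Suc M)\<close>.\<close>
  define \<theta> where "\<theta> M = 1 / (2 * C M * k (M - 1))" for M
  have klim: "k \<longlonglongrightarrow> sqrt 2 / 2"
  proof -
    have "(\<lambda>M. (C (Suc M) + S M) / (1 + S M * C (Suc M) + C M * S (Suc M))) \<longlonglongrightarrow>
       (sqrt 2 / 2 + sqrt 2 / 2) / (1 + sqrt 2 / 2 * (sqrt 2 / 2) + sqrt 2 / 2 * (sqrt 2 / 2))"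
      by (intro tendsto_intros Clim Slim filterlim_compose[OF Clim filterlim_Suc] filterlim_compose[OF Slim filterlim_Suc]) simp
    then have "(\<lambda>M. (C (Suc M) + S M) / (1 + S M * C (Suc M) + C M * S (Suc M))) \<longlonglongrightarrow> sqrt 2 / 2"
      by simp
    moreover have "\<forall>\<^sub>F M in sequentially. (C (Suc M) + S M) / (1 + S M * C (Suc M) + C M * S (Suc M)) = k M"
      using eventually_ge_at_top[of 1] by eventually_elim (simp add: k_eq)
    ultimately show ?thesis by (rule Lim_transform_eventually)
  qed
  have k1lim: "(\<lambda>M. k (M - 1)) \<longlonglongrightarrow> sqrt 2 / 2"
    by (rule LIMSEQ_offset[where k = 1]) (simp add: klim)
  have S1lim: "(\<lambda>M. S (M - 1)) \<longlonglongrightarrow> sqrt 2 / 2"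
    by (rule LIMSEQ_offset[where k = 1]) (simp add: Slim)
  have half: "(1::real) / 2 < sqrt 2 / 2" by simp
  have "\<forall>\<^sub>F M in sequentially. 2 \<le> M \<and> 1 / 2 < C M \<and> 1 / 2 < S (M - 1)"
    by (intro eventually_conj eventually_ge_at_top order_tendstoD(1)[OF Clim half] order_tendstoD(1)[OF S1lim half])
  then obtain N where N: "\<And>M. N \<le> M \<Longrightarrow> 2 \<le> M \<and> 1 / 2 < C M \<and> 1 / 2 < S (M - 1)"
    unfolding eventually_sequentially by blast
  have \<theta>_bound: "\<bar>\<theta> M - 1\<bar> \<le> 18 * A / real M" if "N \<le> M" for M
  proof -
    define M' where "M' = M - 1"
    have M: "2 \<le> M" "1 / 2 < C M" "1 / 2 < S M'" using N[OF that] by (auto simp: M'_def)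
    have M': "M = Suc M'" "1 \<le> M'" "1 \<le> M" using M(1) by (auto simp: M'_def)
    have A': "A / real M' \<le> 2 * A / real M" 
    proof -
      have "A * real M \<le> A * (2 * real M')" using M' \<open>0 \<le> A\<close> by (intro mult_left_mono) auto
      moreover have "0 < real M" "0 < real M'" using M'(2,3) by auto
      ultimately show ?thesis by (simp add: divide_simps mult.commute mult.left_commute)
    qed
    define e where "e = \<bar>\<delta> M\<bar> + \<bar>\<delta> M'\<bar>"
    have e: "e \<le> 3 * A / real M" using A[OF M'(2)] A[OF M'(3)] A' by (simp add: e_def)
    have shift: "\<alpha> M' + \<alpha> M = pi / 2 + (\<delta> M + \<delta> M')" "\<alpha> M' - \<alpha> M = \<delta> M' - \<delta> M" "2 * \<alpha> M = pi/2 + 2 * \<delta> M"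
      by (simp_all add: \<delta>_def)
    have s1: "\<bar>sin (\<alpha> M' + \<alpha> M) - 1\<bar> \<le> e"
    proof -
      have "sin (\<alpha> M' + \<alpha> M) = cos (\<delta> M + \<delta> M')" unfolding shift by (simp add: sin_add)
      moreover have "\<bar>cos (\<delta> M + \<delta> M') - cos 0\<bar> \<le> \<bar>\<delta> M + \<delta> M' - 0\<bar>"
      proof -
        define x where "x = (\<delta> M + \<delta> M') / 2"
        have "cos (2 * x) = 1 - 2 * (sin x)\<^sup>2" by (rule cos_double_sin)
        moreover have "(sin x)\<^sup>2 \<le> \<bar>sin x\<bar>"
          using mult_left_le[of "\<bar>sin x\<bar>" "\<bar>sin x\<bar>"] by (simp add: power2_eq_square flip: abs_mult)
        moreover have "0 \<le> (sin x)\<^sup>2" by simp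
        moreover have "\<bar>sin x\<bar> \<le> \<bar>x\<bar>" by (rule abs_sin_x_le_abs_x)
        ultimately have "\<bar>cos (2 * x) - 1\<bar> \<le> \<bar>2 * x\<bar>" by linarith
        moreover have "2 * x = \<delta> M + \<delta> M'" by (simp add: x_def)
        ultimately show ?thesis by simp
      qed
      ultimately show ?thesis by (simp add: e_def)
    qed
    have s2: "\<bar>sin (\<alpha> M' - \<alpha> M)\<bar> \<le> e"
      unfolding shift e_def using abs_sin_x_le_abs_x[of "\<delta> M' - \<delta> M"] by linarith
    have s3: "\<bar>cos (2 * \<alpha> M)\<bar> \<le> 2 * e"
      unfolding shift e_def using abs_sin_x_le_abs_x[of "2 * \<delta> M"] by (simp add: cos_add)
    have c2: "2 * C M * C M = 1 + cos (2 * \<alpha> M)"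
      using cos_double_cos[of "\<alpha> M"] \<alpha>[OF M'(3)] by (simp add: power2_eq_square)
    have cs: "2 * C M * S M' = sin (\<alpha> M' + \<alpha> M) + sin (\<alpha> M' - \<alpha> M)"
      using \<alpha>[OF M'(3)] \<alpha>[OF M'(2)] by (simp add: sin_add sin_diff)
    have sg: "1 + S M' * C M + C M' * S M = 1 + sin (\<alpha> M' + \<alpha> M)"
      using \<alpha>[OF M'(3)] \<alpha>[OF M'(2)] by (simp add: sin_add)
    \<comment> \<open>\<open>\<theta> M\<close> is
      \<open>(1 + sin (\<alpha> M' + \<alpha> M)) / Q\<close>, where both parts tend to 2. The
      choice of \<open>N\<close> gives \<open>1 \<le> Q\<close>, so the difference of the two parts
      bounds \<open>\<theta> M - 1\<close>.\<close>
    define Q where "Q = 2 * C M * C M + 2 * C M * S M'"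
    have "1 / 2 * (1 / 2) \<le> C M * C M" "1 / 2 * (1 / 2) \<le> C M * S M'" using M by (intro mult_mono; simp)+
    then have Q: "1 \<le> Q" by (simp add: Q_def)
    have \<theta>Q: "\<theta> M = (1 + sin (\<alpha> M' + \<alpha> M)) / Q"
      unfolding \<theta>_def Q_def sg[symmetric] using k_eq[OF M'(2)] M' CS[OF M'(3)] CS[OF M'(2)] sig[OF M'(2)] 
      by (simp add: M'_def[symmetric] algebra_simps)
    have "\<bar>\<theta> M - 1\<bar> = \<bar>1 + sin (\<alpha> M' + \<alpha> M) - Q\<bar> / Q"
      using Q unfolding \<theta>Q by (simp add: field_simps abs_divide)
    also have "\<dots> \<le> \<bar>1 + sin (\<alpha> M' + \<alpha> M) - Q\<bar>" 
      using mult_left_mono[OF Q, of "\<bar>1 + sin (\<alpha> M' + \<alpha> M) - Q\<bar>"] Q by (simp add: divide_le_eq)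
    also have "\<dots> \<le> 6 * e" unfolding Q_def c2 cs using s2 s3 s1 by linarith
    also have "\<dots> \<le> 18 * A / real M" using e by simp
    finally show ?thesis .
  qed
  have F_step: "F (Suc M) = F M * (1 + c * \<theta> M / real M)" if "N \<le> M" for M
  proof -
    have M: "2 \<le> M" "1 \<le> M" "1 \<le> M - 1" "Suc (M - 1) = M" using N[OF that] by auto
    have kp: "0 < k (M - 1)"
      using k_eq[OF M(3)] sig[OF M(3)] CS[OF M(2)] CS[OF M(3)] M(4) by (simp add: add_pos_pos)
    have "r M = c * F M / (2 * real M * k (M - 1))"
      using Fk[OF M(3)] kp M by (simp add: field_simps)
    then show ?thesis unfolding F[OF M(2)] \<theta>_def using kp CS[OF M(2)] M by (simp add: field_simps)
  qed
  obtain K where K: "0 < K" "(\<lambda>M. F M / real M powr c) \<longlonglongrightarrow> K"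
    using powr_growth[OF c(1) _ F_step \<theta>_bound] rF by blast
  have "(\<lambda>M. c / (2 * k (M - 1)) * (F M / real M powr c)) \<longlonglongrightarrow> c / (2 * (sqrt 2 / 2)) * K"
    by (intro tendsto_intros k1lim K) simp
  moreover have "\<forall>\<^sub>F M in sequentially. c / (2 * k (M - 1)) * (F M / real M powr c) = r M / real M powr (c - 1)"
    using eventually_ge_at_top[of 2]
  proof eventually_elim
    case (elim M)
    then have M: "2 \<le> M" "1 \<le> M" "1 \<le> M - 1" "Suc (M - 1) = M" by auto
    have kp: "0 < k (M - 1)"
      using k_eq[OF M(3)] sig[OF M(3)] CS[OF M(2)] CS[OF M(3)] M(4) by (simp add: add_pos_pos)
    have "c * F M = 2 * real M * r M * k (M - 1)" using Fk[OF M(3)] M(4) by simp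
    moreover have "real M powr c = real M * real M powr (c - 1)" using M by (simp add: powr_mult_base)
    ultimately show ?case using kp M by (simp add: field_simps)
  qed
  ultimately have "(\<lambda>M. r M / real M powr (c - 1)) \<longlonglongrightarrow> c / (2 * (sqrt 2 / 2)) * K"
    by (rule Lim_transform_eventually)
  moreover have "0 < c / (2 * (sqrt 2 / 2)) * K" using c K by simp
  ultimately show "\<exists>K>0. (\<lambda>M. r M / real M powr (c - 1)) \<longlonglongrightarrow> K" by blast
qed

section \<open>Positivity of the circle pattern\<close>

text \<open>The map \<open>\<zeta> \<mapsto> \<zeta> / (1 + \<zeta>)\<close> sends the unit circle
  to a vertical line. This is why a neighbour at the common distance contributes to the real part of
  the constraint independently of its direction.\<close>

lemma Re_unit_fraction:
  assumes "cmod \<zeta> = 1" "1 + \<zeta> \<noteq> 0"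
  shows "Re (\<zeta> / (1 + \<zeta>)) = 1 / 2"
proof -
  have "(Re \<zeta>)\<^sup>2 + (Im \<zeta>)\<^sup>2 = 1" using assms(1) by (simp add: cmod_def)
  moreover have "0 < (cmod (1 + \<zeta>))\<^sup>2" using assms(2) by simp
  ultimately show ?thesis
    unfolding cmod_power2 by (simp add: Re_divide power2_eq_square field_simps)
qed

lemma one_plus_i_nz: "1 + \<i> * of_real t \<noteq> 0" "1 - \<i> * of_real t \<noteq> 0"
  by (simp_all add: complex_eq_iff)

text \<open>\<open>a\<close> and \<open>b\<close> are unit numbers given by the tangents of their
  half angles. The real part is half of a number in (-1, 1), and this range is what the positivity
  argument uses.\<close>

lemma cayley_product_Re:
  fixes t \<kappa> :: real
  assumes "0 < t" "0 < \<kappa>"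
    and a: "a * (1 - \<i> * of_real t) = 1 + \<i> * of_real t" and b: "b * (1 - \<i> * of_real \<kappa>) = 1 + \<i> * of_real \<kappa>"
  shows "a + b \<noteq> 0" "Re (a * b / (a + b)) = (1 - t * \<kappa>) / (2 * (1 + t * \<kappa>))"
proof -
  define P where "P = (1 - \<i> * of_real t) * (1 - \<i> * of_real \<kappa>)"
  have P: "P \<noteq> 0" unfolding P_def using one_plus_i_nz by simp
  have s: "(a + b) * P = of_real (2 * (1 + t * \<kappa>))"
  proof -
    have "(a + b) * P = a * (1 - \<i> * of_real t) * (1 - \<i> * of_real \<kappa>) + b * (1 - \<i> * of_real \<kappa>) * (1 - \<i> * of_real t)"
      by (simp add: P_def algebra_simps)
    then show ?thesis unfolding a b by (simp add: algebra_simps)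
  qed
  have p: "a * b * P = (1 + \<i> * of_real t) * (1 + \<i> * of_real \<kappa>)"
    unfolding P_def a[symmetric] b[symmetric] by (simp add: algebra_simps)
  have tk: "0 < t * \<kappa>" using assms by simp
  then have "2 * (1 + t * \<kappa>) \<noteq> 0" by (simp add: add_pos_pos less_imp_neq[symmetric])
  then have "(a + b) * P \<noteq> 0" unfolding s of_real_eq_0_iff .
  then show "a + b \<noteq> 0" by auto
  have "a * b / (a + b) = (a * b * P) / ((a + b) * P)" using P by simp
  also have "\<dots> = (1 + \<i> * of_real t) * (1 + \<i> * of_real \<kappa>) / of_real (2 * (1 + t * \<kappa>))"
    by (simp only: s p)
  also have "Re \<dots> = (1 - t * \<kappa>) / (2 * (1 + t * \<kappa>))" by (simp only: Re_divide_of_real) simp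
  finally show "Re (a * b / (a + b)) = (1 - t * \<kappa>) / (2 * (1 + t * \<kappa>))" .
qed

text \<open>The number \<open>m0\<close> is 1 if the corner of the pattern is degenerate, as for \<open>Z\<^sup>2\<close>, and 0 otherwise. The last
  assumption is what the divided constraint (where \<open>x / 0 = 0\<close>) and the multiplied one have in common.\<close>

locale discrete_power =
  fixes c :: real and f :: "nat \<Rightarrow> nat \<Rightarrow> complex" and \<epsilon> :: complex and d :: "nat \<Rightarrow> real" and m0 :: nat
  assumes c: "0 < c" "c \<le> 2" and m0: "m0 \<le> 1" and unit: "cmod \<epsilon> = 1"
    and cross: "\<And>n m. (f (Suc n) m - f n m) * (f (Suc n) (Suc m) - f n (Suc m))
      + (f n (Suc m) - f n m) * (f (Suc n) (Suc m) - f (Suc n) m) = 0"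
    and d_pos: "\<And>n. m0 \<le> n \<Longrightarrow> 0 < d n" and d_eq: "\<And>n. odd n \<Longrightarrow> d (Suc n) = d n"
    and axis: "f 0 0 = 0" "\<And>n. f (Suc n) 0 = f n 0 + of_real (d n)" "\<And>n. f 0 (Suc n) = f 0 n + \<epsilon>\<^sup>2 * of_real (d n)"
    and constr: "\<And>n m A B X Y. A = f (Suc (Suc n)) (Suc m) - f n (Suc m) \<Longrightarrow> B = f (Suc n) (Suc (Suc m)) - f (Suc n) m \<Longrightarrow>
      X = 2 * of_nat (Suc n) * ((f (Suc (Suc n)) (Suc m) - f (Suc n) (Suc m)) * (f (Suc n) (Suc m) - f n (Suc m))) \<Longrightarrow>
      Y = 2 * of_nat (Suc m) * ((f (Suc n) (Suc (Suc m)) - f (Suc n) (Suc m)) * (f (Suc n) (Suc m) - f (Suc n) m)) \<Longrightarrow>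
      B \<noteq> 0 \<Longrightarrow> (A \<noteq> 0 \<longrightarrow> of_real c * f (Suc n) (Suc m) = X / A + Y / B) \<and>
        (A = 0 \<longrightarrow> X = 0 \<or> of_real c * f (Suc n) (Suc m) = Y / B)"
begin

definition h :: "nat \<Rightarrow> nat \<Rightarrow> complex" where "h n m = f (Suc n) m - f n m"
definition v :: "nat \<Rightarrow> nat \<Rightarrow> complex" where "v n m = f n (Suc m) - f n m"

text \<open>With cross-ratio -1 the far edges are rational in the two edges at the base corner. If
  those were opposite, the relations \<open>e1\<close> and \<open>e2\<close> would force both to
  vanish.\<close>

lemma quad:
  assumes "h n m \<noteq> 0 \<or> v n m \<noteq> 0"
  shows "h n m + v n m \<noteq> 0"
    and "v (Suc n) m = h n m * ((v n m - h n m) / (h n m + v n m))"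
    and "h n (Suc m) = - v n m * ((v n m - h n m) / (h n m + v n m))"
proof -
  have e1: "h n m * h n (Suc m) + v n m * v (Suc n) m = 0"
    using cross[of n m] by (simp add: h_def v_def)
  have e2: "h n m + v (Suc n) m = v n m + h n (Suc m)" by (simp add: h_def v_def)
  show nz: "h n m + v n m \<noteq> 0"
  proof
    assume 0: "h n m + v n m = 0"
    then have "v n m = - h n m" by (simp add: eq_neg_iff_add_eq_0 add.commute)
    then have "h n m * (2 * h n m) = 0" using e1 e2 by algebra
    with \<open>v n m = - h n m\<close> assms show False by simp
  qed
  have "v (Suc n) m * (h n m + v n m) = h n m * (v n m - h n m)"
    "h n (Suc m) * (h n m + v n m) = - v n m * (v n m - h n m)"
    using e1 e2 by algebra+
  then show "v (Suc n) m = h n m * ((v n m - h n m) / (h n m + v n m))"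
    "h n (Suc m) = - v n m * ((v n m - h n m) / (h n m + v n m))"
    using nz by (simp_all add: field_simps)
qed

text \<open>If \<open>n + m\<close> is even, the base vertex is the centre of a circle and \<open>t\<close> is the radius of the opposite circle
  divided by its radius. If \<open>n + m\<close> is odd, the two circles meet orthogonally at the base vertex and \<open>\<kappa>\<close> is
  the ratio of their radii.\<close>

definition kite :: "nat \<Rightarrow> nat \<Rightarrow> bool" where
  "kite n m \<longleftrightarrow> h n m \<noteq> 0 \<and>
     (if even (n + m) then \<exists>t>0. v n m * (1 - \<i> * of_real t) = h n m * (1 + \<i> * of_real t)
      else \<exists>\<kappa>>0. v n m = \<i> * of_real \<kappa> * h n m)"

lemma kite_evenE:
  assumes "kite n m" "even (n + m)"
  obtains t :: real where "0 < t" "h n m \<noteq> 0" "v n m * (1 - \<i> * of_real t) = h n m * (1 + \<i> * of_real t)"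
    "v (Suc n) m = \<i> * of_real t * h n m" "h n (Suc m) = - \<i> * of_real t * v n m" "cmod (v n m) = cmod (h n m)"
proof -
  obtain t where t: "0 < t" and h0: "h n m \<noteq> 0" and eq: "v n m * (1 - \<i> * of_real t) = h n m * (1 + \<i> * of_real t)"
    using assms by (auto simp: kite_def)
  note q = quad[OF disjI1[OF h0]]
  have T: "(v n m - h n m) / (h n m + v n m) = \<i> * of_real t"
  proof -
    have "v n m - h n m = \<i> * of_real t * (h n m + v n m)" using eq by (simp add: algebra_simps)
    then show ?thesis using q(1) by simp
  qed
  have "cmod (v n m) * cmod (1 - \<i> * of_real t) = cmod (h n m) * cmod (1 + \<i> * of_real t)"
    using arg_cong[OF eq, of cmod] by (simp only: norm_mult)
  moreover have "cmod (1 + \<i> * of_real t) = cmod (1 - \<i> * of_real t)" by (simp add: cmod_def)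
  moreover have "cmod (1 - \<i> * of_real t) \<noteq> 0" using one_plus_i_nz(2) norm_eq_zero by blast
  ultimately have "cmod (v n m) = cmod (h n m)" by simp
  with that t h0 eq q(2,3) show thesis unfolding T by (simp add: mult.commute mult.left_commute)
qed

lemma kite_oddE:
  assumes "kite n m" "odd (n + m)"
  obtains \<kappa> :: real where "0 < \<kappa>" "h n m \<noteq> 0" "v n m = \<i> * of_real \<kappa> * h n m"
    "v (Suc n) m * (1 + \<i> * of_real \<kappa>) = - h n m * (1 - \<i> * of_real \<kappa>)"
    "h n (Suc m) * (1 + \<i> * of_real \<kappa>) = v n m * (1 - \<i> * of_real \<kappa>)"
    "v (Suc n) m = \<i> / of_real \<kappa> * h n (Suc m)"
    "cmod (v (Suc n) m) = cmod (h n m)" "cmod (h n (Suc m)) = cmod (v n m)"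
proof -
  obtain \<kappa> where k: "0 < \<kappa>" and h0: "h n m \<noteq> 0" and eq: "v n m = \<i> * of_real \<kappa> * h n m"
    using assms by (auto simp: kite_def)
  note q = quad[OF disjI1[OF h0]]
  have nz: "1 + \<i> * of_real \<kappa> \<noteq> 0" by (rule one_plus_i_nz)
  have T: "(v n m - h n m) / (h n m + v n m) = - (1 - \<i> * of_real \<kappa>) / (1 + \<i> * of_real \<kappa>)"
  proof -
    have "v n m - h n m = h n m * (- (1 - \<i> * of_real \<kappa>))" "h n m + v n m = h n m * (1 + \<i> * of_real \<kappa>)"
      unfolding eq by (simp_all add: algebra_simps)
    then show ?thesis using h0 by simp
  qed
  have n1: "cmod (- (1 - \<i> * of_real \<kappa>) / (1 + \<i> * of_real \<kappa>)) = 1"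
  proof -
    have "cmod (1 - \<i> * of_real \<kappa>) = cmod (1 + \<i> * of_real \<kappa>)" by (simp add: cmod_def)
    then show ?thesis using nz by (simp add: norm_divide norm_minus_commute)
  qed
  show thesis
  proof (rule that[OF k h0 eq])
    show "v (Suc n) m * (1 + \<i> * of_real \<kappa>) = - h n m * (1 - \<i> * of_real \<kappa>)"
      using nz unfolding q(2) T by (simp add: field_simps)
    show "h n (Suc m) * (1 + \<i> * of_real \<kappa>) = v n m * (1 - \<i> * of_real \<kappa>)"
      using nz unfolding q(3) T by (simp add: field_simps)
    show "v (Suc n) m = \<i> / of_real \<kappa> * h n (Suc m)"
    proof -
      have "\<i> / of_real \<kappa> * (- (\<i> * of_real \<kappa> * h n m) * X) = h n m * X" for X
        using k by simp
      then show ?thesis using q(2,3) eq by metis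
    qed
    show "cmod (v (Suc n) m) = cmod (h n m)" "cmod (h n (Suc m)) = cmod (v n m)"
      unfolding q(2,3) T norm_mult n1 by simp_all
  qed
qed

section \<open>Passing positive radii from quadrilateral to quadrilateral\<close>

lemma h_axis: "h n 0 = of_real (d n)" and v_axis: "v 0 n = \<epsilon>\<^sup>2 * of_real (d n)"
  by (simp_all add: h_def v_def axis)

text \<open>Where the circles meet orthogonally all edges lie on two perpendicular lines, so the
  quadrilateral is described by one real ratio, and the three others around the vertex express it as
  a quotient of positive numbers.\<close>

lemma kite_odd_interior:
  assumes "odd (n + m)" "kite n (Suc m)" "kite (Suc n) m" "kite n m"
  shows "kite (Suc n) (Suc m)"
proof -
  obtain t2 where t2: "0 < t2" "h n (Suc m) \<noteq> 0" "v (Suc n) (Suc m) = \<i> * of_real t2 * h n (Suc m)"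
    using kite_evenE[OF assms(2)] assms(1) by (metis add_Suc_right even_Suc)
  obtain t1 where t1: "0 < t1" "h (Suc n) (Suc m) = - \<i> * of_real t1 * v (Suc n) m"
    using kite_evenE[OF assms(3)] assms(1) by (metis add_Suc even_Suc)
  obtain \<kappa> where k: "0 < \<kappa>" "v (Suc n) m = \<i> / of_real \<kappa> * h n (Suc m)"
    using kite_oddE[OF assms(4,1)] by metis
  have h: "h (Suc n) (Suc m) = of_real (t1 / \<kappa>) * h n (Suc m)"
    unfolding t1(2) k(2) by (simp add: field_simps)
  have "v (Suc n) (Suc m) = \<i> * of_real (t2 * \<kappa> / t1) * h (Suc n) (Suc m)"
    unfolding t2(3) h using t1(1) k(1) by (simp add: field_simps)
  moreover have "0 < t2 * \<kappa> / t1" "h (Suc n) (Suc m) \<noteq> 0" using t1(1) t2(1,2) k(1) unfolding h by simp_all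
  ultimately show ?thesis using assms(1) unfolding kite_def by auto
qed

lemma kite_odd_axis:
  assumes "even n" "m0 \<le> n"
  shows "kite n 0 \<Longrightarrow> kite (Suc n) 0" and "kite 0 n \<Longrightarrow> kite 0 (Suc n)"
proof -
  have dp: "0 < d n" "0 < d (Suc n)" using d_pos assms(2) by auto
  show "kite (Suc n) 0" if k: "kite n 0"
  proof -
    obtain t where t: "0 < t" "v (Suc n) 0 = \<i> * of_real t * h n 0"
      using kite_evenE[OF k] assms(1) by (metis add.right_neutral)
    have "v (Suc n) 0 = \<i> * of_real (t * d n / d (Suc n)) * h (Suc n) 0"
      unfolding t(2) h_axis using dp by (simp add: field_simps)
    moreover have "0 < t * d n / d (Suc n)" using t dp by simp
    ultimately show ?thesis using assms(1) dp unfolding kite_def by (auto simp: h_axis)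
  qed
  show "kite 0 (Suc n)" if k: "kite 0 n"
  proof -
    obtain t where t: "0 < t" "h 0 (Suc n) = - \<i> * of_real t * v 0 n"
      using kite_evenE[OF k] assms(1) by (metis add.left_neutral)
    have e: "\<epsilon> \<noteq> 0" using unit by auto
    have "v 0 (Suc n) = \<i> * of_real (d (Suc n) / (t * d n)) * h 0 (Suc n)"
      unfolding t(2) v_axis using dp t by (simp add: field_simps)
    moreover have "0 < d (Suc n) / (t * d n)" using t dp by simp
    moreover have "h 0 (Suc n) \<noteq> 0" unfolding t(2) v_axis using t dp e by simp
    ultimately show ?thesis using assms(1) unfolding kite_def by auto
  qed
qed

text \<open>An odd kite has equal edges on each side, so equality of lengths passes through the
  kites to the left and below; all four edges at the new vertex then have the same length.\<close>

lemma equi_interior: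
  assumes "even (n + m)" "kite n (Suc m)" "kite (Suc n) m" "cmod (h n (Suc m)) = cmod (v (Suc n) m)"
  shows "cmod (h (Suc n) (Suc m)) = cmod (v (Suc n) m)" "cmod (v (Suc n) (Suc m)) = cmod (v (Suc n) m)"
proof -
  have "cmod (v (Suc n) (Suc m)) = cmod (h n (Suc m))"
    using kite_oddE[OF assms(2)] assms(1) by (metis add_Suc_right even_Suc)
  then show "cmod (v (Suc n) (Suc m)) = cmod (v (Suc n) m)" using assms(4) by simp
  show "cmod (h (Suc n) (Suc m)) = cmod (v (Suc n) m)"
    using kite_oddE[OF assms(3)] assms(1) by (metis add_Suc even_Suc)
qed

lemma equi_axis:
  assumes "odd n" "kite n 0"
  shows "cmod (h (Suc n) 0) = cmod (v (Suc n) 0)"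
proof -
  have "cmod (v (Suc n) 0) = cmod (h n 0)"
    using kite_oddE[OF assms(2)] assms(1) by (metis add.right_neutral)
  then show ?thesis by (simp add: h_axis d_eq[OF assms(1)])
qed

text \<open>Equal edges at the base make \<open>(v - h) / (h + v)\<close> purely imaginary. Its
  imaginary part \<open>\<tau>\<close> is the only candidate for the radius ratio, and just its sign
  remains to be decided.\<close>

lemma kite_even_of_far:
  assumes "even (n + m)" and eq: "cmod (h n m) = cmod (v n m)" and h0: "h n m \<noteq> 0"
  obtains \<tau> :: real where "h n (Suc m) = - \<i> * of_real \<tau> * v n m" "0 < \<tau> \<Longrightarrow> kite n m"
proof -
  note q = quad[OF disjI1[OF h0]]
  define T where "T = (v n m - h n m) / (h n m + v n m)"
  have "T * (h n m + v n m) = v n m - h n m" using q(1) by (simp add: T_def)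
  have "Re T = 0"
  proof -
    have "Re ((v n m - h n m) * cnj (h n m + v n m)) = (cmod (v n m))\<^sup>2 - (cmod (h n m))\<^sup>2"
      unfolding cmod_power2 by (simp add: power2_eq_square algebra_simps)
    then have "Re ((v n m - h n m) * cnj (h n m + v n m)) = 0" using eq by simp
    then show ?thesis unfolding T_def by (subst complex_div_cnj) (simp only: Re_divide_of_real div_0)
  qed
  then have T: "T = \<i> * of_real (Im T)" by (simp add: complex_eq_iff)
  show thesis
  proof (rule that[of "Im T"])
    show "h n (Suc m) = - \<i> * of_real (Im T) * v n m"
      using q(3) T unfolding T_def[symmetric] by (metis mult.commute mult_minus_left mult_minus_right)
    assume "0 < Im T"
    moreover have "v n m * (1 - T) = h n m * (1 + T)"
      using \<open>T * (h n m + v n m) = v n m - h n m\<close> by (simp add: algebra_simps)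
    ultimately show "kite n m" using assms(1) h0 T unfolding kite_def by (metis (full_types))
  qed
qed

end

context discrete_power
begin

lemma constraint:
  assumes B: "v (Suc n) (Suc m) + v (Suc n) m \<noteq> 0"
  shows "h (Suc n) (Suc m) + h n (Suc m) \<noteq> 0 \<Longrightarrow> of_real c * f (Suc n) (Suc m) =
      2 * of_nat (Suc n) * (h (Suc n) (Suc m) * h n (Suc m)) / (h (Suc n) (Suc m) + h n (Suc m))
      + 2 * of_nat (Suc m) * (v (Suc n) (Suc m) * v (Suc n) m) / (v (Suc n) (Suc m) + v (Suc n) m)"
    and "h (Suc n) (Suc m) + h n (Suc m) = 0 \<Longrightarrow> h (Suc n) (Suc m) * h n (Suc m) = 0 \<or>
      of_real c * f (Suc n) (Suc m) =
        2 * of_nat (Suc m) * (v (Suc n) (Suc m) * v (Suc n) m) / (v (Suc n) (Suc m) + v (Suc n) m)"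
proof -
  have A': "f (Suc (Suc n)) (Suc m) - f n (Suc m) = h (Suc n) (Suc m) + h n (Suc m)"
    and B': "f (Suc n) (Suc (Suc m)) - f (Suc n) m = v (Suc n) (Suc m) + v (Suc n) m"
    by (simp_all add: h_def v_def)
  have 1: "2 * of_nat (Suc n) * (h (Suc n) (Suc m) * h n (Suc m)) = 0 \<longleftrightarrow> h (Suc n) (Suc m) * h n (Suc m) = 0"
    by (simp del: of_nat_Suc)
  note * = constr[OF A'[symmetric] B'[symmetric] refl refl B, folded h_def v_def]
  show "h (Suc n) (Suc m) + h n (Suc m) \<noteq> 0 \<Longrightarrow> of_real c * f (Suc n) (Suc m) =
      2 * of_nat (Suc n) * (h (Suc n) (Suc m) * h n (Suc m)) / (h (Suc n) (Suc m) + h n (Suc m))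
      + 2 * of_nat (Suc m) * (v (Suc n) (Suc m) * v (Suc n) m) / (v (Suc n) (Suc m) + v (Suc n) m)"
    using * by blast
  show "h (Suc n) (Suc m) + h n (Suc m) = 0 \<Longrightarrow> h (Suc n) (Suc m) * h n (Suc m) = 0 \<or>
      of_real c * f (Suc n) (Suc m) =
        2 * of_nat (Suc m) * (v (Suc n) (Suc m) * v (Suc n) m) / (v (Suc n) (Suc m) + v (Suc n) m)"
    using * unfolding 1 by blast
qed

text \<open>The real part of the constraint at an even vertex, taken along the edge to an odd neighbour, no
  longer involves the fourth neighbour. Comparing it with the constraint at that odd neighbour shows that
  positivity of three of the radii around it implies positivity of the fourth.\<close>

lemma kite_even_step:
  assumes ev: "even (n + m)" and mn: "m \<le> n"
    and kw: "kite (Suc n) (Suc m)" and ks: "kite (Suc n) m" and kl: "kite n (Suc m)"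
    and eq: "cmod (h n (Suc m)) = cmod (h (Suc n) (Suc m))"
    and eqs: "cmod (h (Suc (Suc n)) m) = cmod (v (Suc (Suc n)) m)"
  shows "kite (Suc (Suc n)) m"
proof -
  define w where "w = h (Suc n) (Suc m)"
  obtain t where t: "0 < t" and w0: "w \<noteq> 0" and vw: "v (Suc n) (Suc m) * (1 - \<i> * of_real t) = w * (1 + \<i> * of_real t)"
    and vo: "v (Suc (Suc n)) (Suc m) = \<i> * of_real t * w"
    using kite_evenE[OF kw] ev unfolding w_def by (metis add_Suc add_Suc_right even_Suc)
  obtain \<kappa> where k: "0 < \<kappa>" and vb: "w * (1 + \<i> * of_real \<kappa>) = v (Suc n) m * (1 - \<i> * of_real \<kappa>)"
    and vso: "v (Suc (Suc n)) m = \<i> / of_real \<kappa> * w"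
    using kite_oddE[OF ks] ev unfolding w_def by (metis add_Suc even_Suc)
  obtain \<kappa>' where k': "0 < \<kappa>'" and hl: "v (Suc n) (Suc m) * (1 + \<i> * of_real \<kappa>') = - h n (Suc m) * (1 - \<i> * of_real \<kappa>')"
    using kite_oddE[OF kl] ev by (metis add_Suc_right even_Suc)
  \<comment> \<open>All edges at the even vertex are measured in units of the edge \<open>w\<close>
    to the odd neighbour. \<open>\<zeta>\<close> is the fourth neighbour, known only to have modulus
    1.\<close>
  define a b \<zeta> where "a = v (Suc n) (Suc m) / w" and "b = v (Suc n) m / w" and "\<zeta> = h n (Suc m) / w"
  have ab: "v (Suc n) (Suc m) = w * a" "v (Suc n) m = w * b" "h n (Suc m) = w * \<zeta>"
    using w0 by (simp_all add: a_def b_def \<zeta>_def)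
  have a: "a * (1 - \<i> * of_real t) = 1 + \<i> * of_real t" using vw w0 by (simp add: a_def)
  have b: "b * (1 - \<i> * of_real \<kappa>) = 1 + \<i> * of_real \<kappa>" using vb w0 by (simp add: b_def field_simps)
  have z: "a * (1 + \<i> * of_real \<kappa>') = - \<zeta> * (1 - \<i> * of_real \<kappa>')"
  proof -
    have "a * (1 + \<i> * of_real \<kappa>') = v (Suc n) (Suc m) * (1 + \<i> * of_real \<kappa>') / w" by (simp add: a_def)
    also have "\<dots> = - \<zeta> * (1 - \<i> * of_real \<kappa>')" unfolding hl by (simp add: \<zeta>_def)
    finally show ?thesis .
  qed
  have z1: "cmod \<zeta> = 1" using eq w0 by (simp add: \<zeta>_def norm_divide w_def)
  have z0: "1 + \<zeta> \<noteq> 0"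
  proof
    assume "1 + \<zeta> = 0"
    then have "\<zeta> = - 1" by (simp add: add_eq_0_iff)
    then have "a * (1 + \<i> * of_real \<kappa>') = 1 - \<i> * of_real \<kappa>'" using z by simp
    moreover have "(1 + \<i> * of_real t) * (1 + \<i> * of_real \<kappa>') = (1 - \<i> * of_real t) * (a * (1 + \<i> * of_real \<kappa>'))"
      unfolding a[symmetric] by (simp only: mult_ac)
    ultimately have "(1 + \<i> * of_real t) * (1 + \<i> * of_real \<kappa>') = (1 - \<i> * of_real t) * (1 - \<i> * of_real \<kappa>')"
      by simp
    then have "Im ((1 + \<i> * of_real t) * (1 + \<i> * of_real \<kappa>')) = Im ((1 - \<i> * of_real t) * (1 - \<i> * of_real \<kappa>'))"
      by simp
    then show False using t k' by simp
  qed
  note ab0 = cayley_product_Re(1)[OF t k a b] and abRe = cayley_product_Re(2)[OF t k a b]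
  define q where "q = (1 - t * \<kappa>) / (1 + t * \<kappa>)"
  have tk: "0 < t * \<kappa>" using t k by simp
  then have q: "- 1 < q" "q < 1" by (simp_all add: q_def divide_simps)
  define P where "P = Re (of_real c * f (Suc n) (Suc m) / w)"
  have "of_real c * f (Suc n) (Suc m) / w
      = of_real (2 * real (Suc n)) * (\<zeta> / (1 + \<zeta>)) + of_real (2 * real (Suc m)) * (a * b / (a + b))"
  proof -
    have sums: "v (Suc n) (Suc m) + v (Suc n) m = w * (a + b)" "w + h n (Suc m) = w * (1 + \<zeta>)"
      unfolding ab by (simp_all add: algebra_simps)
    have "of_real c * f (Suc n) (Suc m) = 2 * of_nat (Suc n) * (w * (w * \<zeta>)) / (w * (1 + \<zeta>))
      + 2 * of_nat (Suc m) * ((w * a) * (w * b)) / (w * (a + b))"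
      using constraint(1)[of n m] sums w0 z0 ab0 unfolding w_def[symmetric] by (simp add: ab)
    then show ?thesis using w0 by (simp add: add_divide_distrib mult.assoc)
  qed
  then have "P = 2 * real (Suc n) * Re (\<zeta> / (1 + \<zeta>)) + 2 * real (Suc m) * Re (a * b / (a + b))"
    unfolding P_def by (simp only: plus_complex.sel times_complex.sel Re_complex_of_real Im_complex_of_real mult_zero_left diff_zero)
  also have "\<dots> = real (Suc n) + real (Suc m) * q"
  proof -
    have half: "2 * N * (x / (2 * y)) = N * (x / y)" "2 * N * (1 / 2) = N" for N x y :: real by simp_all
    show ?thesis unfolding Re_unit_fraction[OF z1 z0] abRe q_def by (simp only: half)
  qed
  finally have P_eq: "P = real (Suc n) + real (Suc m) * q" .
  \<comment> \<open>Both bounds use \<open>m \<le> n\<close>: the lower one needs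
    \<open>0 < c\<close> and the upper one \<open>c \<le> 2\<close>. They are exactly what makes the
    solution of \<open>P + c = 2 (n + 2) \<theta> / (1 + \<theta>)\<close> positive.\<close>
  have Pc: "0 < P + c" "P + c < 2 * real (Suc (Suc n))"
  proof -
    define X where "X = real (Suc m) * q"
    have "- real (Suc m) < X" "X < real (Suc m)"
      using mult_strict_left_mono[OF q(1), of "real (Suc m)"] mult_strict_left_mono[OF q(2), of "real (Suc m)"]
      by (simp_all add: X_def)
    moreover have "real m \<le> real n" using mn by simp
    ultimately show "0 < P + c" "P + c < 2 * real (Suc (Suc n))"
      using c unfolding P_eq X_def[symmetric] by simp_all
  qed
  have s0: "h (Suc (Suc n)) m \<noteq> 0"
  proof
    assume "h (Suc (Suc n)) m = 0"
    then have "v (Suc (Suc n)) m = 0" using eqs by simp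
    then show False using vso w0 k by simp
  qed
  obtain \<tau> where tau: "h (Suc (Suc n)) (Suc m) = - \<i> * of_real \<tau> * v (Suc (Suc n)) m"
    and K: "0 < \<tau> \<Longrightarrow> kite (Suc (Suc n)) m"
    using kite_even_of_far[OF _ eqs s0] ev by auto
  define \<theta> where "\<theta> = \<tau> / \<kappa>"
  have ho: "h (Suc (Suc n)) (Suc m) = of_real \<theta> * w"
    unfolding tau vso \<theta>_def using k by (simp add: field_simps)
  have fo: "f (Suc (Suc n)) (Suc m) = f (Suc n) (Suc m) + w" by (simp add: w_def h_def)
  have tk': "0 < t + 1 / \<kappa>" using t k by (simp add: add_pos_pos)
  \<comment> \<open>At the odd neighbour the vertical edges are imaginary multiples of
    \<open>w\<close>, so their term in the constraint, divided by \<open>w\<close>, has real part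
    0.\<close>
  have Bo: "v (Suc (Suc n)) (Suc m) + v (Suc (Suc n)) m = \<i> * of_real (t + 1 / \<kappa>) * w"
    unfolding vo vso by (simp add: algebra_simps)
  have Bo0: "v (Suc (Suc n)) (Suc m) + v (Suc (Suc n)) m \<noteq> 0"
    unfolding Bo using tk' w0 by (simp del: of_real_add)
  have Yo: "Re (2 * of_nat (Suc m) * (v (Suc (Suc n)) (Suc m) * v (Suc (Suc n)) m)
      / (v (Suc (Suc n)) (Suc m) + v (Suc (Suc n)) m) / w) = 0"
  proof -
    have "2 * of_nat (Suc m) * (v (Suc (Suc n)) (Suc m) * v (Suc (Suc n)) m)
      / (v (Suc (Suc n)) (Suc m) + v (Suc (Suc n)) m) / w
      = \<i> * of_real (2 * real (Suc m) * (t / \<kappa>) / (t + 1 / \<kappa>))"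
    proof -
      have gen: "2 * N * (\<i> * a * w * (\<i> / k * w)) / (\<i> * T * w) / w = \<i> * (2 * N * (a / k) / T)"
        if "T \<noteq> 0" "k \<noteq> 0" for N a k T :: complex
        using w0 that by (simp add: field_simps)
      show ?thesis
        unfolding Bo unfolding vo vso
        using gen[of "of_real (t + 1 / \<kappa>)" "of_real \<kappa>" "of_nat (Suc m)" "of_real t"] tk' k
        by (simp del: of_nat_Suc of_real_add)
    qed
    then show ?thesis by simp
  qed
  have Ro: "Re (of_real c * f (Suc (Suc n)) (Suc m) / w) = P + c"
    using w0 unfolding fo P_def by (simp add: algebra_simps add_divide_distrib)
  have "0 < \<theta>"
  proof (cases "\<theta> = - 1")
    \<comment> \<open>Here the horizontal denominator vanishes while its numerator does not; what
      the constraint still provides is \<open>P + c = 0\<close>, against \<open>Pc\<close>.\<close>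
    case True
    then have "h (Suc (Suc n)) (Suc m) + h (Suc n) (Suc m) = 0" "h (Suc (Suc n)) (Suc m) * h (Suc n) (Suc m) \<noteq> 0"
      using w0 unfolding ho w_def[symmetric] by auto
    then have "of_real c * f (Suc (Suc n)) (Suc m) =
        2 * of_nat (Suc m) * (v (Suc (Suc n)) (Suc m) * v (Suc (Suc n)) m) / (v (Suc (Suc n)) (Suc m) + v (Suc (Suc n)) m)"
      using constraint(2)[OF Bo0] by blast
    then have "P + c = 0" using Ro Yo by simp
    with Pc show ?thesis by simp
  next
    case False
    then have \<theta>1: "1 + \<theta> \<noteq> 0" by (simp add: add_eq_0_iff)
    have Ao: "h (Suc (Suc n)) (Suc m) + h (Suc n) (Suc m) = of_real (1 + \<theta>) * w"
      unfolding ho w_def[symmetric] by (simp add: algebra_simps)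
    have Ao0: "h (Suc (Suc n)) (Suc m) + h (Suc n) (Suc m) \<noteq> 0"
      unfolding Ao using \<theta>1 w0 by (simp del: of_real_add)
    have Xo: "2 * of_nat (Suc (Suc n)) * (h (Suc (Suc n)) (Suc m) * h (Suc n) (Suc m))
      / (h (Suc (Suc n)) (Suc m) + h (Suc n) (Suc m)) / w = of_real (2 * real (Suc (Suc n)) * \<theta> / (1 + \<theta>))"
      unfolding Ao unfolding ho w_def[symmetric] using w0 \<theta>1 by (simp del: of_real_add of_nat_Suc)
    have "P + c = 2 * real (Suc (Suc n)) * \<theta> / (1 + \<theta>)"
      using Ro Yo unfolding constraint(1)[OF Bo0 Ao0] add_divide_distrib Xo
      by (simp only: plus_complex.sel Re_complex_of_real)
    then have "\<theta> * (2 * real (Suc (Suc n)) - (P + c)) = P + c"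
      using \<theta>1 by (simp add: field_simps)
    then show ?thesis using Pc by (metis diff_gt_0_iff_gt zero_less_mult_pos2)
  qed
  then have "0 < \<tau>" using k by (simp add: \<theta>_def zero_less_divide_iff)
  then show ?thesis by (rule K)
qed

section \<open>Reflection symmetry in the diagonal, one antidiagonal at a time\<close>

definition mirror :: "nat \<Rightarrow> bool" where
  "mirror L \<longleftrightarrow> (\<forall>n m. n + m = L \<longrightarrow> f m n = \<epsilon>\<^sup>2 * cnj (f n m))"

lemma mirrorD: "mirror L \<Longrightarrow> n + m = L \<Longrightarrow> f m n = \<epsilon>\<^sup>2 * cnj (f n m)"
  unfolding mirror_def by blast

lemma unit_mult: "\<epsilon> * cnj \<epsilon> = 1" "\<epsilon> \<noteq> 0"
  using unit complex_norm_square[of \<epsilon>] by auto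

lemma mirror_hv:
  assumes "mirror (n + m)" "mirror (Suc (n + m))"
  shows "h m n = \<epsilon>\<^sup>2 * cnj (v n m)" "v m n = \<epsilon>\<^sup>2 * cnj (h n m)"
proof -
  have 1: "f m n = \<epsilon>\<^sup>2 * cnj (f n m)" by (rule mirrorD[OF assms(1) refl])
  have 2: "f (Suc m) n = \<epsilon>\<^sup>2 * cnj (f n (Suc m))" by (rule mirrorD[OF assms(2)]) simp
  have 3: "f m (Suc n) = \<epsilon>\<^sup>2 * cnj (f (Suc n) m)" by (rule mirrorD[OF assms(2)]) simp
  show "h m n = \<epsilon>\<^sup>2 * cnj (v n m)" "v m n = \<epsilon>\<^sup>2 * cnj (h n m)"
    unfolding h_def v_def 1 2 3 by (simp_all only: complex_cnj_diff right_diff_distrib)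
qed

lemma mirror_axis: "f 0 n = \<epsilon>\<^sup>2 * cnj (f n 0)" "f n 0 = \<epsilon>\<^sup>2 * cnj (f 0 n)"
proof -
  have 1: "cnj (f n 0) = f n 0 \<and> f 0 n = \<epsilon>\<^sup>2 * f n 0" for n
    by (induction n) (auto simp: axis algebra_simps)
  then show "f 0 n = \<epsilon>\<^sup>2 * cnj (f n 0)" by metis
  have "\<epsilon>\<^sup>2 * cnj (f 0 n) = (\<epsilon> * cnj \<epsilon>)\<^sup>2 * f n 0"
    using 1[of n] by (simp add: power_mult_distrib)
  then show "f n 0 = \<epsilon>\<^sup>2 * cnj (f 0 n)" by (simp add: unit_mult)
qed

lemma mirror_01: "mirror 0" "mirror (Suc 0)"
proof -
  show "mirror 0" unfolding mirror_def using mirror_axis(1)[of 0] by simp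
  show "mirror (Suc 0)" unfolding mirror_def
  proof (intro allI impI)
    fix n m :: nat assume "n + m = Suc 0"
    then consider "n = 0" | "m = 0" by linarith
    then show "f m n = \<epsilon>\<^sup>2 * cnj (f n m)" by cases (simp_all only: mirror_axis[symmetric])
  qed
qed

lemma kite_swap:
  assumes "kite n m" "mirror (n + m)" "mirror (Suc (n + m))"
  shows "kite m n"
proof (cases "even (n + m)")
  case True
  obtain t where t: "0 < t" "h n m \<noteq> 0" "v n m * (1 - \<i> * of_real t) = h n m * (1 + \<i> * of_real t)"
    "cmod (v n m) = cmod (h n m)"
    using kite_evenE[OF assms(1) True] by metis
  have "cnj (v n m) * (1 + \<i> * of_real t) = cnj (h n m) * (1 - \<i> * of_real t)"
    using arg_cong[OF t(3), of cnj] by simp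
  then have "v m n * (1 - \<i> * of_real t) = h m n * (1 + \<i> * of_real t)"
    unfolding mirror_hv[OF assms(2,3)] by (simp only: mult.assoc)
  moreover have "h m n \<noteq> 0" unfolding mirror_hv[OF assms(2,3)] using t unit_mult by auto
  ultimately show ?thesis using t True unfolding kite_def by (auto simp: add.commute)
next
  case False
  then have odd: "odd (n + m)" .
  obtain \<kappa> where k: "0 < \<kappa>" "h n m \<noteq> 0" "v n m = \<i> * of_real \<kappa> * h n m"
    using kite_oddE[OF assms(1) odd] by metis
  have "v m n = \<i> * of_real (1 / \<kappa>) * h m n"
    unfolding mirror_hv[OF assms(2,3)] k(3) using k by (simp add: field_simps)
  moreover have "h m n \<noteq> 0" unfolding mirror_hv[OF assms(2,3)] k(3) using k unit_mult by auto
  moreover have "0 < 1 / \<kappa>" using k by simp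
  ultimately show ?thesis using False unfolding kite_def by (metis add.commute)
qed

text \<open>The last corner of a quadrilateral is determined by the other three. Reflection replaces
  the factor \<open>X\<close> in \<open>quad\<close> by \<open>- cnj X\<close>, which interchanges
  the formulas for the two far edges.\<close>

lemma mirror_step:
  assumes "mirror L" "mirror (Suc L)" and k: "\<And>n m. n + m = L \<Longrightarrow> kite n m"
  shows "mirror (Suc (Suc L))"
  unfolding mirror_def
proof (intro allI impI)
  fix n m :: nat assume nm: "n + m = Suc (Suc L)"
  show "f m n = \<epsilon>\<^sup>2 * cnj (f n m)"
  proof (cases n)
    case 0 then show ?thesis using mirror_axis(2) by simp
  next
    case (Suc n')
    show ?thesis
    proof (cases m)
      case 0 then show ?thesis using mirror_axis(1) by simp
    next
      case (Suc m')
      with \<open>n = Suc n'\<close> nm have L: "n' + m' = L" "m' + n' = L" by simp_all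
      note s = mirror_hv[of n' m', unfolded L, OF assms(1,2)]
      have h0: "h n' m' \<noteq> 0" "h m' n' \<noteq> 0" using k L by (auto simp: kite_def)
      have "f (Suc m') (Suc n') = f m' n' + h m' n' + v (Suc m') n'" by (simp add: h_def v_def)
      also have "v (Suc m') n' = h m' n' * ((v m' n' - h m' n') / (h m' n' + v m' n'))"
        by (rule quad(2)) (use h0 in blast)
      also have "f m' n' + h m' n' + \<dots> = \<epsilon>\<^sup>2 * cnj (f n' m' + v n' m' + (- v n' m' * ((v n' m' - h n' m') / (h n' m' + v n' m'))))"
      proof -
        have "f m' n' = \<epsilon>\<^sup>2 * cnj (f n' m')" by (rule mirrorD[OF assms(1) L(1)])
        moreover define X where "X = (v n' m' - h n' m') / (h n' m' + v n' m')"
        moreover have "(v m' n' - h m' n') / (h m' n' + v m' n') = - cnj X"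
        proof -
          have "v m' n' - h m' n' = \<epsilon>\<^sup>2 * (- cnj (v n' m' - h n' m'))" "h m' n' + v m' n' = \<epsilon>\<^sup>2 * cnj (h n' m' + v n' m')"
            unfolding s by (simp_all add: algebra_simps)
          then show ?thesis using unit_mult by (simp add: X_def minus_divide_left)
        qed
        ultimately have "f m' n' + h m' n' + h m' n' * ((v m' n' - h m' n') / (h m' n' + v m' n'))
            = \<epsilon>\<^sup>2 * cnj (f n' m') + \<epsilon>\<^sup>2 * cnj (v n' m') + \<epsilon>\<^sup>2 * cnj (v n' m') * (- cnj X)"
          by (simp only: s(1))
        also have "\<dots> = \<epsilon>\<^sup>2 * cnj (f n' m' + v n' m' + (- v n' m' * X))" by (simp add: algebra_simps)
        finally show ?thesis by (simp only: X_def)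
      qed
      also have "- v n' m' * ((v n' m' - h n' m') / (h n' m' + v n' m')) = h n' (Suc m')"
        by (rule quad(3)[symmetric]) (use h0 in blast)
      also have "f n' m' + v n' m' + h n' (Suc m') = f (Suc n') (Suc m')" by (simp add: h_def v_def)
      finally show ?thesis using \<open>n = Suc n'\<close> Suc by simp
    qed
  qed
qed

section \<open>The diagonal recursion and the induction that drives positivity\<close>

definition rad :: "nat \<Rightarrow> real" where "rad M = cmod (h M M)"
definition co :: "nat \<Rightarrow> real" where "co M = Re (h M M / \<epsilon>) / rad M"
definition si :: "nat \<Rightarrow> real" where "si M = - Im (h M M / \<epsilon>) / rad M"
definition mid :: "nat \<Rightarrow> real" where "mid M = Re (f M M / \<epsilon>)"

text \<open>\<open>c * mid M / (4 * rad M)\<close> is the Riccati coefficient \<open>G\<close>,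
  which ties the analytic function to the map. Strict positivity of \<open>mid\<close> is asked from
  1 on because \<open>f 0 0 = 0\<close>.\<close>

definition diagonal :: "nat \<Rightarrow> bool" where
  "diagonal M \<longleftrightarrow> level (c / 2) M (co M) (si M) (c * mid M / (4 * rad M)) \<and>
     f M M = \<epsilon> * of_real (mid M) \<and> 0 < rad M \<and> 0 \<le> mid M \<and> (1 \<le> M \<longrightarrow> 0 < mid M)"

lemma h_diag:
  assumes "0 < rad M"
  shows "h M M = \<epsilon> * of_real (rad M) * (of_real (co M) - \<i> * of_real (si M))"
proof -
  have "h M M / \<epsilon> = of_real (rad M) * (of_real (co M) - \<i> * of_real (si M))"
    using assms by (simp add: complex_eq_iff co_def si_def)
  then show ?thesis using unit_mult by (simp add: field_simps)
qed

lemma v_diag: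
  assumes "0 < rad M" "mirror (M + M)" "mirror (Suc (M + M))"
  shows "v M M = \<epsilon> * of_real (rad M) * (of_real (co M) + \<i> * of_real (si M))"
proof -
  have "v M M = \<epsilon> * (\<epsilon> * cnj \<epsilon>) * of_real (rad M) * (of_real (co M) + \<i> * of_real (si M))"
    unfolding mirror_hv(2)[OF assms(2,3)] h_diag[OF assms(1)] by (simp add: power2_eq_square)
  then show ?thesis by (simp add: unit_mult)
qed

lemma co_si: "0 < rad M \<Longrightarrow> (co M)\<^sup>2 + (si M)\<^sup>2 = 1"
proof -
  assume r: "0 < rad M"
  have "rad M = cmod (h M M / \<epsilon>)" by (simp add: rad_def norm_divide unit)
  then have "(rad M)\<^sup>2 = (Re (h M M / \<epsilon>))\<^sup>2 + (Im (h M M / \<epsilon>))\<^sup>2" by (simp only: cmod_power2)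
  have "(co M)\<^sup>2 + (si M)\<^sup>2 = ((Re (h M M / \<epsilon>))\<^sup>2 + (Im (h M M / \<epsilon>))\<^sup>2) / (rad M)\<^sup>2"
    by (simp add: co_def si_def power_divide add_divide_distrib)
  also have "\<dots> = (rad M)\<^sup>2 / (rad M)\<^sup>2" by (simp only: \<open>(rad M)\<^sup>2 = _\<close>)
  finally show ?thesis using r by simp
qed

lemma diagonal_kite:
  assumes "diagonal M" "mirror (M + M)" "mirror (Suc (M + M))"
  shows "v M M * (1 - \<i> * of_real (si M / co M)) = h M M * (1 + \<i> * of_real (si M / co M))" "kite M M"
proof -
  have r: "0 < rad M" and cs: "0 < co M" "0 < si M"
    using assms(1) by (auto simp: diagonal_def level_def)
  show eq: "v M M * (1 - \<i> * of_real (si M / co M)) = h M M * (1 + \<i> * of_real (si M / co M))"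
  proof -
    have e: "1 - \<i> * of_real (si M / co M) = (of_real (co M) - \<i> * of_real (si M)) / of_real (co M)"
      "1 + \<i> * of_real (si M / co M) = (of_real (co M) + \<i> * of_real (si M)) / of_real (co M)"
      using cs by (simp_all add: diff_divide_distrib add_divide_distrib)
    show ?thesis unfolding e v_diag[OF r assms(2,3)] h_diag[OF r] by simp
  qed
  have "h M M \<noteq> 0" using r by (auto simp: rad_def)
  then show "kite M M" using eq cs unfolding kite_def by (auto intro!: exI[of _ "si M / co M"])
qed

text \<open>The kite beside the diagonal carries the radius to the new vertex and keeps the
  denominators of the constraint there from vanishing. That constraint is then the discrete Painleve
  equation, and \<open>level_step\<close> provides the sign of the new edge.\<close>

lemma diagonal_step:
  assumes dg: "diagonal M" and s: "\<And>L. L \<le> M + M + 3 \<Longrightarrow> mirror L"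
    and k: "kite (Suc M) M"
  shows "diagonal (Suc M)" "rad (Suc M) = rad M * si M / co M" "mid (Suc M) = mid M + rad M / co M"
    "c * mid (Suc M) * (1 + si M * co (Suc M) + co M * si (Suc M)) = 2 * real (Suc M) * rad (Suc M) * (co (Suc M) + si M)"
proof -
  have r: "0 < rad M" and cs: "0 < co M" "0 < si M" and lev: "level (c / 2) M (co M) (si M) (c * mid M / (4 * rad M))"
    and fM: "f M M = \<epsilon> * of_real (mid M)" and mid0: "0 \<le> mid M"
    using dg by (auto simp: diagonal_def level_def)
  note sM = s[of "M + M", simplified] s[of "Suc (M + M)", simplified]
  note hM = h_diag[OF r] and vM = v_diag[OF r sM]
  have unitM: "(co M)\<^sup>2 + (si M)\<^sup>2 = 1" by (rule co_si[OF r])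
  define \<tau> where "\<tau> = si M / co M"
  have \<tau>: "0 < \<tau>" "\<tau> * co M = si M" using cs by (simp_all add: \<tau>_def)
  have kM: "v M M * (1 - \<i> * of_real \<tau>) = h M M * (1 + \<i> * of_real \<tau>)"
    using diagonal_kite(1)[OF dg sM] by (simp add: \<tau>_def)
  have far: "v (Suc M) M = \<i> * of_real \<tau> * h M M" "h M (Suc M) = - \<i> * of_real \<tau> * v M M"
  proof -
    have hn: "h M M \<noteq> 0" using r by (auto simp: rad_def)
    note q = quad[OF disjI1[OF hn]]
    have "v M M - h M M = \<i> * of_real \<tau> * (h M M + v M M)" using kM by (simp add: algebra_simps)
    then have T: "(v M M - h M M) / (h M M + v M M) = \<i> * of_real \<tau>" using q(1) by simp
    show "v (Suc M) M = \<i> * of_real \<tau> * h M M" "h M (Suc M) = - \<i> * of_real \<tau> * v M M"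
      using q(2,3) unfolding T by simp_all
  qed
  obtain \<kappa> where kap: "0 < \<kappa>" and hw: "h (Suc M) (Suc M) * (1 + \<i> * of_real \<kappa>) = v (Suc M) M * (1 - \<i> * of_real \<kappa>)"
    and hw_abs: "cmod (h (Suc M) (Suc M)) = cmod (v (Suc M) M)"
    using kite_oddE[OF k] by (metis add_Suc even_Suc even_add)
  show r': "rad (Suc M) = rad M * si M / co M"
  proof -
    have "cmod (v (Suc M) M) = \<tau> * cmod (h M M)" unfolding far(1) using \<tau>(1) by (simp add: norm_mult)
    then show ?thesis unfolding rad_def hw_abs by (simp add: \<tau>_def)
  qed
  have r0: "0 < rad (Suc M)" unfolding r' using r cs by simp
  have rr: "rad (Suc M) = \<tau> * rad M" unfolding r' \<tau>_def by simp
  have sM': "mirror (Suc M + Suc M)" "mirror (Suc (Suc M + Suc M))" by (rule s; simp)+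
  note hM' = h_diag[OF r0] and vM' = v_diag[OF r0 sM']
  have unitM': "(co (Suc M))\<^sup>2 + (si (Suc M))\<^sup>2 = 1" by (rule co_si[OF r0])
  have fM': "f (Suc M) (Suc M) = \<epsilon> * of_real (mid M + rad M / co M)"
  proof -
    have "f (Suc M) (Suc M) = f M M + (h M M + v (Suc M) M)" by (simp add: h_def v_def)
    also have "h M M + v (Suc M) M = \<epsilon> * of_real (rad M) *
        ((of_real (co M) - \<i> * of_real (si M)) * (1 + \<i> * of_real \<tau>))"
      unfolding far(1) hM by (simp add: algebra_simps)
    also have "(of_real (co M) - \<i> * of_real (si M)) * (1 + \<i> * of_real \<tau>) = of_real (1 / co M)"
    proof -
      have "co M + si M * \<tau> = 1 / co M" using unitM cs by (simp add: \<tau>_def field_simps power2_eq_square)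
      then show ?thesis using \<tau>(2) by (simp add: complex_eq_iff mult.commute)
    qed
    finally show ?thesis unfolding fM by (simp add: algebra_simps)
  qed
  show mid': "mid (Suc M) = mid M + rad M / co M"
    unfolding mid_def[of "Suc M"] fM' using unit_mult by simp
  define x y where "x = co (Suc M) + si M" and "y = si (Suc M) + co M"
  have hsum: "h (Suc M) (Suc M) + h M (Suc M) = \<epsilon> * of_real (rad (Suc M)) * (of_real x - \<i> * of_real y)"
    unfolding hM' far(2) vM rr x_def y_def by (simp add: algebra_simps)
  have vsum: "v (Suc M) (Suc M) + v (Suc M) M = \<epsilon> * of_real (rad (Suc M)) * (of_real x + \<i> * of_real y)"
    unfolding vM' far(1) hM rr x_def y_def by (simp add: algebra_simps)
  \<comment> \<open>If both vanish, the edge \<open>h (Suc M) (Suc M)\<close> folds back along the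
    incoming edge, which a positive \<open>\<kappa>\<close> forbids.\<close>
  have xy: "x \<noteq> 0 \<or> y \<noteq> 0"
  proof (rule ccontr)
    assume "\<not> (x \<noteq> 0 \<or> y \<noteq> 0)"
    then have C': "co (Suc M) = - si M" "si (Suc M) = - co M" by (simp_all add: x_def y_def)
    have "\<epsilon> * of_real (rad (Suc M)) * ((of_real (- si M) + \<i> * of_real (co M)) * (1 + \<i> * of_real \<kappa>))
        = \<epsilon> * of_real (rad (Suc M)) * ((of_real (si M) + \<i> * of_real (co M)) * (1 - \<i> * of_real \<kappa>))"
      using hw unfolding hM' far(1) hM C' rr by (simp add: algebra_simps)
    then have "(of_real (- si M) + \<i> * of_real (co M)) * (1 + \<i> * of_real \<kappa>) = (of_real (si M) + \<i> * of_real (co M)) * (1 - \<i> * of_real \<kappa>)"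
      using unit_mult r0 by simp
    then have "2 * (si M + co M * \<kappa>) = 0" by (simp add: complex_eq_iff algebra_simps)
    then have "si M + co M * \<kappa> = 0" by simp
    moreover have "0 < co M * \<kappa>" using cs kap by simp
    ultimately show False using cs by linarith
  qed
  define \<sigma> where "\<sigma> = 1 + si M * co (Suc M) + co M * si (Suc M)"
  have xy\<sigma>: "x\<^sup>2 + y\<^sup>2 = 2 * \<sigma>"
    unfolding x_def y_def \<sigma>_def using unitM unitM' by (simp add: power2_eq_square algebra_simps)
  have \<sigma>0: "0 < \<sigma>"
  proof -
    have "0 < x\<^sup>2 + y\<^sup>2" using xy by (simp add: sum_power2_gt_zero_iff)
    then show ?thesis unfolding xy\<sigma> by simp
  qed
  have hs0: "h (Suc M) (Suc M) + h M (Suc M) \<noteq> 0" and vs0: "v (Suc M) (Suc M) + v (Suc M) M \<noteq> 0"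
  proof -
    have "of_real x - \<i> * of_real y \<noteq> 0" "of_real x + \<i> * of_real y \<noteq> 0"
      using xy by (auto simp: complex_eq_iff)
    then show "h (Suc M) (Suc M) + h M (Suc M) \<noteq> 0" "v (Suc M) (Suc M) + v (Suc M) M \<noteq> 0"
      unfolding hsum vsum using unit_mult r0 by auto
  qed
  show dPII: "c * mid (Suc M) * (1 + si M * co (Suc M) + co M * si (Suc M)) = 2 * real (Suc M) * rad (Suc M) * (co (Suc M) + si M)"
  proof -
    \<comment> \<open>The primed numbers are the conjugates: by symmetry the two terms of the
      constraint add up to twice a real part, namely \<open>2 * x\<close> over
      \<open>x\<^sup>2 + y\<^sup>2 = 2 * \<sigma>\<close>.\<close>
    define z z' p p' where "z = of_real x - \<i> * of_real y" and "z' = of_real x + \<i> * of_real y"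
      and "p = (of_real (co (Suc M)) - \<i> * of_real (si (Suc M))) * (of_real (si M) - \<i> * of_real (co M))"
      and "p' = (of_real (co (Suc M)) + \<i> * of_real (si (Suc M))) * (of_real (si M) + \<i> * of_real (co M))"
    define E where "E = \<epsilon> * of_real (rad (Suc M))"
    have E0: "E \<noteq> 0" using unit_mult r0 by (simp add: E_def)
    have z0: "z \<noteq> 0" "z' \<noteq> 0" using xy by (auto simp: z_def z'_def complex_eq_iff)
    have hp: "h (Suc M) (Suc M) * h M (Suc M) = E * E * p"
      unfolding hM' far(2) vM p_def E_def rr by (simp add: algebra_simps)
    have vp: "v (Suc M) (Suc M) * v (Suc M) M = E * E * p'"
      unfolding vM' far(1) hM p'_def E_def rr by (simp add: algebra_simps)
    have "of_real c * f (Suc M) (Suc M) = 2 * of_nat (Suc M) * (E * E * p) / (E * z) + 2 * of_nat (Suc M) * (E * E * p') / (E * z')"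
      using constraint(1)[OF vs0 hs0] unfolding hp vp hsum vsum E_def[symmetric] z_def[symmetric] z'_def[symmetric] .
    also have "\<dots> = E * (2 * of_nat (Suc M) * ((p * z' + p' * z) / (z * z')))"
      using E0 z0 by (simp add: field_simps)
    also have "p * z' + p' * z = of_real (2 * x)"
      unfolding p_def p'_def z_def z'_def x_def y_def using unitM unitM'
      by (simp add: complex_eq_iff power2_eq_square, algebra)
    also have "z * z' = of_real (2 * \<sigma>)"
      unfolding xy\<sigma>[symmetric] z_def z'_def by (simp add: complex_eq_iff power2_eq_square)
    finally have "\<epsilon> * of_real (c * mid (Suc M)) = \<epsilon> * of_real (rad (Suc M) * (2 * real (Suc M) * ((2 * x) / (2 * \<sigma>))))"
      unfolding fM' mid'[symmetric] E_def by (simp add: mult.assoc mult.left_commute)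
    then have "c * mid (Suc M) = rad (Suc M) * (2 * real (Suc M) * ((2 * x) / (2 * \<sigma>)))"
      using unit_mult by (simp only: mult_cancel_left of_real_eq_iff) simp
    then show ?thesis using \<sigma>0 unfolding \<sigma>_def[symmetric] x_def[symmetric] by (simp add: field_simps)
  qed
  have C0: "co (Suc M) \<noteq> 0"
  proof
    assume "co (Suc M) = 0"
    then have "h (Suc M) (Suc M) + v (Suc M) (Suc M) = 0" unfolding hM' vM' by (simp add: algebra_simps)
    moreover have "h (Suc M) (Suc M) \<noteq> 0" using r0 by (auto simp: rad_def)
    ultimately show False using quad(1)[of "Suc M" "Suc M"] by blast
  qed
  have "0 < mid (Suc M)" unfolding mid' using mid0 r cs by (simp add: add_nonneg_pos)
  moreover have "level (c / 2) (Suc M) (co (Suc M)) (si (Suc M)) (c * mid (Suc M) / (4 * rad (Suc M)))"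
  proof (rule level_step[OF lev _ _ unitM' C0])
    show "0 < c / 2" using c by simp
    show "c * mid (Suc M) / (4 * rad (Suc M)) = (c * mid M / (4 * rad M) * co M + c / 2 / 2) / si M"
      unfolding mid' r' using cs r by (simp add: field_simps)
    show "1 + si M * co (Suc M) + co M * si (Suc M) \<noteq> 0" using \<sigma>0 by (simp add: \<sigma>_def)
    show "c * mid (Suc M) / (4 * rad (Suc M)) * (2 * (1 + si M * co (Suc M) + co M * si (Suc M))) = real (Suc M) * (co (Suc M) + si M)"
      using dPII r0 by (simp add: field_simps)
  qed
  ultimately show "diagonal (Suc M)"
    unfolding diagonal_def using r0 fM' mid' by simp
qed

text \<open>Positivity off the diagonal spreads from the diagonal kite, while the diagonal step
  needs a kite beside the diagonal, so all three properties advance together by two antidiagonals.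
  Symmetry reaches \<open>2 * M + 1\<close> because a quadrilateral based on antidiagonal L has its
  far corner on L + 2.\<close>

definition admissible :: "nat \<Rightarrow> bool" where
  "admissible M \<longleftrightarrow> (\<forall>n m. m0 \<le> n + m \<and> n + m < 2 * M \<longrightarrow> kite n m) \<and> (\<forall>L\<le>2 * M + 1. mirror L) \<and> diagonal M"

text \<open>Antidiagonal \<open>2 * M\<close> is filled outwards from \<open>(M, M)\<close>, the
  next one follows from its even neighbours, and its kite at \<open>(Suc M, M)\<close> permits the
  diagonal step.\<close>

lemma admissible_step:
  assumes "m0 \<le> M" and adm: "admissible M"
  shows "\<And>n m. n + m = 2 * M \<Longrightarrow> kite n m" "\<And>n m. n + m = Suc (2 * M) \<Longrightarrow> kite n m" "\<And>L. L \<le> 2 * M + 3 \<Longrightarrow> mirror L"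
    "admissible (Suc M)"
proof -
  have low: "\<And>n m. m0 \<le> n + m \<Longrightarrow> n + m < 2 * M \<Longrightarrow> kite n m" and s: "\<And>L. L \<le> 2 * M + 1 \<Longrightarrow> mirror L"
    and dg: "diagonal M" using adm by (auto simp: admissible_def)
  have kd: "kite M M" by (rule diagonal_kite(2)[OF dg]; rule s; simp)
  have eq_int: "cmod (h n (Suc m)) = cmod (v (Suc n) m)" if nm: "Suc (Suc (n + m)) = 2 * M" for n m
  proof (cases "m0 \<le> n + m")
    case True
    then have kk: "kite n m" using low nm by simp
    have ev: "even (n + m)" using nm by presburger
    show ?thesis using kite_evenE[OF kk ev] by (metis norm_minus_cancel norm_mult mult_minus_left)
  next
    \<comment> \<open>The degenerate corner of \<open>Z\<^sup>2\<close>: there is no kite at the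
      origin, and reflection alone gives the equality of lengths.\<close>
    case False
    then have "n = 0" "m = 0" "1 \<le> M" using m0 nm by auto
    have "v 1 0 = \<epsilon>\<^sup>2 * cnj (h 0 1)"
      using mirror_hv(2)[of 0 1] s[of 1] s[of 2] \<open>1 \<le> M\<close> by (simp add: numeral_2_eq_2)
    then show ?thesis using \<open>n = 0\<close> \<open>m = 0\<close> by (simp add: norm_mult norm_power unit)
  qed
  \<comment> \<open>Only the half below the diagonal is walked, since \<open>kite_even_step\<close>
    needs \<open>m \<le> n\<close>; the other half is its mirror image.\<close>
  have ev: "kite n m" if "m \<le> M" "n + m = 2 * M" for n m
    using that
  proof (induction m arbitrary: n rule: inc_induct)
    case base then show ?case using kd by simp
  next
    case (step m)
    define n' where "n' = n - 2"
    have n: "n = Suc (Suc n')" "m \<le> n'" using step by (simp_all add: n'_def)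
    have sum: "Suc (Suc (n' + m)) = 2 * M" using step n by simp
    have nm: "even (n' + m)" using sum by presburger
    have M1: "1 \<le> M" using sum by simp
    have kw: "kite (Suc n') (Suc m)" using step n by simp
    have ks: "kite (Suc n') m" "kite n' (Suc m)" using sum m0 by (auto intro!: low)
    note eqw = equi_interior[OF nm ks(2) ks(1) eq_int[OF sum]]
    have eqs: "cmod (h (Suc (Suc n')) m) = cmod (v (Suc (Suc n')) m)"
    proof (cases m)
      case 0
      have "odd (Suc n')" using nm 0 by simp
      then show ?thesis using equi_axis[of "Suc n'"] ks(1) 0 by simp
    next
      case (Suc m')
      have sum': "Suc (Suc (Suc n' + m')) = 2 * M" using sum Suc by simp
      have "even (Suc n' + m')" using sum' by presburger
      moreover have "kite (Suc n') (Suc m')" "kite (Suc (Suc n')) m'" using sum' m0 by (auto intro!: low)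
      ultimately show ?thesis using equi_interior[of "Suc n'" m'] eq_int[OF sum'] Suc by simp
    qed
    show ?case unfolding n(1)
      by (rule kite_even_step[OF nm n(2) kw ks _ eqs]) (use eqw eq_int[OF sum] in simp)
  qed
  show even: "kite n m" if "n + m = 2 * M" for n m
  proof (cases "m \<le> M")
    case False
    then have "kite m n" using ev[of n m] that ev[of n m] by (intro ev) auto
    then show ?thesis by (rule kite_swap; use that in \<open>simp add: s add.commute\<close>)
  qed (use ev that in blast)
  show odd: "kite n m" if nm: "n + m = Suc (2 * M)" for n m
  proof (cases "n = 0 \<or> m = 0")
    case True
    have m0M: "m0 \<le> 2 * M" using assms(1) by simp
    show ?thesis using True
    proof
      assume "n = 0"
      then show ?thesis using kite_odd_axis(2)[of "2 * M"] m0M even[of 0 "2 * M"] nm by simp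
    next
      assume "m = 0"
      then show ?thesis using kite_odd_axis(1)[of "2 * M"] m0M even[of "2 * M" 0] nm by simp
    qed
  next
    case False
    then obtain n' m' where *: "n = Suc n'" "m = Suc m'" by (meson not0_implies_Suc)
    have "odd (n' + m')" using nm unfolding * by presburger
    moreover have "kite n' (Suc m')" "kite (Suc n') m'" using nm * by (auto intro!: even)
    moreover have "kite n' m'"
      by (rule low) (use \<open>odd (n' + m')\<close> nm m0 * in \<open>auto elim: oddE\<close>)
    ultimately show ?thesis unfolding * by (intro kite_odd_interior)
  qed
  have s2: "mirror (Suc (Suc (2 * M)))" by (rule mirror_step) (use s even in auto)
  have s3: "mirror (Suc (Suc (Suc (2 * M))))" by (rule mirror_step) (use s s2 odd in auto)
  show s': "mirror L" if "L \<le> 2 * M + 3" for L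
  proof -
    have "L \<le> 2 * M + 1 \<or> L = Suc (Suc (2 * M)) \<or> L = Suc (Suc (Suc (2 * M)))" using that by linarith
    then show ?thesis using s s2 s3 by blast
  qed
  have dg': "diagonal (Suc M)"
  proof (rule diagonal_step(1)[OF dg])
    show "mirror L" if "L \<le> M + M + 3" for L using that by (intro s') simp
    show "kite (Suc M) M" by (rule odd) simp
  qed
  show "admissible (Suc M)"
    unfolding admissible_def
  proof (intro conjI allI impI)
    fix n m assume nm: "m0 \<le> n + m \<and> n + m < 2 * Suc M"
    then have "n + m < 2 * M \<or> n + m = 2 * M \<or> n + m = Suc (2 * M)" by auto
    then show "kite n m" using low nm even odd by blast
  qed (use s' dg' in auto)
qed

end

section \<open>Radii away from the diagonal\<close>

text \<open>Schramm's equation is linear in each ratio. The coefficient \<open>den\<close> of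
  \<open>e\<close> tends to 2, so solving for \<open>e\<close> is eventually legitimate and
  continuous.\<close>

lemma fourth_ratio_tendsto:
  fixes u d w e :: "nat \<Rightarrow> real"
  assumes lim: "u \<longlonglongrightarrow> 1" "d \<longlonglongrightarrow> 1" "w \<longlonglongrightarrow> 1"
    and eq: "\<forall>\<^sub>F M in sequentially. u M + d M + e M + w M = u M * d M * e M + u M * d M * w M + u M * e M * w M + d M * e M * w M"
  shows "e \<longlonglongrightarrow> 1"
proof -
  define den where "den M = u M * d M + u M * w M + d M * w M - 1" for M
  have den: "den \<longlonglongrightarrow> 2"
    unfolding den_def by (rule tendsto_eq_intros lim refl | simp)+
  have "(\<lambda>M. (u M + d M + w M - u M * d M * w M) / den M) \<longlonglongrightarrow> 1"
    by (rule tendsto_eq_intros lim den refl | simp)+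
  moreover have "\<forall>\<^sub>F M in sequentially. (u M + d M + w M - u M * d M * w M) / den M = e M"
    using eq order_tendstoD(1)[OF den, of 0, simplified]
  proof eventually_elim
    case (elim M)
    then have "e M * den M = u M + d M + w M - u M * d M * w M" by (simp add: den_def algebra_simps)
    with elim(2) show ?case by (simp add: field_simps)
  qed
  ultimately show ?thesis by (rule Lim_transform_eventually)
qed

text \<open>On the diagonal reflection identifies the two lateral ratios, so the equation becomes
  quadratic; positivity selects the root \<open>y + sqrt (y^2 + 1)\<close>, and \<open>y\<close>
  tends to 0.\<close>

lemma equal_ratios_tendsto:
  fixes u d e :: "nat \<Rightarrow> real"
  assumes lim: "u \<longlonglongrightarrow> 1" "d \<longlonglongrightarrow> 1"
    and pos: "\<forall>\<^sub>F M in sequentially. 0 < e M"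
    and eq: "\<forall>\<^sub>F M in sequentially. u M + d M + e M + e M = u M * d M * e M + u M * d M * e M + u M * e M * e M + d M * e M * e M"
  shows "e \<longlonglongrightarrow> 1"
proof -
  define y where "y M = (1 - u M * d M) / (u M + d M)" for M
  have ud: "(\<lambda>M. u M + d M) \<longlonglongrightarrow> 2" by (rule tendsto_eq_intros lim refl | simp)+
  have "(\<lambda>M. y M + sqrt ((y M)\<^sup>2 + 1)) \<longlonglongrightarrow> 1"
    unfolding y_def by (rule tendsto_eq_intros lim refl | simp)+
  moreover have "\<forall>\<^sub>F M in sequentially. y M + sqrt ((y M)\<^sup>2 + 1) = e M"
    using eq pos order_tendstoD(1)[OF ud, of 0, simplified]
  proof eventually_elim
    case (elim M)
    have "(u M + d M) * ((e M)\<^sup>2 - 1) = 2 * e M * (1 - u M * d M)"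
      using elim(1) by (simp add: power2_eq_square algebra_simps)
    then have q: "(e M)\<^sup>2 - 1 = 2 * e M * y M" using elim(3) by (simp add: y_def field_simps)
    then have "(e M - y M)\<^sup>2 = (y M)\<^sup>2 + 1" by (simp add: power2_eq_square algebra_simps)
    moreover have "0 \<le> e M - y M"
    proof (rule ccontr)
      assume "\<not> 0 \<le> e M - y M"
      then have "e M * e M < e M * y M" using elim(2) by (auto intro: mult_strict_left_mono)
      moreover have "e M * e M - 1 = 2 * (e M * y M)" using q by (simp add: power2_eq_square)
      moreover have "0 < e M * e M" using elim(2) by simp
      ultimately show False by linarith
    qed
    ultimately have "sqrt ((y M)\<^sup>2 + 1) = e M - y M" by (rule real_sqrt_unique)
    then show ?case by simp
  qed
  ultimately show ?thesis by (rule Lim_transform_eventually)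
qed

text \<open>The start of the induction stays open: it is level 0 for \<open>Z\<^sup>c\<close> and
  level 1 for \<open>Z\<^sup>2\<close>.\<close>

locale discrete_power_map = discrete_power +
  assumes init: "admissible m0"
begin

lemma admissible_all: "m0 \<le> M \<Longrightarrow> admissible M"
  by (induction M rule: dec_induct) (use init admissible_step(4) in auto)

lemma kite_all:
  assumes "m0 \<le> n + m"
  shows "kite n m"
proof (cases "even (n + m)")
  case True
  then obtain M where M: "n + m = 2 * M" by (elim evenE)
  then have "m0 \<le> M" using assms m0 by linarith
  then show ?thesis using admissible_step(1) admissible_all M by blast
next
  case False
  then obtain M where M: "n + m = Suc (2 * M)" by (elim oddE) simp
  show ?thesis
  proof (cases "m0 \<le> M")
    case True then show ?thesis using admissible_step(2) admissible_all M by blast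
  next
    case False
    then have "m0 = 1" "M = 0" using m0 by auto
    moreover have "\<forall>n m. m0 \<le> n + m \<and> n + m < 2 * m0 \<longrightarrow> kite n m"
      using init unfolding admissible_def by blast
    ultimately show ?thesis using M by simp
  qed
qed

lemma mirror_all: "mirror L"
proof -
  have "admissible (Suc L)" using admissible_all m0 by simp
  then show ?thesis by (auto simp: admissible_def)
qed

lemma diagonal_all: "1 \<le> M \<Longrightarrow> diagonal M"
  using admissible_all[of M] m0 by (auto simp: admissible_def)

lemma equi_all:
  assumes "even (n + m)"
  shows "cmod (h n (Suc m)) = cmod (v (Suc n) m)"
proof (cases "m0 \<le> n + m")
  case True
  then show ?thesis
    using kite_evenE[OF kite_all[OF True] assms] by (metis norm_minus_cancel norm_mult mult_minus_left)
next
  case False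
  then have "n = 0" "m = 0" using m0 by auto
  then show ?thesis using mirror_hv(2)[OF mirror_all mirror_all, where n = 0 and m = 1] by (simp add: norm_mult norm_power unit)
qed

lemma equi_edges:
  assumes "even (n + m)"
  shows "cmod (h n (Suc m)) = cmod (h (Suc n) (Suc m))" "cmod (v (Suc n) m) = cmod (h (Suc n) (Suc m))"
    "cmod (v (Suc n) (Suc m)) = cmod (h (Suc n) (Suc m))"
proof -
  have "kite n (Suc m)" "kite (Suc n) m" using m0 by (auto intro!: kite_all)
  from equi_interior[OF assms this equi_all[OF assms]] equi_all[OF assms]
  show "cmod (h n (Suc m)) = cmod (h (Suc n) (Suc m))" "cmod (v (Suc n) m) = cmod (h (Suc n) (Suc m))"
    "cmod (v (Suc n) (Suc m)) = cmod (h (Suc n) (Suc m))" by simp_all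
qed

definition g :: "nat \<Rightarrow> nat \<Rightarrow> real" where "g n m = cmod (h n m)"

lemma g_pos: "m0 \<le> n + m \<Longrightarrow> 0 < g n m"
  using kite_all by (auto simp: g_def kite_def)

lemma g_swap:
  assumes "even (n + m)" "m0 \<le> n + m"
  shows "g m n = g n m"
proof -
  have "cmod (v n m) = cmod (h n m)" using kite_evenE[OF kite_all[OF assms(2)] assms(1)] by metis
  then show ?thesis
    using mirror_hv(1)[OF mirror_all mirror_all, of m n] by (simp add: g_def norm_mult norm_power unit)
qed

text \<open>The four edges at the centre close up after one turn. Multiplying the four half-angle
  relations between consecutive edges cancels the edges, and the imaginary part of what is left is
  the equation for the radius ratios \<open>t\<close>, \<open>1 / \<tau>\<close>,
  \<open>1 / \<kappa>\<close> and \<open>\<kappa>'\<close>.\<close>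

lemma schramm:
  assumes ev: "even (n + m)" and nm: "m0 \<le> n + m"
  defines "x \<equiv> g (Suc n) (Suc m)"
  defines "u \<equiv> g (Suc (Suc n)) (Suc (Suc m)) / x" and "b \<equiv> g n m / x"
    and "e \<equiv> g (Suc (Suc n)) m / x" and "w \<equiv> g n (Suc (Suc m)) / x"
  shows "u + b + e + w = u * b * e + u * b * w + u * e * w + b * e * w"
proof -
  have x0: "0 < x" unfolding x_def by (rule g_pos) (use m0 in simp)
  note eq = equi_edges[OF ev, folded g_def, folded x_def]
  obtain t where t: "0 < t" "v (Suc n) (Suc m) * (1 - \<i> * of_real t) = h (Suc n) (Suc m) * (1 + \<i> * of_real t)"
    "v (Suc (Suc n)) (Suc m) = \<i> * of_real t * h (Suc n) (Suc m)"
    using kite_evenE[OF kite_all[of "Suc n" "Suc m"]] ev m0 by (metis add_Suc add_Suc_right even_Suc le_SucI le_add1 le_trans plus_1_eq_Suc)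
  obtain \<tau> where tau: "0 < \<tau>" "v n m * (1 - \<i> * of_real \<tau>) = h n m * (1 + \<i> * of_real \<tau>)"
    "v (Suc n) m = \<i> * of_real \<tau> * h n m" "h n (Suc m) = - \<i> * of_real \<tau> * v n m"
    using kite_evenE[OF kite_all[OF nm] ev] by metis
  have od: "odd (Suc n + m)" "odd (n + Suc m)" "m0 \<le> Suc n + m" "m0 \<le> n + Suc m" using ev nm by auto
  obtain \<kappa> where k: "0 < \<kappa>" "h (Suc n) (Suc m) * (1 + \<i> * of_real \<kappa>) = v (Suc n) m * (1 - \<i> * of_real \<kappa>)"
    "v (Suc (Suc n)) m = \<i> / of_real \<kappa> * h (Suc n) (Suc m)"
    using kite_oddE[OF kite_all[OF od(3)] od(1)] by metis
  obtain \<kappa>' where k': "0 < \<kappa>'" "v (Suc n) (Suc m) * (1 + \<i> * of_real \<kappa>') = - h n (Suc m) * (1 - \<i> * of_real \<kappa>')"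
    "v n (Suc m) = \<i> * of_real \<kappa>' * h n (Suc m)" "cmod (h n (Suc (Suc m))) = cmod (v n (Suc m))"
    using kite_oddE[OF kite_all[OF od(4)] od(2)] by metis
  have "even (Suc n + Suc m)" using ev by simp
  have u: "u = t"
  proof -
    have "g (Suc (Suc n)) (Suc (Suc m)) = cmod (v (Suc (Suc n)) (Suc m))"
      using equi_edges(2)[OF \<open>even (Suc n + Suc m)\<close>] by (simp add: g_def)
    also have "\<dots> = t * x" unfolding t(3) using t(1) by (simp add: norm_mult x_def g_def)
    finally show ?thesis using x0 by (simp add: u_def)
  qed
  have b: "b = 1 / \<tau>"
  proof -
    have "x = \<tau> * g n m" using eq(2) unfolding tau(3) using tau(1) by (simp add: norm_mult g_def)
    moreover have "0 < g n m" using g_pos[OF nm] .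
    ultimately show ?thesis using tau(1) by (simp add: b_def)
  qed
  have e: "e = 1 / \<kappa>"
  proof -
    have "even (Suc (Suc n) + m)" "m0 \<le> Suc (Suc n) + m" using ev nm by auto
    then have "g (Suc (Suc n)) m = cmod (v (Suc (Suc n)) m)" using kite_evenE[OF kite_all] unfolding g_def by metis
    also have "\<dots> = x / \<kappa>" unfolding k(3) using k(1) by (simp add: norm_mult norm_divide x_def g_def)
    finally show ?thesis using x0 by (simp add: e_def)
  qed
  have w: "w = \<kappa>'"
  proof -
    have "g n (Suc (Suc m)) = \<kappa>' * x"
      unfolding g_def k'(4) unfolding k'(3) using k'(1) eq(1) by (simp add: norm_mult g_def)
    then show ?thesis using x0 by (simp add: w_def)
  qed
  have hl: "h n (Suc m) * (1 - \<i> * of_real \<tau>) = - v (Suc n) m * (1 + \<i> * of_real \<tau>)"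
  proof -
    have "h n (Suc m) * (1 - \<i> * of_real \<tau>) = - \<i> * of_real \<tau> * (v n m * (1 - \<i> * of_real \<tau>))"
      unfolding tau(4) by (simp only: mult.assoc)
    also have "\<dots> = - v (Suc n) m * (1 + \<i> * of_real \<tau>)"
      unfolding tau(2) unfolding tau(3) by (simp add: algebra_simps)
    finally show ?thesis .
  qed
  define hw vw vb hl' where "hw = h (Suc n) (Suc m)" and "vw = v (Suc n) (Suc m)" and "vb = v (Suc n) m" and "hl' = h n (Suc m)"
  define T T' K K' U U' L L' where "T = 1 + \<i> * of_real t" and "T' = 1 - \<i> * of_real t"
    and "K = 1 + \<i> * of_real \<kappa>" and "K' = 1 - \<i> * of_real \<kappa>"
    and "U = 1 + \<i> * of_real \<tau>" and "U' = 1 - \<i> * of_real \<tau>"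
    and "L = 1 + \<i> * of_real \<kappa>'" and "L' = 1 - \<i> * of_real \<kappa>'"
  have nz: "hw \<noteq> 0" using x0 by (auto simp: x_def g_def hw_def)
  have "hw * (K * U * L' * T') = hw * (K' * U' * L * T)"
  proof -
    have 1: "vw * T' = hw * T" "hw * K = vb * K'" "vw * L = - hl' * L'" "hl' * U' = - vb * U"
      using t(2) k(2) k'(2) hl unfolding hw_def vw_def vb_def hl'_def T_def T'_def K_def K'_def U_def U'_def L_def L'_def by auto
    have "hw * (K * U * L' * T') = K' * (vb * U) * L' * T'" using 1(2) by (simp add: mult_ac)
    also have "vb * U = - hl' * U'" using 1(4) by simp
    also have "K' * (- hl' * U') * L' * T' = K' * U' * T' * (- hl' * L')" by (simp add: mult_ac)
    also have "\<dots> = K' * U' * L * (vw * T')" unfolding 1(3)[symmetric] by (simp add: mult_ac)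
    also have "\<dots> = hw * (K' * U' * L * T)" unfolding 1(1) by (simp add: mult_ac)
    finally show ?thesis .
  qed
  then have "K * U * L' * T' = K' * U' * L * T" using nz by simp
  then have "Im (K * U * L' * T') = Im (K' * U' * L * T)" by simp
  then have "\<kappa> + \<tau> - \<kappa>' - t + \<kappa> * \<tau> * \<kappa>' + \<kappa> * \<tau> * t - \<kappa> * \<kappa>' * t - \<tau> * \<kappa>' * t = 0"
    unfolding K_def K'_def U_def U'_def L_def L'_def T_def T'_def by (simp add: algebra_simps)
  then show ?thesis unfolding u b e w using k(1) tau(1) by (simp add: field_simps)
qed

text \<open>A natural index suffices, because reflection gives the radii on the other side of the
  diagonal the same values.\<close>

definition \<rho> :: "nat \<Rightarrow> nat \<Rightarrow> real" where "\<rho> N M = g (M + N) (M - N)"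

lemma \<rho>_0: "\<rho> 0 M = rad M"
  by (simp add: \<rho>_def g_def rad_def)

lemma \<rho>_pos: "N \<le> M \<Longrightarrow> 1 \<le> M \<Longrightarrow> 0 < \<rho> N M"
  unfolding \<rho>_def by (rule g_pos) (use m0 in simp)

lemma radius_\<rho>:
  assumes "N \<le> M" "1 \<le> M"
  shows "radius f (int N) (int M) = \<rho> N M" "radius f (- int N) (int M) = \<rho> N M"
proof -
  have nats: "nat (int M + int N) = M + N" "nat (int M - int N) = M - N" using assms by auto
  show "radius f (int N) (int M) = \<rho> N M"
    by (simp add: radius_def nats \<rho>_def g_def h_def)
  have "radius f (- int N) (int M) = g (M - N) (M + N)"
    by (simp add: radius_def nats g_def h_def)
  also have "\<dots> = \<rho> N M" unfolding \<rho>_def by (rule g_swap) (use assms m0 in auto)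
  finally show "radius f (- int N) (int M) = \<rho> N M" .
qed

text \<open>The neighbour towards the diagonal is written with \<open>g\<close> since for
  \<open>N = 0\<close> it lies beyond the diagonal, outside the indexing of
  \<open>\<rho>\<close>.\<close>

lemma schramm_\<rho>:
  assumes "Suc N < M"
  shows "\<rho> N (Suc M) / \<rho> N M + \<rho> N (M - 1) / \<rho> N M + \<rho> (Suc N) M / \<rho> N M + g (M + N - 1) (M - N + 1) / \<rho> N M
    = \<rho> N (Suc M) / \<rho> N M * (\<rho> N (M - 1) / \<rho> N M) * (\<rho> (Suc N) M / \<rho> N M)
    + \<rho> N (Suc M) / \<rho> N M * (\<rho> N (M - 1) / \<rho> N M) * (g (M + N - 1) (M - N + 1) / \<rho> N M)
    + \<rho> N (Suc M) / \<rho> N M * (\<rho> (Suc N) M / \<rho> N M) * (g (M + N - 1) (M - N + 1) / \<rho> N M)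
    + \<rho> N (M - 1) / \<rho> N M * (\<rho> (Suc N) M / \<rho> N M) * (g (M + N - 1) (M - N + 1) / \<rho> N M)"
proof -
  define n m where "n = M + N - 1" and "m = M - N - 1"
  have nm: "M + N = Suc n" "M - N = Suc m" "Suc M + N = Suc (Suc n)" "Suc M - N = Suc (Suc m)"
    "M - 1 + N = n" "M - 1 - N = m" "M + Suc N = Suc (Suc n)" "M - Suc N = m" "M - N + 1 = Suc (Suc m)"
    using assms by (auto simp: n_def m_def)
  have "n + m = 2 * (M - 1)" using assms by (simp add: n_def m_def)
  then have "even (n + m)" "m0 \<le> n + m" using m0 assms by simp_all
  then show ?thesis
    unfolding \<rho>_def nm n_def[symmetric] using schramm[of n m] by simp
qed

lemma rad_asymptotics:
  "\<exists>K>0. (\<lambda>M. rad M / real M powr (c - 1)) \<longlonglongrightarrow> K" "(\<lambda>M. rad (Suc M) / rad M) \<longlonglongrightarrow> 1"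
proof -
  have step: "rad (Suc M) = rad M * si M / co M" "mid (Suc M) = mid M + rad M / co M"
    "c * mid (Suc M) * (1 + si M * co (Suc M) + co M * si (Suc M)) = 2 * real (Suc M) * rad (Suc M) * (co (Suc M) + si M)"
    if "1 \<le> M" for M
    using diagonal_step[OF diagonal_all[OF that] mirror_all kite_all[of "Suc M" M]] m0 by auto
  have pos: "0 < co M \<and> 0 < si M \<and> (co M)\<^sup>2 + (si M)\<^sup>2 = 1" "0 < rad M \<and> 0 < mid M" if "1 \<le> M" for M
    using diagonal_all[OF that] that by (auto simp: diagonal_def level_def)
  show "\<exists>K>0. (\<lambda>M. rad M / real M powr (c - 1)) \<longlonglongrightarrow> K" "(\<lambda>M. rad (Suc M) / rad M) \<longlonglongrightarrow> 1"
    using dPII_asymptotics[where C = co and S = si and r = rad and F = mid and c = c, OF c pos step] by auto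
qed

text \<open>Ratios along \<open>M\<close> tend to 1 in every column already comparable to
  \<open>rad\<close>. Schramm's equation then carries the comparison sideways: quadratic from the
  diagonal to column 1, linear afterwards from two adjacent columns to the next.\<close>

lemma \<rho>_ratio: "(\<lambda>M. \<rho> N M / rad M) \<longlonglongrightarrow> 1"
proof -
  have vert: "(\<lambda>M. \<rho> N (Suc M) / \<rho> N M) \<longlonglongrightarrow> 1" "(\<lambda>M. \<rho> N (M - 1) / \<rho> N M) \<longlonglongrightarrow> 1"
    if lim: "(\<lambda>M. \<rho> N M / rad M) \<longlonglongrightarrow> 1" for N
  proof -
    have r: "(\<lambda>M. (\<rho> N (Suc M) / rad (Suc M)) * (rad (Suc M) / rad M) / (\<rho> N M / rad M)) \<longlonglongrightarrow> 1 * 1 / 1"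
      by (intro tendsto_divide tendsto_mult LIMSEQ_Suc[OF lim] rad_asymptotics(2) lim) simp
    have rp: "\<forall>\<^sub>F M in sequentially. 0 < rad M \<and> 0 < rad (Suc M)"
      using eventually_ge_at_top[of 1] by eventually_elim (use diagonal_all in \<open>auto simp: diagonal_def\<close>)
    have "\<forall>\<^sub>F M in sequentially. (\<rho> N (Suc M) / rad (Suc M)) * (rad (Suc M) / rad M) / (\<rho> N M / rad M) = \<rho> N (Suc M) / \<rho> N M"
      using rp by eventually_elim auto
    with r show 1: "(\<lambda>M. \<rho> N (Suc M) / \<rho> N M) \<longlonglongrightarrow> 1"
      using Lim_transform_eventually by fastforce
    have "(\<lambda>M. inverse (\<rho> N (Suc M) / \<rho> N M)) \<longlonglongrightarrow> inverse 1"
      by (rule tendsto_inverse[OF 1]) simp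
    then have "(\<lambda>M. \<rho> N (M + 1 - 1) / \<rho> N (M + 1)) \<longlonglongrightarrow> 1" by simp
    then show "(\<lambda>M. \<rho> N (M - 1) / \<rho> N M) \<longlonglongrightarrow> 1" by (rule LIMSEQ_offset)
  qed
  have next_ratio: "(\<lambda>M. \<rho> (Suc N) M / rad M) \<longlonglongrightarrow> 1"
    if lim: "(\<lambda>M. \<rho> N M / rad M) \<longlonglongrightarrow> 1" and e: "(\<lambda>M. \<rho> (Suc N) M / \<rho> N M) \<longlonglongrightarrow> 1" for N
  proof -
    have "(\<lambda>M. (\<rho> (Suc N) M / \<rho> N M) * (\<rho> N M / rad M)) \<longlonglongrightarrow> 1 * 1"
      by (intro tendsto_mult lim e)
    moreover have "\<forall>\<^sub>F M in sequentially. (\<rho> (Suc N) M / \<rho> N M) * (\<rho> N M / rad M) = \<rho> (Suc N) M / rad M"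
      using eventually_ge_at_top[of "Suc N"]
    proof eventually_elim
      case (elim M)
      then have "0 < \<rho> N M" by (intro \<rho>_pos) auto
      then show ?case by simp
    qed
    ultimately show ?thesis using Lim_transform_eventually by fastforce
  qed
  have "(\<lambda>M. \<rho> 0 M / rad M) \<longlonglongrightarrow> 1"
  proof (rule Lim_transform_eventually[OF tendsto_const])
    show "\<forall>\<^sub>F M in sequentially. 1 = \<rho> 0 M / rad M"
      using eventually_ge_at_top[of 1] by eventually_elim (use diagonal_all in \<open>auto simp: \<rho>_0 diagonal_def less_imp_neq[symmetric]\<close>)
  qed
  note base0 = this
  have "(\<lambda>M. \<rho> 1 M / \<rho> 0 M) \<longlonglongrightarrow> 1"
  proof (rule equal_ratios_tendsto[OF vert[OF base0]])
    show "\<forall>\<^sub>F M in sequentially. 0 < \<rho> 1 M / \<rho> 0 M"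
      using eventually_ge_at_top[of 1] by eventually_elim (simp add: \<rho>_pos)
    show "\<forall>\<^sub>F M in sequentially. \<rho> 0 (Suc M) / \<rho> 0 M + \<rho> 0 (M - 1) / \<rho> 0 M + \<rho> 1 M / \<rho> 0 M + \<rho> 1 M / \<rho> 0 M
      = \<rho> 0 (Suc M) / \<rho> 0 M * (\<rho> 0 (M - 1) / \<rho> 0 M) * (\<rho> 1 M / \<rho> 0 M)
      + \<rho> 0 (Suc M) / \<rho> 0 M * (\<rho> 0 (M - 1) / \<rho> 0 M) * (\<rho> 1 M / \<rho> 0 M)
      + \<rho> 0 (Suc M) / \<rho> 0 M * (\<rho> 1 M / \<rho> 0 M) * (\<rho> 1 M / \<rho> 0 M)
      + \<rho> 0 (M - 1) / \<rho> 0 M * (\<rho> 1 M / \<rho> 0 M) * (\<rho> 1 M / \<rho> 0 M)"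
      using eventually_ge_at_top[of 2]
    proof eventually_elim
      case (elim M)
      have "g (M - 1) (M + 1) = g (M + 1) (M - 1)" by (rule g_swap) (use elim m0 in auto)
      then have "g (M + 0 - 1) (M - 0 + 1) = \<rho> 1 M" by (simp add: \<rho>_def)
      then show ?case using schramm_\<rho>[of 0 M] elim by (simp only: One_nat_def)
    qed
  qed
  from next_ratio[of 0, OF base0] this have base1: "(\<lambda>M. \<rho> 1 M / rad M) \<longlonglongrightarrow> 1" by simp
  have "(\<lambda>M. \<rho> N M / rad M) \<longlonglongrightarrow> 1 \<and> (\<lambda>M. \<rho> (Suc N) M / rad M) \<longlonglongrightarrow> 1" for N
  proof (induction N)
    case 0 then show ?case using base0 base1 by simp
  next
    case (Suc N)
    then have l0: "(\<lambda>M. \<rho> N M / rad M) \<longlonglongrightarrow> 1" and l1: "(\<lambda>M. \<rho> (Suc N) M / rad M) \<longlonglongrightarrow> 1" by auto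
    have "(\<lambda>M. (\<rho> N M / rad M) / (\<rho> (Suc N) M / rad M)) \<longlonglongrightarrow> 1 / 1"
      by (intro tendsto_divide l0 l1) simp
    moreover have "\<forall>\<^sub>F M in sequentially. (\<rho> N M / rad M) / (\<rho> (Suc N) M / rad M) = \<rho> N M / \<rho> (Suc N) M"
      using eventually_ge_at_top[of 1] by eventually_elim (use diagonal_all in \<open>auto simp: diagonal_def less_imp_neq[symmetric]\<close>)
    ultimately have w: "(\<lambda>M. \<rho> N M / \<rho> (Suc N) M) \<longlonglongrightarrow> 1"
      using Lim_transform_eventually by fastforce
    have "(\<lambda>M. \<rho> (Suc (Suc N)) M / \<rho> (Suc N) M) \<longlonglongrightarrow> 1"
    proof (rule fourth_ratio_tendsto[OF vert[OF l1] w])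
      show "\<forall>\<^sub>F M in sequentially. \<rho> (Suc N) (Suc M) / \<rho> (Suc N) M + \<rho> (Suc N) (M - 1) / \<rho> (Suc N) M
          + \<rho> (Suc (Suc N)) M / \<rho> (Suc N) M + \<rho> N M / \<rho> (Suc N) M
        = \<rho> (Suc N) (Suc M) / \<rho> (Suc N) M * (\<rho> (Suc N) (M - 1) / \<rho> (Suc N) M) * (\<rho> (Suc (Suc N)) M / \<rho> (Suc N) M)
        + \<rho> (Suc N) (Suc M) / \<rho> (Suc N) M * (\<rho> (Suc N) (M - 1) / \<rho> (Suc N) M) * (\<rho> N M / \<rho> (Suc N) M)
        + \<rho> (Suc N) (Suc M) / \<rho> (Suc N) M * (\<rho> (Suc (Suc N)) M / \<rho> (Suc N) M) * (\<rho> N M / \<rho> (Suc N) M)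
        + \<rho> (Suc N) (M - 1) / \<rho> (Suc N) M * (\<rho> (Suc (Suc N)) M / \<rho> (Suc N) M) * (\<rho> N M / \<rho> (Suc N) M)"
        using eventually_gt_at_top[of "Suc (Suc N)"]
      proof eventually_elim
        case (elim M)
        have "M + Suc N - 1 = M + N" "M - Suc N + 1 = M - N" using elim by auto
        then have "g (M + Suc N - 1) (M - Suc N + 1) = \<rho> N M" by (simp only: \<rho>_def)
        then show ?case using schramm_\<rho>[of "Suc N" M] elim by simp
      qed
    qed
    then show ?case using next_ratio[OF l1] l1 by simp
  qed
  then show ?thesis by blast
qed

theorem radius_asymptotics:
  "\<exists>K>0. \<forall>N0::int. (\<lambda>M::nat. radius f N0 (int M) / (K * real M powr (c - 1))) \<longlonglongrightarrow> 1"
proof -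
  obtain K where K: "K > 0" "(\<lambda>M. rad M / real M powr (c - 1)) \<longlonglongrightarrow> K" using rad_asymptotics(1) by blast
  have "(\<lambda>M::nat. radius f N0 (int M) / (K * real M powr (c - 1))) \<longlonglongrightarrow> 1" for N0 :: int
  proof -
    define N where "N = nat \<bar>N0\<bar>"
    have "(\<lambda>M. (\<rho> N M / rad M) * (rad M / real M powr (c - 1)) / K) \<longlonglongrightarrow> 1 * K / K"
      by (intro tendsto_intros \<rho>_ratio K) (use K in simp)
    moreover have "\<forall>\<^sub>F M in sequentially. (\<rho> N M / rad M) * (rad M / real M powr (c - 1)) / K
        = radius f N0 (int M) / (K * real M powr (c - 1))"
      using eventually_ge_at_top[of "Suc N"]
    proof eventually_elim
      case (elim M)
      have "N0 = int N \<or> N0 = - int N" by (auto simp: N_def)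
      then have "radius f N0 (int M) = \<rho> N M" using radius_\<rho>[of N M] elim by auto
      moreover have "0 < rad M" using diagonal_all[of M] elim by (auto simp: diagonal_def)
      ultimately show ?case by (simp add: mult.commute)
    qed
    ultimately show ?thesis using K(1) Lim_transform_eventually by fastforce
  qed
  then show ?thesis using K(1) by blast
qed

end

section \<open>The discrete power maps\<close>

text \<open>The radius of the circle centred at axis vertex \<open>2 * k\<close>, with
  \<open>s = c / 2\<close>. For \<open>s = 1\<close> circle 0 degenerates to a point, the recursion
  has a zero denominator at \<open>k = 0\<close>, and circle 1 has the prescribed radius 1.\<close>

fun axis_radius :: "real \<Rightarrow> nat \<Rightarrow> real" where
  "axis_radius s 0 = (if s < 1 then 1 else 0)"
| "axis_radius s (Suc k) = (if s < 1 \<or> 0 < k then axis_radius s k * (real k + s) / (real k + 1 - s) else 1)"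

text \<open>Edges \<open>2 * k - 1\<close> and \<open>2 * k\<close> on the axis are radii of the
  same circle, hence the rounding.\<close>

definition axis_step :: "real \<Rightarrow> nat \<Rightarrow> real" where
  "axis_step s n = axis_radius s (Suc n div 2)"

lemma axis_radius_pos:
  assumes "0 < s" "s \<le> 1" "s < 1 \<or> 0 < k"
  shows "0 < axis_radius s k"
  using assms
proof (induction k)
  case (Suc k)
  then show ?case by (cases "s < 1 \<or> 0 < k") (auto intro!: divide_pos_pos mult_pos_pos)
qed auto

text \<open>At odd vertices the constraint yields the radius recursion, at even ones equality of the
  adjacent edges. It is assumed only where \<open>q (Suc n)\<close> is nonzero, since there the
  divided form implies the multiplied one: a zero denominator would give
  \<open>c * f = 0\<close>.\<close>

lemma axis_values:
  fixes q :: "nat \<Rightarrow> complex"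
  assumes s: "0 < s" "s \<le> 1" and "w \<noteq> 0"
    and init: "q 0 = 0" "s < 1 \<Longrightarrow> q 1 = w" "s = 1 \<Longrightarrow> q 1 = 0 \<and> q 2 = w"
    and constr: "\<And>n. q (Suc n) \<noteq> 0 \<Longrightarrow> of_real (2 * s) * q (Suc n) * (q (Suc (Suc n)) - q n)
      = 2 * of_nat (Suc n) * ((q (Suc (Suc n)) - q (Suc n)) * (q (Suc n) - q n))"
  shows "q (Suc n) = q n + w * of_real (axis_step s n)"
proof -
  define \<rho> where "\<rho> = axis_radius s"
  define P where "P k \<longleftrightarrow> q (2 * k) = w * of_real (real k * \<rho> k / s) \<and> q (Suc (2 * k)) = q (2 * k) + w * of_real (\<rho> k)" for k
  have odd_step: "q (Suc (Suc (2 * k))) = q (Suc (2 * k)) + w * of_real (\<rho> (Suc k)) \<and>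
      q (2 * Suc k) = w * of_real (real (Suc k) * \<rho> (Suc k) / s)"
    if Pk: "P k" and k: "s < 1 \<or> 0 < k" for k
  proof -
    have r: "0 < \<rho> k" using axis_radius_pos s k by (simp add: \<rho>_def)
    have q1: "q (Suc (2 * k)) = w * of_real ((real k + s) * \<rho> k / s)"
      using Pk s by (simp add: P_def field_simps)
    have kpos: "0 < (real k + s) * \<rho> k / s" using r s by simp
    then have q1n: "q (Suc (2 * k)) \<noteq> 0" unfolding q1 using \<open>w \<noteq> 0\<close> by (metis less_irrefl mult_eq_0_iff of_real_eq_0_iff)
    define X where "X = (q (Suc (Suc (2 * k))) - q (Suc (2 * k))) / w"
    have X: "q (Suc (Suc (2 * k))) - q (Suc (2 * k)) = w * X" using \<open>w \<noteq> 0\<close> by (simp add: X_def)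
    have d0: "q (Suc (2 * k)) - q (2 * k) = w * of_real (\<rho> k)" using Pk by (simp add: P_def)
    have d2: "q (Suc (Suc (2 * k))) - q (2 * k) = w * (X + of_real (\<rho> k))"
      using X d0 by (simp add: algebra_simps)
    have "of_real (2 * s) * (w * of_real ((real k + s) * \<rho> k / s)) * (w * (X + of_real (\<rho> k)))
      = 2 * of_nat (Suc (2 * k)) * ((w * X) * (w * of_real (\<rho> k)))"
      using constr[OF q1n] unfolding d2 X d0 unfolding q1 .
    moreover have "of_real (2 * s) * (w * of_real ((real k + s) * \<rho> k / s)) = w * of_real (2 * \<rho> k) * of_real (real k + s)"
    proof -
      have "2 * s * ((real k + s) * \<rho> k / s) = 2 * \<rho> k * (real k + s)" using s by simp
      then have "of_real (2 * s) * (of_real ((real k + s) * \<rho> k / s) :: complex) = of_real (2 * \<rho> k) * of_real (real k + s)"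
        by (simp only: of_real_mult[symmetric])
      then show ?thesis by (metis mult.left_commute mult.assoc)
    qed
    ultimately have "w * of_real (2 * \<rho> k) * of_real (real k + s) * (w * (X + of_real (\<rho> k)))
      = 2 * of_nat (Suc (2 * k)) * ((w * X) * (w * of_real (\<rho> k)))" by (simp only:)
    then have "w * w * of_real (2 * \<rho> k) * (of_real (real k + s) * (X + of_real (\<rho> k)))
      = w * w * of_real (2 * \<rho> k) * (of_nat (Suc (2 * k)) * X)"
      unfolding of_real_mult[of 2] by (simp only: of_real_numeral mult_ac)
    then have "of_real (real k + s) * (X + of_real (\<rho> k)) = of_nat (Suc (2 * k)) * X"
      using \<open>w \<noteq> 0\<close> r by simp
    then have "X * of_real (real k + 1 - s) = of_real ((real k + s) * \<rho> k)"
      by (simp add: algebra_simps)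
    moreover have k1: "0 < real k + 1 - s" using s k by auto
    ultimately have "X = of_real ((real k + s) * \<rho> k) / of_real (real k + 1 - s)"
      by (simp add: nonzero_eq_divide_eq del: of_real_add of_real_diff of_real_mult)
    also have "\<dots> = of_real (\<rho> (Suc k))" using k by (simp add: \<rho>_def mult.commute)
    finally have X': "X = of_real (\<rho> (Suc k))" .
    have \<rho>': "(real k + s) * \<rho> k = (real k + 1 - s) * \<rho> (Suc k)" using k k1 by (simp add: \<rho>_def)
    have "q (2 * Suc k) = q (Suc (2 * k)) + w * of_real (\<rho> (Suc k))" using X X' by (simp add: algebra_simps)
    also have "\<dots> = w * of_real ((real k + 1 - s) * \<rho> (Suc k) / s + \<rho> (Suc k))"
      unfolding q1 \<rho>' by (simp add: algebra_simps)
    also have "(real k + 1 - s) * \<rho> (Suc k) / s + \<rho> (Suc k) = real (Suc k) * \<rho> (Suc k) / s"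
      using s by (simp add: field_simps)
    finally show ?thesis using X X' by (simp add: algebra_simps)
  qed
  have even_step: "P (Suc k)"
    if "q (2 * Suc k) = w * of_real (real (Suc k) * \<rho> (Suc k) / s)"
      "q (Suc (Suc (2 * k))) = q (Suc (2 * k)) + w * of_real (\<rho> (Suc k))" for k
  proof -
    have r: "0 < \<rho> (Suc k)" using axis_radius_pos[of s "Suc k"] s by (simp add: \<rho>_def)
    have q2: "q (Suc (Suc (2 * k))) = w * of_real (real (Suc k) * \<rho> (Suc k) / s)" using that(1) by simp
    have "0 < real (Suc k) * \<rho> (Suc k) / s" using r s by simp
    then have q2n: "q (Suc (Suc (2 * k))) \<noteq> 0" unfolding q2 using \<open>w \<noteq> 0\<close> by (metis less_irrefl mult_eq_0_iff of_real_eq_0_iff)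
    define Y where "Y = (q (Suc (Suc (Suc (2 * k)))) - q (Suc (Suc (2 * k)))) / w"
    have Y: "q (Suc (Suc (Suc (2 * k)))) - q (Suc (Suc (2 * k))) = w * Y" using \<open>w \<noteq> 0\<close> by (simp add: Y_def)
    have d1: "q (Suc (Suc (2 * k))) - q (Suc (2 * k)) = w * of_real (\<rho> (Suc k))" using that(2) by simp
    have d2: "q (Suc (Suc (Suc (2 * k)))) - q (Suc (2 * k)) = w * (Y + of_real (\<rho> (Suc k)))"
      using Y d1 by (simp add: algebra_simps)
    have "of_real (2 * s) * (w * of_real (real (Suc k) * \<rho> (Suc k) / s)) * (w * (Y + of_real (\<rho> (Suc k))))
      = 2 * of_nat (Suc (Suc (2 * k))) * ((w * Y) * (w * of_real (\<rho> (Suc k))))"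
      using constr[OF q2n] unfolding d2 Y d1 unfolding q2 .
    moreover have "of_nat (Suc (Suc (2 * k))) = (2 * of_nat (Suc k) :: complex)" by simp
    moreover have "of_real (2 * s) * (w * of_real (real (Suc k) * \<rho> (Suc k) / s)) = w * of_real (2 * \<rho> (Suc k)) * of_nat (Suc k)"
    proof -
      have "2 * s * (real (Suc k) * \<rho> (Suc k) / s) = 2 * \<rho> (Suc k) * real (Suc k)" using s by simp
      then have "of_real (2 * s) * (of_real (real (Suc k) * \<rho> (Suc k) / s) :: complex) = of_real (2 * \<rho> (Suc k)) * of_real (real (Suc k))"
        by (simp only: of_real_mult[symmetric])
      then show ?thesis unfolding of_real_of_nat_eq by (metis mult.left_commute mult.assoc)
    qed
    ultimately have "w * of_real (2 * \<rho> (Suc k)) * of_nat (Suc k) * (w * (Y + of_real (\<rho> (Suc k))))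
      = 2 * (2 * of_nat (Suc k)) * ((w * Y) * (w * of_real (\<rho> (Suc k))))" by (simp only:)
    then have "w * w * of_real (2 * \<rho> (Suc k)) * of_nat (Suc k) * (Y + of_real (\<rho> (Suc k)))
      = w * w * of_real (2 * \<rho> (Suc k)) * of_nat (Suc k) * (2 * Y)"
      unfolding of_real_mult[of 2] by (simp only: of_real_numeral mult_ac)
    then have "Y = of_real (\<rho> (Suc k))" using \<open>w \<noteq> 0\<close> r by (simp del: of_nat_Suc)
    then show ?thesis using Y that(1) by (simp add: P_def algebra_simps)
  qed
  have P: "P k" if "s < 1 \<or> 0 < k" for k
    using that
  proof (induction k)
    case 0
    then show ?case using init s by (simp add: P_def \<rho>_def)
  next
    case (Suc k)
    show ?case
    proof (cases "s < 1 \<or> 0 < k")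
      case True
      then show ?thesis using odd_step[OF Suc.IH[OF True] True] even_step by blast
    next
      case False
      then have "k = 0" "s = 1" using s by auto
      then show ?thesis using init by (intro even_step) (simp_all add: \<rho>_def numeral_2_eq_2)
    qed
  qed
  show ?thesis
  proof (cases "s < 1 \<or> 1 < n")
    case True
    show ?thesis
    proof (cases "even n")
      case True
      then obtain k where k: "n = 2 * k" by (elim evenE)
      then have "P k" using \<open>s < 1 \<or> 1 < n\<close> by (intro P) auto
      then show ?thesis using k by (simp add: P_def axis_step_def \<rho>_def)
    next
      case False
      then obtain k where k: "n = Suc (2 * k)" by (elim oddE) simp
      then have "s < 1 \<or> 0 < k" using \<open>s < 1 \<or> 1 < n\<close> by auto
      then show ?thesis using odd_step[OF P] k by (simp add: axis_step_def \<rho>_def)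
    qed
  next
    case False
    then have "n = 0 \<or> n = 1" "s = 1" using s by auto
    then show ?thesis using init by (auto simp: axis_step_def numeral_2_eq_2)
  qed
qed

lemma axis_step_pos:
  assumes "0 < s" "s \<le> 1" "s < 1 \<or> 0 < n"
  shows "0 < axis_step s n"
  unfolding axis_step_def by (rule axis_radius_pos) (use assms in auto)

lemma axis_step_odd: "odd n \<Longrightarrow> axis_step s (Suc n) = axis_step s n"
  unfolding axis_step_def by (elim oddE) simp

text \<open>The convention \<open>x / 0 = 0\<close> does no harm: a cross-ratio of -1 and a nonzero
  left side of the axis constraint both exclude zero denominators. The diagonal starts from
  \<open>level_power\<close>.\<close>

lemma discrete_Zc_map:
  assumes c: "0 < c" "c < 2" and f: "is_Zc c f"
  shows "discrete_power_map c f (cis (c * pi / 4)) (axis_step (c / 2)) 0"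
proof -
  define \<epsilon> where "\<epsilon> = cis (c * pi / 4)"
  have cr: "((f n m - f (n+1) m) * (f (n+1) (m+1) - f n (m+1))) /
     ((f (n+1) m - f (n+1) (m+1)) * (f n (m+1) - f n m)) = -1" for n m
    using f by (simp add: is_Zc_def cross_ratio_cond_def)
  have co: "of_real c * f n m = term_n f n m + term_m f n m" for n m
    using f by (simp add: is_Zc_def constraint_cond_def)
  have f00: "f 0 0 = 0" "f 1 0 = 1" using f by (simp_all add: is_Zc_def)
  have f01: "f 0 1 = \<epsilon>\<^sup>2"
  proof -
    have "f 0 1 = cis (c * pi / 2)" using f unfolding is_Zc_def cis_conv_exp by (simp only: mult.commute)
    also have "\<dots> = \<epsilon>\<^sup>2" by (simp add: \<epsilon>_def power2_eq_square cis_mult mult.commute)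
    finally show ?thesis .
  qed
  have e0: "\<epsilon> \<noteq> 0" by (simp add: \<epsilon>_def)
  have axis_n: "f (Suc n) 0 = f n 0 + 1 * of_real (axis_step (c / 2) n)" for n
  proof (rule axis_values)
    fix n assume nz: "f (Suc n) 0 \<noteq> 0"
    have "of_real c * f (Suc n) 0 = 2 * of_nat (Suc n) * ((f (Suc (Suc n)) 0 - f (Suc n) 0) * (f (Suc n) 0 - f n 0)) / (f (Suc (Suc n)) 0 - f n 0)"
      using co[of "Suc n" 0] by (simp add: term_n_def term_m_def del: of_nat_Suc)
    moreover from this have "f (Suc (Suc n)) 0 - f n 0 \<noteq> 0" using nz c by auto
    ultimately show "of_real (2 * (c / 2)) * f (Suc n) 0 * (f (Suc (Suc n)) 0 - f n 0)
      = 2 * of_nat (Suc n) * ((f (Suc (Suc n)) 0 - f (Suc n) 0) * (f (Suc n) 0 - f n 0))" by simp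
  qed (use c f00 in auto)
  have axis_m: "f 0 (Suc n) = f 0 n + \<epsilon>\<^sup>2 * of_real (axis_step (c / 2) n)" for n
  proof (rule axis_values)
    fix n assume nz: "f 0 (Suc n) \<noteq> 0"
    have "of_real c * f 0 (Suc n) = 2 * of_nat (Suc n) * ((f 0 (Suc (Suc n)) - f 0 (Suc n)) * (f 0 (Suc n) - f 0 n)) / (f 0 (Suc (Suc n)) - f 0 n)"
      using co[of 0 "Suc n"] by (simp add: term_n_def term_m_def del: of_nat_Suc)
    moreover from this have "f 0 (Suc (Suc n)) - f 0 n \<noteq> 0" using nz c by auto
    ultimately show "of_real (2 * (c / 2)) * f 0 (Suc n) * (f 0 (Suc (Suc n)) - f 0 n)
      = 2 * of_nat (Suc n) * ((f 0 (Suc (Suc n)) - f 0 (Suc n)) * (f 0 (Suc n) - f 0 n))" by simp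
  qed (use c f00 f01 e0 in auto)
  interpret discrete_power c f \<epsilon> "axis_step (c / 2)" 0
  proof
    show "0 < c" "c \<le> 2" using c by auto
    show "cmod \<epsilon> = 1" by (simp add: \<epsilon>_def)
    show "0 < axis_step (c / 2) n" for n using c by (intro axis_step_pos) auto
    show "f (Suc n) 0 = f n 0 + of_real (axis_step (c / 2) n)" for n using axis_n by simp
    show "(f (Suc n) m - f n m) * (f (Suc n) (Suc m) - f n (Suc m)) +
        (f n (Suc m) - f n m) * (f (Suc n) (Suc m) - f (Suc n) m) = 0" for n m
    proof -
      define X Y where "X = (f n m - f (n+1) m) * (f (n+1) (m+1) - f n (m+1))"
        and "Y = (f (n+1) m - f (n+1) (m+1)) * (f n (m+1) - f n m)"
      have "X / Y = - 1" using cr[of n m] by (simp add: X_def Y_def)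
      then have "X = - Y" by (cases "Y = 0") (auto simp: field_simps)
      then show ?thesis unfolding X_def Y_def by (simp add: algebra_simps)
    qed
    fix n m A B X Y
    assume A: "A = f (Suc (Suc n)) (Suc m) - f n (Suc m)" and B: "B = f (Suc n) (Suc (Suc m)) - f (Suc n) m"
      and X: "X = 2 * of_nat (Suc n) * ((f (Suc (Suc n)) (Suc m) - f (Suc n) (Suc m)) * (f (Suc n) (Suc m) - f n (Suc m)))"
      and Y: "Y = 2 * of_nat (Suc m) * ((f (Suc n) (Suc (Suc m)) - f (Suc n) (Suc m)) * (f (Suc n) (Suc m) - f (Suc n) m))"
    have "of_real c * f (Suc n) (Suc m) = X / A + Y / B"
      using co[of "Suc n" "Suc m"] by (simp add: term_n_def term_m_def A B X Y del: of_nat_Suc)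
    then show "(A \<noteq> 0 \<longrightarrow> of_real c * f (Suc n) (Suc m) = X / A + Y / B) \<and>
        (A = 0 \<longrightarrow> X = 0 \<or> of_real c * f (Suc n) (Suc m) = Y / B)" by simp
  qed (use axis_m axis_step_odd f00 in auto)
  have h0: "h 0 0 = 1" using f00 by (simp add: h_def)
  have he: "h 0 0 / \<epsilon> = cis (- (c * pi / 4))" unfolding h0 \<epsilon>_def by (simp only: inverse_eq_divide[symmetric] cis_inverse)
  have r: "rad 0 = 1" "mid 0 = 0" "co 0 = cos (pi * (c / 2) / 2)" "si 0 = sin (pi * (c / 2) / 2)"
    using h0 f00 unfolding co_def si_def he by (simp_all add: rad_def mid_def mult.commute)
  have "diagonal 0"
    unfolding diagonal_def r using level_power[of "c / 2"] assms(1,2) f00 by simp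
  moreover have "mirror L" if "L \<le> 1" for L
    using that mirror_01 by (cases L) auto
  ultimately have "admissible 0" by (simp add: admissible_def)
  then show ?thesis
    unfolding \<epsilon>_def[symmetric] by unfold_locales
qed

text \<open>The first quadrilateral is degenerate, so level 1 is verified by hand;
  \<open>f 1 1 = 2 i / pi\<close> is the value that makes \<open>h 1 1\<close> agree with
  \<open>level_log\<close>.\<close>

lemma discrete_Z2_map:
  assumes f: "is_Z2 f"
  shows "discrete_power_map 2 f \<i> (axis_step 1) 1"
proof -
  have cr: "(f n m - f (n+1) m) * (f (n+1) (m+1) - f n (m+1)) = - ((f (n+1) m - f (n+1) (m+1)) * (f n (m+1) - f n m))" for n m
    using f by (simp add: is_Z2_def cross_ratio_cond_mult_def)
  have co: "(let A = f (n+1) m - f (n-1) m; B = f n (m+1) - f n (m-1);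
          X = 2 * of_nat n * ((f (n+1) m - f n m) * (f n m - f (n-1) m));
          Y = 2 * of_nat m * ((f n (m+1) - f n m) * (f n m - f n (m-1)))
      in if n = 0 \<and> m = 0 then of_real 2 * f n m = 0
         else if n = 0 then of_real 2 * f n m * B = Y
         else if m = 0 then of_real 2 * f n m * A = X
         else of_real 2 * f n m * A * B = X * B + Y * A)" for n m
    using f unfolding is_Z2_def constraint_cond_mult_def by blast
  have vals: "f 0 0 = 0" "f 1 0 = 0" "f 0 1 = 0" "f 2 0 = 1" "f 0 2 = -1" "f 1 1 = 2 * \<i> / of_real pi"
    using f by (simp_all add: is_Z2_def)
  have axis_n: "f (Suc n) 0 = f n 0 + 1 * of_real (axis_step 1 n)" for n
  proof (rule axis_values)
    fix n
    show "of_real (2 * 1) * f (Suc n) 0 * (f (Suc (Suc n)) 0 - f n 0)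
      = 2 * of_nat (Suc n) * ((f (Suc (Suc n)) 0 - f (Suc n) 0) * (f (Suc n) 0 - f n 0))"
      using co[of "Suc n" 0] by (simp add: Let_def del: of_nat_Suc)
  qed (use vals in auto)
  have axis_m: "f 0 (Suc n) = f 0 n + \<i>\<^sup>2 * of_real (axis_step 1 n)" for n
  proof (rule axis_values)
    fix n
    show "of_real (2 * 1) * f 0 (Suc n) * (f 0 (Suc (Suc n)) - f 0 n)
      = 2 * of_nat (Suc n) * ((f 0 (Suc (Suc n)) - f 0 (Suc n)) * (f 0 (Suc n) - f 0 n))"
      using co[of 0 "Suc n"] by (simp add: Let_def del: of_nat_Suc)
  qed (use vals in auto)
  interpret discrete_power 2 f "\<i>" "axis_step 1" 1
  proof
    show "0 < axis_step 1 n" if "1 \<le> n" for n using that by (intro axis_step_pos) auto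
    show "f (Suc n) 0 = f n 0 + of_real (axis_step 1 n)" for n using axis_n by simp
    show "(f (Suc n) m - f n m) * (f (Suc n) (Suc m) - f n (Suc m)) +
        (f n (Suc m) - f n m) * (f (Suc n) (Suc m) - f (Suc n) m) = 0" for n m
      using cr[of n m] by (simp add: algebra_simps)
    fix n m A B X Y
    assume A: "A = f (Suc (Suc n)) (Suc m) - f n (Suc m)" and B: "B = f (Suc n) (Suc (Suc m)) - f (Suc n) m"
      and X: "X = 2 * of_nat (Suc n) * ((f (Suc (Suc n)) (Suc m) - f (Suc n) (Suc m)) * (f (Suc n) (Suc m) - f n (Suc m)))"
      and Y: "Y = 2 * of_nat (Suc m) * ((f (Suc n) (Suc (Suc m)) - f (Suc n) (Suc m)) * (f (Suc n) (Suc m) - f (Suc n) m))"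
      and B0: "B \<noteq> 0"
    have "of_real 2 * f (Suc n) (Suc m) * A * B = X * B + Y * A"
      using co[of "Suc n" "Suc m"] by (simp add: Let_def A B X Y del: of_nat_Suc)
    then show "(A \<noteq> 0 \<longrightarrow> of_real 2 * f (Suc n) (Suc m) = X / A + Y / B) \<and>
        (A = 0 \<longrightarrow> X = 0 \<or> of_real 2 * f (Suc n) (Suc m) = Y / B)"
      using B0 by (auto simp: field_simps)
  qed (use axis_m axis_step_odd vals in auto)
  have hv: "h 1 0 = 1" "v 1 0 = 2 * \<i> / of_real pi" "h 0 1 = 2 * \<i> / of_real pi" "v 0 1 = - 1"
    using vals by (simp_all add: h_def v_def numeral_2_eq_2)
  have k10: "kite 1 0"
    unfolding kite_def hv by (auto intro!: exI[of _ "2 / pi"])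
  have k01: "kite 0 1"
    unfolding kite_def hv by (auto intro!: exI[of _ "pi / 2"])
  have k1: "kite n m" if "n + m = 1" for n m
  proof -
    have "n = 1 \<and> m = 0 \<or> n = 0 \<and> m = 1" using that by linarith
    then show ?thesis using k10 k01 by auto
  qed
  have s2: "mirror 2"
    unfolding mirror_def
  proof (intro allI impI)
    fix n m :: nat assume "n + m = 2"
    then consider "n = 0" | "m = 0" | "n = 1 \<and> m = 1" by linarith
    then show "f m n = \<i>\<^sup>2 * cnj (f n m)"
    proof cases
      case 3
      then show ?thesis using vals(6) by simp
    qed (simp_all only: mirror_axis[symmetric])
  qed
  have s3: "mirror (Suc (Suc 1))" by (rule mirror_step) (use s2 mirror_01 k1 in \<open>auto simp: numeral_2_eq_2\<close>)
  have syms: "mirror L" if "L \<le> 3" for L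
  proof -
    have "L = 0 \<or> L = Suc 0 \<or> L = 2 \<or> L = Suc (Suc 1)" using that by linarith
    then show ?thesis using mirror_01 s2 s3 by blast
  qed
  \<comment> \<open>The unit factor is \<open>(pi - 2 i) / (pi + 2 i)\<close>, the value at i of the
    function in \<open>level_log\<close>.\<close>
  have h11: "h 1 1 = \<i> * of_real (2 / pi) * (of_real ((pi\<^sup>2 - 4) / (pi\<^sup>2 + 4)) - \<i> * of_real (4 * pi / (pi\<^sup>2 + 4)))"
  proof -
    define P :: complex where "P = of_real pi"
    have v10: "v 1 0 = \<i> * of_real (2 / pi)" unfolding hv by simp
    have nz: "P \<noteq> 0" "P + 2 * \<i> \<noteq> 0" "P - 2 * \<i> \<noteq> 0" by (auto simp: P_def complex_eq_iff)
    have "h 1 (Suc 0) = - v 1 0 * ((v 1 0 - h 1 0) / (h 1 0 + v 1 0))" by (rule quad(3)) (use hv(1) in simp)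
    also have "(v 1 0 - h 1 0) / (h 1 0 + v 1 0) = - ((P - 2 * \<i>) / (P + 2 * \<i>))"
    proof -
      have "v 1 0 - h 1 0 = - (P - 2 * \<i>) / P" "h 1 0 + v 1 0 = (P + 2 * \<i>) / P"
        using nz unfolding hv P_def[symmetric] by (simp_all add: field_simps)
      then show ?thesis using nz by (simp add: minus_divide_left)
    qed
    also have "(P - 2 * \<i>) / (P + 2 * \<i>) = of_real ((pi\<^sup>2 - 4) / (pi\<^sup>2 + 4)) - \<i> * of_real (4 * pi / (pi\<^sup>2 + 4))"
    proof -
      have den: "of_real (pi\<^sup>2 + 4) = (P - 2 * \<i>) * (P + 2 * \<i>)"
        by (simp add: P_def power2_eq_square algebra_simps)
      have num: "of_real (pi\<^sup>2 - 4) - \<i> * of_real (4 * pi) = (P - 2 * \<i>) * (P - 2 * \<i>)"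
        by (simp add: P_def power2_eq_square algebra_simps)
      have "of_real ((pi\<^sup>2 - 4) / (pi\<^sup>2 + 4)) - \<i> * of_real (4 * pi / (pi\<^sup>2 + 4))
          = (of_real (pi\<^sup>2 - 4) - \<i> * of_real (4 * pi)) / of_real (pi\<^sup>2 + 4)"
        by (simp only: of_real_divide times_divide_eq_right diff_divide_distrib[symmetric])
      also have "\<dots> = (P - 2 * \<i>) / (P + 2 * \<i>)" unfolding den num using nz by simp
      finally show ?thesis by simp
    qed
    finally show ?thesis by (simp only: One_nat_def[symmetric] v10 minus_mult_minus)
  qed
  have "((pi\<^sup>2 - 4) / (pi\<^sup>2 + 4))\<^sup>2 + (4 * pi / (pi\<^sup>2 + 4))\<^sup>2 = 1"
    using level_log by (simp add: level_def)
  then have nrm: "cmod (of_real ((pi\<^sup>2 - 4) / (pi\<^sup>2 + 4)) - \<i> * of_real (4 * pi / (pi\<^sup>2 + 4))) = 1"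
    by (simp add: cmod_def)
  have r: "rad 1 = 2 / pi" unfolding rad_def h11 norm_mult nrm by (simp add: norm_divide)
  have hi: "h 1 1 / \<i> = of_real (2 / pi) * (of_real ((pi\<^sup>2 - 4) / (pi\<^sup>2 + 4)) - \<i> * of_real (4 * pi / (pi\<^sup>2 + 4)))"
    unfolding h11 by (simp only: mult.assoc nonzero_mult_div_cancel_left[OF complex_i_not_zero])
  have cs: "co 1 = (pi\<^sup>2 - 4) / (pi\<^sup>2 + 4)" "si 1 = 4 * pi / (pi\<^sup>2 + 4)"
  proof -
    have parts: "Re (of_real a * (of_real x - \<i> * of_real y)) = a * x" "Im (of_real a * (of_real x - \<i> * of_real y)) = - (a * y)"
      for a x y :: real by simp_all
    have a0: "2 / pi \<noteq> 0" by simp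
    show "co 1 = (pi\<^sup>2 - 4) / (pi\<^sup>2 + 4)" "si 1 = 4 * pi / (pi\<^sup>2 + 4)"
      unfolding co_def si_def r hi parts minus_minus by (rule nonzero_mult_div_cancel_left[OF a0])+
  qed
  have md: "mid 1 = 2 / pi" unfolding mid_def vals by simp
  have "diagonal 1"
    unfolding diagonal_def cs r md using level_log vals by simp
  then have "admissible 1"
    unfolding admissible_def using k1 syms by auto
  then show ?thesis by unfold_locales
qed

theorem theorem2:
  fixes c :: real and R :: "int \<Rightarrow> int \<Rightarrow> real"
  assumes "(0 < c \<and> c < 2 \<and> (\<exists>f. is_Zc c f \<and> R = radius f)) \<or>
           (c = 0 \<and> (\<exists>g. is_Z2 g \<and> R = (\<lambda>N M. 1 / radius g N M)))"
  shows "\<exists>K::real. \<forall>N0::int.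
           (\<lambda>M::nat. R N0 (int M) / (K * real M powr (c - 1))) \<longlonglongrightarrow> 1"
  using assms
proof
  assume "0 < c \<and> c < 2 \<and> (\<exists>f. is_Zc c f \<and> R = radius f)"
  then obtain f where "0 < c" "c < 2" "is_Zc c f" and R: "R = radius f" by blast
  then interpret discrete_power_map c f "cis (c * pi / 4)" "axis_step (c / 2)" 0
    by (intro discrete_Zc_map)
  show ?thesis unfolding R using radius_asymptotics by blast
next
  assume "c = 0 \<and> (\<exists>g. is_Z2 g \<and> R = (\<lambda>N M. 1 / radius g N M))"
  then obtain f where c0: "c = 0" and "is_Z2 f" and R: "R = (\<lambda>N M. 1 / radius f N M)" by blast
  then interpret discrete_power_map 2 f "\<i>" "axis_step 1" 1
    by (intro discrete_Z2_map)
  obtain K where K: "0 < K"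
    "\<And>N0::int. (\<lambda>M::nat. radius f N0 (int M) / (K * real M powr (2 - 1))) \<longlonglongrightarrow> 1"
    using radius_asymptotics by blast
  \<comment> \<open>The radii of \<open>Z\<^sup>2\<close> grow like \<open>K * M\<close>; their
    reciprocals behave like \<open>1 / K * M powr (- 1)\<close>, which is the exponent
    \<open>c - 1\<close> at \<open>c = 0\<close>.\<close>
  have "(\<lambda>M::nat. R N0 (int M) / (1 / K * real M powr (c - 1))) \<longlonglongrightarrow> 1" for N0 :: int
  proof (rule Lim_transform_eventually)
    show "(\<lambda>M::nat. inverse (radius f N0 (int M) / (K * real M powr (2 - 1)))) \<longlonglongrightarrow> 1"
      using tendsto_inverse[OF K(2)[of N0]] by simp
    show "\<forall>\<^sub>F M in sequentially. inverse (radius f N0 (int M) / (K * real M powr (2 - 1)))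
        = R N0 (int M) / (1 / K * real M powr (c - 1))"
      using eventually_ge_at_top[of 1]
      by eventually_elim (use K(1) in \<open>simp add: R c0 powr_minus field_simps\<close>)
  qed
  then show ?thesis by blast
qed

end
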